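(* There is no transitive model $M$ of ZFC in which both of the following hold: (a) every rigid-based construction in $M$ is uniformisable; (b) every unitype uniformisable construction in $M$ is weakly natural. In particular, there is no transitive model of ZFC in which the natural constructions are exactly the uniformisable ones.
   Context: Let $M$ be a transitive model of ZFC. A construction in $M$ is a triple $\mathbf{C}=\langle\phi_1,\phi_2,\phi_3\rangle$ of formulas of set theory (possibly with parameters from $M$) such that: $\phi_1$ and $\phi_2$ define first-order languages $L$ and $L^-$ in $M$, every symbol of $L^-$ is a symbol of $L$, and $L\setminus L^-$ contains a unary relation symbol $P$; the class $\{a: M\models\phi_3(a)\}$ (the graph of $\mathbf{C}$) is in $M$ a class of $L$-structures; for each $B$ in the graph, the set $P^B$ of elements satisfying $Px$ is the domain of an $L^-$-structure $B^-$ inside $B$, and the class of all such $B^-$ is the domain of $\mathbf{C}$; the domain is closed under isomorphism, and if $A,B$ are in the graph then every isomorphism from $A^-$ onto $B^-$ extends to an isomorphism from $A$ onto $B$. $\mathbf{C}$ is unitype if its domain contains exactly one isomorphism type. $\mathbf{C}$ is rigid-based if for every $B$ in the graph, $B^-$ has no nontrivial automorphisms. $\mathbf{C}$ is uniformisable (in $M$) if there is a formula $\phi_4(x,y)$ of set theory (possibly with parameters from $M$) such that for each $A$ in the domain there is a unique $B$ with $M\models\phi_4(A,B)$, and this $B$ is in the graph of $\mathbf{C}$ with $B^-=A$. For $B$ in the graph with $A=B^-$, restriction gives a surjective homomorphism $\nu_B:\mathrm{Aut}(B)\to\mathrm{Aut}(A)$. A splitting of a surjective homomorphism $\nu:G\to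 H$ is a homomorphism $s:H\to G$ with $\nu s=\mathrm{id}_H$. A weak splitting is a map $s:H\to G$ with $\nu s=\mathrm{id}_H$ such that there is a commutative subgroup $G_0\le G$ with $s(f_1)^{\varepsilon_1}\cdots s(f_k)^{\varepsilon_k}\in G_0$ whenever $f_i\in H$, $\varepsilon_i\in\{1,-1\}$ and $f_1^{\varepsilon_1}\cdots f_k^{\varepsilon_k}=1$. $\mathbf{C}$ is natural (resp. weakly natural) if for every $B$ in the graph, $\nu_B$ has a splitting (resp. weak splitting). *)

theory Defs
  imports "HOL-Algebra.Bij"
begin

text \<open>
  The ambient universe of sets is an arbitrary type with a well-founded extensional membership
  relation \<open>E\<close>, so that no set-theoretic strength is assumed outside the model.  A model is a
  subset \<open>M\<close> of this type; \<open>M = UNIV\<close> is allowed.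
\<close>

definition set_universe :: "('v \<Rightarrow> 'v \<Rightarrow> bool) \<Rightarrow> bool" where
  "set_universe E \<longleftrightarrow> wfP E \<and> (\<forall>x y. (\<forall>z. E z x \<longleftrightarrow> E z y) \<longrightarrow> x = y)"

datatype fm =
    FMem nat nat
  | FEq nat nat
  | FNot fm
  | FAnd fm fm
  | FAll nat fm

text \<open>
  A formula with parameters is a formula together with an assignment; free variables other than
  the displayed argument variables (0, or 0 and 1) take their values from the assignment.
\<close>

type_synonym 'v pfm = "fm \<times> (nat \<Rightarrow> 'v)"

text \<open>
  The symbol \<open>con_P\<close> is part of the data because \<open>L - L\<^sup>-\<close> may contain several unary
  relation symbols.
\<close>

record 'v construction =
  con_L :: "'v pfm"
  con_Lminus :: "'v pfm"
  con_graph :: "'v pfm"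
  con_P :: 'v

definition splitting :: "('a, 'x) monoid_scheme \<Rightarrow> ('b, 'y) monoid_scheme \<Rightarrow> ('a \<Rightarrow> 'b) \<Rightarrow> ('b \<Rightarrow> 'a) \<Rightarrow> bool"
  where "splitting G H \<nu> s \<longleftrightarrow> s \<in> hom H G \<and> (\<forall>h \<in> carrier H. \<nu> (s h) = h)"

primrec signed_prod :: "('a, 'x) monoid_scheme \<Rightarrow> ('h \<Rightarrow> 'a) \<Rightarrow> ('h \<times> int) list \<Rightarrow> 'a" where
  "signed_prod G s [] = \<one>\<^bsub>G\<^esub>"
| "signed_prod G s (p # w) = (s (fst p) [^]\<^bsub>G\<^esub> snd p) \<otimes>\<^bsub>G\<^esub> signed_prod G s w"

definition weak_splitting ::
  "('a, 'x) monoid_scheme \<Rightarrow> ('b, 'y) monoid_scheme \<Rightarrow> ('a \<Rightarrow> 'b) \<Rightarrow> ('b \<Rightarrow> 'a) \<Rightarrow> 'a set \<Rightarrow> bool"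
  where "weak_splitting G H \<nu> s G0 \<longleftrightarrow>
    s \<in> carrier H \<rightarrow> carrier G \<and> (\<forall>h \<in> carrier H. \<nu> (s h) = h) \<and>
    subgroup G0 G \<and> (\<forall>x \<in> G0. \<forall>y \<in> G0. x \<otimes>\<^bsub>G\<^esub> y = y \<otimes>\<^bsub>G\<^esub> x) \<and>
    (\<forall>w. set w \<subseteq> carrier H \<times> {1, -1} \<and> signed_prod H (\<lambda>h. h) w = \<one>\<^bsub>H\<^esub>
        \<longrightarrow> signed_prod G s w \<in> G0)"

context
  fixes E :: "'v \<Rightarrow> 'v \<Rightarrow> bool"  (infix "\<epsilon>" 50)
begin

definition elts :: "'v \<Rightarrow> 'v set" where
  "elts x = {y. y \<epsilon> x}"

definition is_pair :: "'v \<Rightarrow> 'v \<Rightarrow> 'v \<Rightarrow> bool" where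
  "is_pair p a b \<longleftrightarrow> (\<exists>s t. elts p = {s, t} \<and> elts s = {a} \<and> elts t = {a, b})"

definition pairs_in :: "'v \<Rightarrow> ('v \<times> 'v) set" where
  "pairs_in f = {(a, b). \<exists>p. p \<epsilon> f \<and> is_pair p a b}"

definition is_function :: "'v \<Rightarrow> 'v set \<Rightarrow> 'v set \<Rightarrow> bool" where
  "is_function f X Y \<longleftrightarrow>
     (\<forall>p. p \<epsilon> f \<longrightarrow> (\<exists>x \<in> X. \<exists>y \<in> Y. is_pair p x y)) \<and>
     (\<forall>x \<in> X. \<exists>!y. (x, y) \<in> pairs_in f)"

definition app :: "'v \<Rightarrow> 'v \<Rightarrow> 'v" where
  "app f x = (THE y. (x, y) \<in> pairs_in f)"

primrec is_num :: "nat \<Rightarrow> 'v \<Rightarrow> bool" where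
  "is_num 0 x \<longleftrightarrow> elts x = {}"
| "is_num (Suc n) x \<longleftrightarrow> (\<exists>y. is_num n y \<and> elts x = insert y (elts y))"

primrec is_tuple :: "'v list \<Rightarrow> 'v \<Rightarrow> bool" where
  "is_tuple [] t \<longleftrightarrow> elts t = {}"
| "is_tuple (x # xs) t \<longleftrightarrow> (\<exists>u. is_tuple xs u \<and> is_pair t x u)"

definition tuples :: "nat \<Rightarrow> 'v set \<Rightarrow> 'v set" where
  "tuples n X = {t. \<exists>xs. length xs = n \<and> set xs \<subseteq> X \<and> is_tuple xs t}"

text \<open>
  A symbol is a set \<open>\<langle>kind, \<langle>arity, name\<rangle>\<rangle>\<close>, of kind 0 for relation symbols and 1 for function
  symbols; constants are function symbols of arity 0.
\<close>

definition is_symbol :: "nat \<Rightarrow> nat \<Rightarrow> 'v \<Rightarrow> bool" where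
  "is_symbol k n s \<longleftrightarrow>
     (\<exists>kind ar name t. is_num k kind \<and> is_num n ar \<and> is_pair t ar name \<and> is_pair s kind t)"

abbreviation rel_symbol :: "nat \<Rightarrow> 'v \<Rightarrow> bool" where
  "rel_symbol \<equiv> is_symbol 0"

abbreviation fun_symbol :: "nat \<Rightarrow> 'v \<Rightarrow> bool" where
  "fun_symbol \<equiv> is_symbol 1"

text \<open>
  A structure for \<open>L\<close> is a pair \<open>\<langle>D, I\<rangle>\<close> with \<open>D\<close> nonempty and \<open>I\<close> a function on \<open>L\<close>.
\<close>

definition is_structure :: "'v set \<Rightarrow> 'v \<Rightarrow> bool" where
  "is_structure L B \<longleftrightarrow>
     (\<exists>D I. is_pair B D I \<and> elts D \<noteq> {} \<and> is_function I L UNIV \<and>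
       (\<forall>s \<in> L. \<forall>n. (rel_symbol n s \<longrightarrow> elts (app I s) \<subseteq> tuples n (elts D)) \<and>
                     (fun_symbol n s \<longrightarrow> is_function (app I s) (tuples n (elts D)) (elts D))))"

definition univ :: "'v \<Rightarrow> 'v set" where
  "univ B = {x. \<exists>D I. is_pair B D I \<and> x \<epsilon> D}"

definition rel_holds :: "'v \<Rightarrow> 'v \<Rightarrow> 'v list \<Rightarrow> bool" where
  "rel_holds B s xs \<longleftrightarrow> (\<exists>D I t. is_pair B D I \<and> is_tuple xs t \<and> t \<epsilon> app I s)"

definition fun_maps :: "'v \<Rightarrow> 'v \<Rightarrow> 'v list \<Rightarrow> 'v \<Rightarrow> bool" where
  "fun_maps B s xs y \<longleftrightarrow> (\<exists>D I t. is_pair B D I \<and> is_tuple xs t \<and> (t, y) \<in> pairs_in (app I s))"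

text \<open>
  \<open>is_minus L' P B A\<close>: the structure \<open>A\<close> is \<open>B\<^sup>-\<close>, the substructure of the \<open>L'\<close>-reduct of \<open>B\<close>
  with domain \<open>P\<^sup>B\<close>.
\<close>

definition is_minus :: "'v set \<Rightarrow> 'v \<Rightarrow> 'v \<Rightarrow> 'v \<Rightarrow> bool" where
  "is_minus L' P B A \<longleftrightarrow>
     is_structure L' A \<and> univ A = {x \<in> univ B. rel_holds B P [x]} \<and>
     (\<forall>s \<in> L'. \<forall>n. \<forall>xs. length xs = n \<and> set xs \<subseteq> univ A \<longrightarrow>
        (rel_symbol n s \<longrightarrow> (rel_holds A s xs \<longleftrightarrow> rel_holds B s xs)) \<and>
        (fun_symbol n s \<longrightarrow> (\<forall>y \<in> univ A. fun_maps A s xs y \<longleftrightarrow> fun_maps B s xs y)))"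

context
  fixes M :: "'v set"
begin

primrec sat :: "fm \<Rightarrow> (nat \<Rightarrow> 'v) \<Rightarrow> bool" where
  "sat (FMem i j) v \<longleftrightarrow> v i \<epsilon> v j"
| "sat (FEq i j) v \<longleftrightarrow> v i = v j"
| "sat (FNot \<phi>) v \<longleftrightarrow> \<not> sat \<phi> v"
| "sat (FAnd \<phi> \<psi>) v \<longleftrightarrow> sat \<phi> v \<and> sat \<psi> v"
| "sat (FAll i \<phi>) v \<longleftrightarrow> (\<forall>a \<in> M. sat \<phi> (v(i := a)))"

text \<open>
  The single axioms are given by their truth conditions in \<open>M\<close>, the two schemas via \<^term>\<open>sat\<close>.
\<close>

definition Extensionality_ax :: bool where
  "Extensionality_ax \<longleftrightarrow> (\<forall>x \<in> M. \<forall>y \<in> M. (\<forall>z \<in> M. z \<epsilon> x \<longleftrightarrow> z \<epsilon> y) \<longrightarrow> x = y)"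

definition Foundation_ax :: bool where
  "Foundation_ax \<longleftrightarrow>
     (\<forall>x \<in> M. (\<exists>y \<in> M. y \<epsilon> x) \<longrightarrow> (\<exists>y \<in> M. y \<epsilon> x \<and> \<not> (\<exists>z \<in> M. z \<epsilon> x \<and> z \<epsilon> y)))"

definition Pairing_ax :: bool where
  "Pairing_ax \<longleftrightarrow> (\<forall>a \<in> M. \<forall>b \<in> M. \<exists>c \<in> M. \<forall>x \<in> M. x \<epsilon> c \<longleftrightarrow> x = a \<or> x = b)"

definition Union_ax :: bool where
  "Union_ax \<longleftrightarrow> (\<forall>a \<in> M. \<exists>u \<in> M. \<forall>x \<in> M. x \<epsilon> u \<longleftrightarrow> (\<exists>y \<in> M. y \<epsilon> a \<and> x \<epsilon> y))"

definition Powerset_ax :: bool where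
  "Powerset_ax \<longleftrightarrow>
     (\<forall>a \<in> M. \<exists>p \<in> M. \<forall>x \<in> M. x \<epsilon> p \<longleftrightarrow> (\<forall>z \<in> M. z \<epsilon> x \<longrightarrow> z \<epsilon> a))"

definition Infinity_ax :: bool where
  "Infinity_ax \<longleftrightarrow>
     (\<exists>w \<in> M. (\<exists>e \<in> M. e \<epsilon> w \<and> (\<forall>z \<in> M. \<not> z \<epsilon> e)) \<and>
        (\<forall>y \<in> M. y \<epsilon> w \<longrightarrow> (\<exists>s \<in> M. s \<epsilon> w \<and> (\<forall>z \<in> M. z \<epsilon> s \<longleftrightarrow> z \<epsilon> y \<or> z = y))))"

definition Separation_schema :: bool where
  "Separation_schema \<longleftrightarrow>
     (\<forall>\<phi> v. range v \<subseteq> M \<longrightarrow>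
        (\<forall>a \<in> M. \<exists>b \<in> M. \<forall>x \<in> M. x \<epsilon> b \<longleftrightarrow> x \<epsilon> a \<and> sat \<phi> (v(0 := x))))"

definition Replacement_schema :: bool where
  "Replacement_schema \<longleftrightarrow>
     (\<forall>\<phi> v. range v \<subseteq> M \<longrightarrow>
        (\<forall>a \<in> M.
           (\<forall>x \<in> M. x \<epsilon> a \<longrightarrow>
              (\<forall>y \<in> M. \<forall>z \<in> M.
                 sat \<phi> (v(0 := x, 1 := y)) \<and> sat \<phi> (v(0 := x, 1 := z)) \<longrightarrow> y = z)) \<longrightarrow>
           (\<exists>b \<in> M. \<forall>y \<in> M. y \<epsilon> b \<longleftrightarrow> (\<exists>x \<in> M. x \<epsilon> a \<and> sat \<phi> (v(0 := x, 1 := y))))))"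

definition Choice_ax :: bool where
  "Choice_ax \<longleftrightarrow>
     (\<forall>a \<in> M.
        (\<forall>x \<in> M. x \<epsilon> a \<longrightarrow> (\<exists>z \<in> M. z \<epsilon> x)) \<and>
        (\<forall>x \<in> M. \<forall>y \<in> M. x \<epsilon> a \<and> y \<epsilon> a \<and> x \<noteq> y \<longrightarrow> \<not> (\<exists>z \<in> M. z \<epsilon> x \<and> z \<epsilon> y)) \<longrightarrow>
        (\<exists>c \<in> M. \<forall>x \<in> M. x \<epsilon> a \<longrightarrow> (\<exists>!z. z \<in> M \<and> z \<epsilon> x \<and> z \<epsilon> c)))"

definition ZFC_model :: bool where
  "ZFC_model \<longleftrightarrow>
     Extensionality_ax \<and> Foundation_ax \<and> Pairing_ax \<and> Union_ax \<and> Powerset_ax \<and>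
     Infinity_ax \<and> Separation_schema \<and> Replacement_schema \<and> Choice_ax"

definition transitive_ZFC_model :: bool where
  "transitive_ZFC_model \<longleftrightarrow> (\<forall>x \<in> M. elts x \<subseteq> M) \<and> ZFC_model"

definition pfm_over :: "'v pfm \<Rightarrow> bool" where
  "pfm_over \<psi> \<longleftrightarrow> range (snd \<psi>) \<subseteq> M"

definition holds1 :: "'v pfm \<Rightarrow> 'v \<Rightarrow> bool" where
  "holds1 \<psi> x \<longleftrightarrow> sat (fst \<psi>) ((snd \<psi>)(0 := x))"

definition holds2 :: "'v pfm \<Rightarrow> 'v \<Rightarrow> 'v \<Rightarrow> bool" where
  "holds2 \<psi> x y \<longleftrightarrow> sat (fst \<psi>) ((snd \<psi>)(0 := x, 1 := y))"

definition extent :: "'v pfm \<Rightarrow> 'v set" where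
  "extent \<psi> = {x \<in> M. holds1 \<psi> x}"

text \<open>
  Constructions are read inside the model: isomorphisms, automorphisms and splittings are
  required to be elements of \<open>M\<close>.  \<open>Aut\<close> decodes the automorphisms lying in \<open>M\<close> to
  permutations, in order to use the groups of the library.
\<close>

definition is_iso :: "'v set \<Rightarrow> 'v \<Rightarrow> 'v \<Rightarrow> 'v \<Rightarrow> bool" where
  "is_iso L A B f \<longleftrightarrow>
     f \<in> M \<and> is_function f (univ A) (univ B) \<and> bij_betw (app f) (univ A) (univ B) \<and>
     (\<forall>s \<in> L. \<forall>n. \<forall>xs. length xs = n \<and> set xs \<subseteq> univ A \<longrightarrow>
        (rel_symbol n s \<longrightarrow> (rel_holds A s xs \<longleftrightarrow> rel_holds B s (map (app f) xs))) \<and>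
        (fun_symbol n s \<longrightarrow>
          (\<forall>y \<in> univ A. fun_maps A s xs y \<longleftrightarrow> fun_maps B s (map (app f) xs) (app f y))))"

definition perm_of :: "'v \<Rightarrow> 'v \<Rightarrow> 'v \<Rightarrow> 'v" where
  "perm_of B f = restrict (app f) (univ B)"

definition Aut :: "'v set \<Rightarrow> 'v \<Rightarrow> ('v \<Rightarrow> 'v) monoid" where
  "Aut L B = (BijGroup (univ B)) \<lparr>carrier := perm_of B ` {f. is_iso L B B f}\<rparr>"

text \<open>
  \<open>map_in_model\<close> and \<open>set_in_model\<close> say that a map \<open>Aut A \<rightarrow> Aut B\<close>, respectively a subset of
  \<open>Aut B\<close>, is an element of \<open>M\<close>.
\<close>

definition map_in_model :: "'v set \<Rightarrow> 'v \<Rightarrow> 'v set \<Rightarrow> 'v \<Rightarrow> (('v \<Rightarrow> 'v) \<Rightarrow> 'v \<Rightarrow> 'v) \<Rightarrow> bool" where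
  "map_in_model L' A L B s \<longleftrightarrow>
     (\<exists>S \<in> M. pairs_in S =
        {(f, g). is_iso L' A A f \<and> is_iso L B B g \<and> s (perm_of A f) = perm_of B g})"

definition set_in_model :: "'v set \<Rightarrow> 'v \<Rightarrow> ('v \<Rightarrow> 'v) set \<Rightarrow> bool" where
  "set_in_model L B G0 \<longleftrightarrow>
     (\<exists>S \<in> M. elts S \<subseteq> {f. is_iso L B B f} \<and> G0 = perm_of B ` elts S)"

definition is_language :: "'v set \<Rightarrow> bool" where
  "is_language L \<longleftrightarrow>
     (\<exists>l \<in> M. elts l = L) \<and> (\<forall>s \<in> L. \<exists>n. rel_symbol n s \<or> fun_symbol n s)"

definition lang :: "'v construction \<Rightarrow> 'v set" where
  "lang C = extent (con_L C)"

definition lang_minus :: "'v construction \<Rightarrow> 'v set" where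
  "lang_minus C = extent (con_Lminus C)"

definition graph :: "'v construction \<Rightarrow> 'v set" where
  "graph C = extent (con_graph C)"

definition minus_of :: "'v construction \<Rightarrow> 'v \<Rightarrow> 'v \<Rightarrow> bool" where
  "minus_of C B A \<longleftrightarrow> A \<in> M \<and> is_minus (lang_minus C) (con_P C) B A"

definition con_domain :: "'v construction \<Rightarrow> 'v set" where
  "con_domain C = {A. \<exists>B \<in> graph C. minus_of C B A}"

definition is_construction :: "'v construction \<Rightarrow> bool" where
  "is_construction C \<longleftrightarrow>
     pfm_over (con_L C) \<and> pfm_over (con_Lminus C) \<and> pfm_over (con_graph C) \<and>
     is_language (lang C) \<and> is_language (lang_minus C) \<and> lang_minus C \<subseteq> lang C \<and>
     con_P C \<in> lang C - lang_minus C \<and> rel_symbol 1 (con_P C) \<and>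
     (\<forall>B \<in> graph C. is_structure (lang C) B \<and> (\<exists>A. minus_of C B A)) \<and>
     (\<forall>A \<in> con_domain C. \<forall>A' \<in> M. is_structure (lang_minus C) A' \<and>
        (\<exists>f. is_iso (lang_minus C) A A' f) \<longrightarrow> A' \<in> con_domain C) \<and>
     (\<forall>A \<in> graph C. \<forall>B \<in> graph C. \<forall>A' B' f.
        minus_of C A A' \<and> minus_of C B B' \<and> is_iso (lang_minus C) A' B' f \<longrightarrow>
        (\<exists>g. is_iso (lang C) A B g \<and> (\<forall>x \<in> univ A'. app g x = app f x)))"

definition unitype :: "'v construction \<Rightarrow> bool" where
  "unitype C \<longleftrightarrow> con_domain C \<noteq> {} \<and>
     (\<forall>A \<in> con_domain C. \<forall>A' \<in> con_domain C. \<exists>f. is_iso (lang_minus C) A A' f)"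

definition rigid_based :: "'v construction \<Rightarrow> bool" where
  "rigid_based C \<longleftrightarrow>
     (\<forall>B \<in> graph C. \<forall>A f. minus_of C B A \<and> is_iso (lang_minus C) A A f \<longrightarrow>
        (\<forall>x \<in> univ A. app f x = x))"

definition uniformisable :: "'v construction \<Rightarrow> bool" where
  "uniformisable C \<longleftrightarrow>
     (\<exists>\<psi>. pfm_over \<psi> \<and>
        (\<forall>A \<in> con_domain C. \<exists>B \<in> graph C. minus_of C B A \<and>
           (\<forall>B' \<in> M. holds2 \<psi> A B' \<longleftrightarrow> B' = B)))"

text \<open>
  For \<open>A = B\<^sup>-\<close>, the homomorphism \<open>\<nu>\<^sub>B\<close> sends \<open>\<pi>\<close> to \<open>restrict \<pi> (univ A)\<close>.
\<close>

definition natural :: "'v construction \<Rightarrow> bool" where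
  "natural C \<longleftrightarrow>
     (\<forall>B \<in> graph C. \<forall>A. minus_of C B A \<longrightarrow>
        (\<exists>s. map_in_model (lang_minus C) A (lang C) B s \<and>
             splitting (Aut (lang C) B) (Aut (lang_minus C) A) (\<lambda>\<pi>. restrict \<pi> (univ A)) s))"

definition weakly_natural :: "'v construction \<Rightarrow> bool" where
  "weakly_natural C \<longleftrightarrow>
     (\<forall>B \<in> graph C. \<forall>A. minus_of C B A \<longrightarrow>
        (\<exists>s G0. map_in_model (lang_minus C) A (lang C) B s \<and> set_in_model (lang C) B G0 \<and>
             weak_splitting (Aut (lang C) B) (Aut (lang_minus C) A)
               (\<lambda>\<pi>. restrict \<pi> (univ A)) s G0))"

end

end

end

theory Submission
  imports Defs "HOL-Library.Numeral_Type"
begin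

text \<open>
  If every rigid-based construction is uniformisable, then a definable choice is available:
  over the structure \<open>(t, \<in>)\<close>, which is rigid and remembers \<open>t\<close> under isomorphism, put one
  further point without any structure.  All these expansions are isomorphic over their base, so
  the new point may be any set from a class that depends on \<open>t\<close>, and a uniformisation has to
  choose one.  Taking for \<open>t\<close> the transitive closure of a set \<open>A\<close> and for the new point an
  expansion \<open>B\<close> of \<open>A\<close>, this uniformises the construction \<open>A \<mapsto> B\<close>.

  Apply this to a finite structure \<open>B\<close> whose automorphism group is the group \<open>G\<close> of upper
  unitriangular \<open>5 \<times> 5\<close> matrices over the field with two elements, with a part \<open>A\<close> on which
  \<open>G\<close> acts through the superdiagonal, that is, as its abelianisation \<open>H\<close>.  Lift the four
  generators of \<open>H\<close> to \<open>G\<close> in any way.  The commutator of the first two lifts has a \<open>1\<close> in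
  position \<open>(1, 3)\<close>, that of the last two has a \<open>1\<close> in position \<open>(3, 5)\<close>, hence these two do
  not commute, although both are words that are trivial in \<open>H\<close>.  So \<open>G \<rightarrow> H\<close> has no weak splitting.
  The second claim follows in the same way, since the rigid-based construction used above is natural.
\<close>

subsection \<open>Unitriangular matrices\<close>

text \<open>The kernel of \<open>G\<close> \<rightarrow> \<open>H\<close> consists of the matrices
  with zero superdiagonal. A commutative kernel could serve as \<open>G0\<close> for every section,
  and for 4 x 4 matrices it is commutative, as positions (1,3) and (2,4) do not compose. Size 5 is
  the first in which two of its positions, (1,3) and (3,5), do. The second diagonal of a commutator
  depends only on the superdiagonals of its two entries, which a change of lift leaves alone, so no
  choice of lifts helps. The detour over transitive closures is needed because \<open>A\<close> has
  automorphisms, so the finite construction is not rigid-based. A domain is closed under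
  isomorphism, so a rigid base must determine \<open>A\<close> even when replaced by an isomorphic
  copy; uniqueness of the Mostowski collapse gives both rigidity and this. Members over isomorphic
  bases must be isomorphic, so the choice of \<open>B\<close> may leave no trace in the isomorphism
  type: it is hidden in the identity of the extra point. Isomorphisms and splittings have to be
  elements of the model. On finite carriers this is automatic; over transitive closures the axioms
  have to provide them.\<close>

type_synonym 'a quad = "'a \<times> 'a \<times> 'a \<times> 'a"
type_synonym 'a point = "'a quad + 'a quad"

text \<open>The first four parameters are the superdiagonal of a \<open>5 \<times> 5\<close> matrix, followed by the higher
  diagonals.  The matrix acts on the left summand by translation with its superdiagonal, and on
  \<open>(x, y, z, w)\<close> in the right summand as on the vector \<open>(x, y, z, w, 1)\<close>.\<close>

fun act :: "'a quad \<Rightarrow> 'a \<times> 'a \<times> 'a \<Rightarrow> 'a \<times> 'a \<Rightarrow> 'a \<Rightarrow> 'a point \<Rightarrow> ('a::comm_ring_1) point" where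
  "act (a, b, c, d) (e, f, g) (h, i) j (Inl (p, q, r, s)) = Inl (p + a, q + b, r + c, s + d)"
| "act (a, b, c, d) (e, f, g) (h, i) j (Inr (x, y, z, w)) =
     Inr (x + a * y + e * z + h * w + j, y + b * z + f * w + i, z + c * w + g, w + d)"

lemma act_0: "act (0,0,0,0) (0,0,0) (0,0) 0 = id"
proof
  fix x :: "'a point" show "act (0,0,0,0) (0,0,0) (0,0) 0 x = id x"
    by (cases x) (auto split: prod.splits)
qed

text \<open>Entries by position: \<open>a\<close>, \<open>b\<close>, \<open>c\<close>,
  \<open>d\<close> are (1,2) to (4,5), then \<open>e\<close>, \<open>f\<close>, \<open>g\<close> are
  (1,3), (2,4), (3,5), \<open>h\<close>, \<open>i\<close> are (1,4), (2,5), and \<open>j\<close> is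
  (1,5). The formula is the matrix product, diagonal by diagonal.\<close>

lemma act_comp:
  "act (a,b,c,d) (e,f,g) (h,i) j \<circ> act (a',b',c',d') (e',f',g') (h',i') j' =
   act (a + a', b + b', c + c', d + d')
       (e + e' + a * b', f + f' + b * c', g + g' + c * d')
       (h + h' + a * f' + e * c', i + i' + b * g' + f * d')
       (j + j' + a * i' + e * g' + h * d')" (is "?l = ?r")
proof
  fix x
  show "?l x = ?r x"
  proof (cases x)
    case (Inl q)
    then show ?thesis by (cases q) (simp add: ac_simps)
  next
    case (Inr q)
    then show ?thesis by (cases q) (simp add: algebra_simps)
  qed
qed

lemma act_eq_iff:
  "act (a,b,c,d) (e,f,g) (h,i) j = act (a',b',c',d') (e',f',g') (h',i') j' \<longleftrightarrow>
   a = a' \<and> b = b' \<and> c = c' \<and> d = d' \<and> e = e' \<and> f = f' \<and> g = g' \<and> h = h' \<and> i = i' \<and> j = j'"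
  (is "?F = ?F' \<longleftrightarrow> _")
proof
  assume eq: "?F = ?F'"
  \<comment> \<open>The base point yields the superdiagonal and the zero vector the last column; the
    two unit vectors then yield columns four and three.\<close>
  have "?F (Inl (0,0,0,0)) = ?F' (Inl (0,0,0,0))" "?F (Inr (0,0,0,0)) = ?F' (Inr (0,0,0,0))"
     "?F (Inr (0,0,0,1)) = ?F' (Inr (0,0,0,1))" "?F (Inr (0,0,1,0)) = ?F' (Inr (0,0,1,0))"
    using eq by simp_all
  then show "a = a' \<and> b = b' \<and> c = c' \<and> d = d' \<and> e = e' \<and> f = f' \<and> g = g' \<and> h = h' \<and> i = i' \<and> j = j'"
    by simp
qed auto

definition unip :: "('a::comm_ring_1 point \<Rightarrow> 'a point) set" where
  "unip = {act m n k j | m n k j. True}"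

lemma unipE:
  assumes "u \<in> unip"
  obtains a b c d e f g h i j where "u = act (a,b,c,d) (e,f,g) (h,i) j"
proof -
  obtain m n k j where "u = act m n k j" using assms by (auto simp: unip_def)
  then show thesis using that by (metis prod.exhaust)
qed

lemma act_unip: "act m n k j \<in> unip"
  unfolding unip_def by blast

lemma id_unip: "id \<in> unip"
  by (metis act_0 act_unip)

lemma comp_unip:
  assumes "u \<in> unip" "u' \<in> unip" shows "u \<circ> u' \<in> unip"
  using assms by (elim unipE) (simp only: act_comp act_unip)

lemma inv_unip:
  assumes "u \<in> unip" obtains u' where "u' \<in> unip" "u \<circ> u' = id" "u' \<circ> u = id"
proof -
  obtain a b c d e f g h i j where u: "u = act (a,b,c,d) (e,f,g) (h,i) j"
    using assms by (rule unipE)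
  show thesis
  proof (rule that)
    \<comment> \<open>These entries come from setting those of the product in
      \<open>act_comp\<close> to zero and solving one diagonal after the other.\<close>
    let ?e = "a * b - e" and ?f = "b * c - f" and ?g = "c * d - g"
    let ?h = "- h - a * ?f + e * c" and ?i = "- i - b * ?g + f * d"
    let ?u' = "act (-a,-b,-c,-d) (?e, ?f, ?g) (?h, ?i) (- j - a * ?i - e * ?g + h * d)"
    show "?u' \<in> unip" by (rule act_unip)
    show "u \<circ> ?u' = id" "?u' \<circ> u = id"
      unfolding u act_comp act_0[symmetric] act_eq_iff by (simp_all add: algebra_simps)
  qed
qed

lemma bij_unip: "u \<in> unip \<Longrightarrow> bij u"
  by (metis inv_unip o_bij)

abbreviation base :: "'a point set" where "base \<equiv> range Inl"

lemma unip_base: "u \<in> unip \<Longrightarrow> x \<in> base \<Longrightarrow> u x \<in> base"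
  by (auto elim!: unipE)

lemma unip_comm_base: "u \<in> unip \<Longrightarrow> u' \<in> unip \<Longrightarrow> x \<in> base \<Longrightarrow> u (u' x) = u' (u x)"
  by (auto elim!: unipE simp: ac_simps)

definition gen1 where "gen1 = act (1,0,0,0) (0,0,0) (0,0) 0"
definition gen2 where "gen2 = act (0,1,0,0) (0,0,0) (0,0) 0"
definition gen3 where "gen3 = act (0,0,1,0) (0,0,0) (0,0) 0"
definition gen4 where "gen4 = act (0,0,0,1) (0,0,0) (0,0) 0"

lemma gens_unip: "gen1 \<in> unip" "gen2 \<in> unip" "gen3 \<in> unip" "gen4 \<in> unip"
  by (simp_all add: act_unip gen1_def gen2_def gen3_def gen4_def)

text \<open>A single base point fixes the superdiagonal. The six higher entries stay free, which is
  exactly the freedom in choosing a lift.\<close>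

lemma lift_unip:
  assumes u: "u \<in> unip" and l: "\<forall>p\<in>base. u p = act (a,b,c,d) (0,0,0) (0,0) 0 p"
  obtains e f g h i j where "u = act (a,b,c,d) (e,f,g) (h,i) j"
proof -
  obtain a' b' c' d' e f g h i j where "u = act (a',b',c',d') (e,f,g) (h,i) j"
    using u by (rule unipE)
  moreover have "u (Inl (0,0,0,0)) = act (a,b,c,d) (0,0,0) (0,0) 0 (Inl (0,0,0,0))"
    using l by blast
  ultimately show thesis using that by simp
qed

text \<open>The equations for \<open>x\<close> and \<open>y\<close> make them commutators of
  \<open>s1\<close>, \<open>s2\<close> and of \<open>s3\<close>, \<open>s4\<close> without
  mentioning inverses. Their first two diagonals do not depend on the lifts: the only nonzero
  entries there are (1,3) of \<open>x\<close> and (3,5) of \<open>y\<close>, so the two products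
  differ by 1 at (1,5).\<close>

lemma lifts_not_commuting:
  assumes s: "s1 \<in> unip" "s2 \<in> unip" "s3 \<in> unip" "s4 \<in> unip" and xy: "x \<in> unip" "y \<in> unip"
    and l: "\<forall>p\<in>base. s1 p = gen1 p" "\<forall>p\<in>base. s2 p = gen2 p"
      "\<forall>p\<in>base. s3 p = gen3 p" "\<forall>p\<in>base. s4 p = gen4 p"
    and x: "x \<circ> (s2 \<circ> s1) = s1 \<circ> s2" and y: "y \<circ> (s4 \<circ> s3) = s3 \<circ> s4"
  shows "x \<circ> y \<noteq> y \<circ> x"
proof -
  obtain e1 f1 g1 h1 i1 j1 where s1: "s1 = act (1,0,0,0) (e1,f1,g1) (h1,i1) j1"
    using s(1) l(1) unfolding gen1_def by (rule lift_unip)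
  obtain e2 f2 g2 h2 i2 j2 where s2: "s2 = act (0,1,0,0) (e2,f2,g2) (h2,i2) j2"
    using s(2) l(2) unfolding gen2_def by (rule lift_unip)
  obtain e3 f3 g3 h3 i3 j3 where s3: "s3 = act (0,0,1,0) (e3,f3,g3) (h3,i3) j3"
    using s(3) l(3) unfolding gen3_def by (rule lift_unip)
  obtain e4 f4 g4 h4 i4 j4 where s4: "s4 = act (0,0,0,1) (e4,f4,g4) (h4,i4) j4"
    using s(4) l(4) unfolding gen4_def by (rule lift_unip)
  obtain a b c d e f g h i j where xx: "x = act (a,b,c,d) (e,f,g) (h,i) j"
    using xy(1) by (rule unipE)
  obtain a' b' c' d' e' f' g' h' i' j' where yy: "y = act (a',b',c',d') (e',f',g') (h',i') j'"
    using xy(2) by (rule unipE)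
  have X: "a = 0" "b = 0" "c = 0" "d = 0" "e = 1" "f = 0" "g = 0"
    using x unfolding xx s1 s2 act_comp act_eq_iff by (auto simp: algebra_simps)
  have Y: "a' = 0" "b' = 0" "c' = 0" "d' = 0" "e' = 0" "f' = 0" "g' = 1"
    using y unfolding yy s3 s4 act_comp act_eq_iff by (auto simp: algebra_simps)
  show ?thesis
    unfolding xx yy act_comp act_eq_iff by (simp add: X Y)
qed

text \<open>Over the ring with two elements there are finitely many points and matrices, so that the
  structures, the group and the defining formulas can be listed element by element.\<close>

type_synonym pt = "2 point"

definition pts :: "pt list" where
  "pts = (SOME l. set l = UNIV \<and> distinct l)"

definition base_pts :: "pt list" where
  "base_pts = (SOME l. set l = base \<and> distinct l)"

lemma pts: "set pts = UNIV \<and> distinct pts"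
  unfolding pts_def by (rule someI_ex) (rule finite_distinct_list, simp)

lemma base_pts: "set base_pts = base \<and> distinct base_pts"
  unfolding base_pts_def by (rule someI_ex) (rule finite_distinct_list, simp)

lemma ex_map_list:
  assumes "set xs \<subseteq> f ` S" obtains ps where "xs = map f ps" "set ps \<subseteq> S"
proof -
  have "xs \<in> lists (f ` S)" using assms by (simp add: lists_eq_set)
  then show thesis using that unfolding lists_image by (auto simp: lists_eq_set)
qed

subsection \<open>Formulas\<close>

definition fEx where "fEx i \<phi> = FNot (FAll i (FNot \<phi>))"
definition fOr where "fOr \<phi> \<psi> = FNot (FAnd (FNot \<phi>) (FNot \<psi>))"
definition fImp where "fImp \<phi> \<psi> = FNot (FAnd \<phi> (FNot \<psi>))"
definition fIff where "fIff \<phi> \<psi> = FAnd (fImp \<phi> \<psi>) (fImp \<psi> \<phi>)"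
definition fDisj where "fDisj fs = foldr fOr fs (FNot (FEq 0 0))"
definition fConj where "fConj fs = foldr FAnd fs (FEq 0 0)"
definition fExs where "fExs is \<phi> = foldr fEx is \<phi>"

text \<open>Terms denote sets built from the values of variables by finite set formation. Pairs,
  tuples and the finite structures are such sets, so one recursion supplies their defining
  formulas.\<close>

datatype tm = TV nat | TS "tm list"

fun tvars :: "tm \<Rightarrow> nat set" where
  "tvars (TV i) = {i}"
| "tvars (TS ts) = (\<Union>t\<in>set ts. tvars t)"

definition tPair where "tPair a b = TS [TS [a], TS [a, b]]"
definition tTup where "tTup ts = foldr tPair ts (TS [])"

lemma tvars_tPair [simp]: "tvars (tPair a b) = tvars a \<union> tvars b"
  by (auto simp: tPair_def)

lemma tvars_tTup [simp]: "tvars (tTup ts) = (\<Union>t\<in>set ts. tvars t)"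
  by (induction ts) (auto simp: tTup_def)

text \<open>\<open>fTm t N x\<close> says that variable \<open>x\<close> is the set denoted by \<open>t\<close>; the variables from \<open>N\<close> on
  are free for use as bound variables.\<close>

fun fTm :: "tm \<Rightarrow> nat \<Rightarrow> nat \<Rightarrow> fm" where
  "fTm (TV i) N x = FEq x i"
| "fTm (TS ts) N x = FAll N (fIff (FMem N x) (fDisj (map (\<lambda>t. fTm t (Suc N) N) ts)))"

definition fPairIn where
  "fPairIn N x y f = fEx N (FAnd (FMem N f) (fTm (tPair (TV x) (TV y)) (Suc N) N))"

text \<open>Bound variables are renamed too, so an injective renaming captures nothing. It serves to
  insert an arbitrary given formula into a larger one.\<close>

fun ren :: "(nat \<Rightarrow> nat) \<Rightarrow> fm \<Rightarrow> fm" where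
  "ren r (FMem i j) = FMem (r i) (r j)"
| "ren r (FEq i j) = FEq (r i) (r j)"
| "ren r (FNot \<phi>) = FNot (ren r \<phi>)"
| "ren r (FAnd \<phi> \<psi>) = FAnd (ren r \<phi>) (ren r \<psi>)"
| "ren r (FAll i \<phi>) = FAll (r i) (ren r \<phi>)"

lemma sat_ren: "inj r \<Longrightarrow> sat E M (ren r \<phi>) v \<longleftrightarrow> sat E M \<phi> (v \<circ> r)"
proof (induction \<phi> arbitrary: v)
  case (FAll i \<phi>)
  have "(v(r i := a)) \<circ> r = (v \<circ> r)(i := a)" for a
    using FAll.prems by (auto simp: fun_eq_iff inj_def)
  then show ?case by (simp only: sat.simps ren.simps FAll.IH[OF FAll.prems])
qed auto

definition fTrans where
  "fTrans N t = FAll N (fImp (FMem N t) (FAll (Suc N) (fImp (FMem (Suc N) N) (FMem (Suc N) t))))"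

text \<open>This characterises \<open>t\<close> as the transitive closure of the singleton of
  \<open>a\<close>.\<close>

definition fCone where
  "fCone N t a = FAnd (fTrans (Suc N) t) (FAnd (FMem a t)
     (FAll N (fImp (FAnd (fTrans (Suc N) N) (FMem a N)) (FAll (Suc N) (fImp (FMem (Suc N) t) (FMem (Suc N) N))))))"

definition pidx :: "pt \<Rightarrow> nat" where
  "pidx = (SOME h. inj h \<and> range h = {..<length pts})"

lemma pidx: "inj pidx" "range pidx = {..<length pts}"
proof -
  have "bij_betw ((!) pts) {..<length pts} (set pts)"
    using pts by (intro bij_betw_nth) auto
  then have "bij_betw (the_inv_into {..<length pts} ((!) pts)) UNIV {..<length pts}"
    using pts by (simp add: bij_betw_the_inv_into)
  then have "\<exists>h::pt \<Rightarrow> nat. inj h \<and> range h = {..<length pts}"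
    unfolding bij_betw_def by blast
  then have "inj pidx \<and> range pidx = {..<length pts}"
    unfolding pidx_def by (rule someI_ex)
  then show "inj pidx" "range pidx = {..<length pts}" by blast+
qed

definition unips :: "(pt \<Rightarrow> pt) list" where
  "unips = (SOME l. set l = unip)"

lemma set_unips: "set unips = unip"
  unfolding unips_def by (rule someI_ex) (rule finite_list, simp)

definition pvar :: "nat \<Rightarrow> pt \<Rightarrow> tm" where
  "pvar K p = TV (K + pidx p)"

definition tOrb :: "nat \<Rightarrow> pt list list \<Rightarrow> tm" where
  "tOrb K pss = TS (map (\<lambda>ps. tTup (map (pvar K) ps)) pss)"

text \<open>The variables from \<open>K\<close> on stand for the points, the variables 3, 4, 5 for the symbols.\<close>

definition tA2 :: "nat \<Rightarrow> tm" where
  "tA2 K = tPair (TS (map (pvar K) base_pts))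
     (TS [tPair (TV 4) (tOrb K (map (\<lambda>u. map u base_pts) unips))])"

definition tB2 :: "nat \<Rightarrow> tm" where
  "tB2 K = tPair (TS (map (pvar K) pts))
     (TS [tPair (TV 3) (tOrb K (map (\<lambda>p. [p]) base_pts)),
          tPair (TV 4) (tOrb K (map (\<lambda>u. map u base_pts) unips)),
          tPair (TV 5) (tOrb K (map (\<lambda>u. map u pts) unips))])"

definition fDist :: "nat \<Rightarrow> fm" where
  "fDist K = fConj [FNot (FEq (K + i) (K + j)). i \<leftarrow> [0..<length pts], j \<leftarrow> [0..<length pts], i \<noteq> j]"

text \<open>The quantified block has one variable for each point. As it is shared, \<open>a\<close>
  and \<open>b\<close> are the base and the whole of the same labelled copy.\<close>

definition fQ :: "nat \<Rightarrow> nat \<Rightarrow> nat \<Rightarrow> fm" where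
  "fQ K a b = fExs [K..<K + length pts]
     (FAnd (fDist K) (FAnd (fTm (tA2 K) (K + length pts) a) (fTm (tB2 K) (K + length pts) b)))"

text \<open>Membership pulled back along \<open>f\<close>: the relation whose Mostowski collapse
  \<open>f\<close> will be.\<close>

definition fRel where
  "fRel N z f = fEx N (fEx (N+1) (fEx (N+2) (fEx (N+3) (FAnd (fPairIn (N+4) N (N+2) f)
     (FAnd (fPairIn (N+4) (N+1) (N+3) f) (FAnd (FMem (N+2) (N+3)) (fTm (tTup [TV N, TV (N+1)]) (N+4) z)))))))"

definition fBij where
  "fBij N D f t =
     FAnd (FAll N (fImp (FMem N f) (fEx (N+1) (fEx (N+2)
            (FAnd (FMem (N+1) D) (FAnd (FMem (N+2) t) (fTm (tPair (TV (N+1)) (TV (N+2))) (N+3) N)))))))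
     (FAnd (FAll N (fImp (FMem N D) (fEx (N+1) (fPairIn (N+2) N (N+1) f))))
     (FAnd (FAll N (FAll (N+1) (FAll (N+2) (FAll (N+3)
            (fImp (FAnd (fPairIn (N+4) N (N+1) f) (fPairIn (N+4) (N+2) (N+3) f))
              (fIff (FEq N (N+2)) (FEq (N+1) (N+3))))))))
       (FAll N (fImp (FMem N t) (fEx (N+1) (fPairIn (N+2) (N+1) N f))))))"

definition fA1 where
  "fA1 N a D f = fEx N (FAnd (FAll (N+1) (fIff (FMem (N+1) N) (fRel (N+2) (N+1) f)))
     (fTm (tPair (TV D) (TS [tPair (TV 2) (TV N)])) (N+1) a))"

definition fB1 where
  "fB1 N b' D f b = fEx N (fEx (N+1) (fEx (N+2)
     (FAnd (FAll (N+3) (fIff (FMem (N+3) N) (fRel (N+4) (N+3) f)))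
     (FAnd (FAll (N+3) (fIff (FMem (N+3) (N+1)) (fEx (N+4) (FAnd (FMem (N+4) D) (fTm (tTup [TV (N+4)]) (N+5) (N+3))))))
     (FAnd (FAll (N+3) (fIff (FMem (N+3) (N+2)) (fOr (FMem (N+3) D) (fTm (tPair (TV D) (TV b)) (N+4) (N+3)))))
       (fTm (tPair (TV (N+2)) (TS [tPair (TV 2) (TV N), tPair (TV 3) (TV (N+1))])) (N+3) b'))))))"

text \<open>Variables 6 to 10 are the carrier, a bijection onto the transitive closure, that
  closure, the set \<open>A\<close> at its top and the expansion \<open>B\<close> kept in the extra
  point.\<close>

definition fG1 where
  "fG1 = fEx 6 (fEx 7 (fEx 8 (fEx 9 (fEx 10 (FAnd (fBij 11 6 7 8) (FAnd (fCone 11 8 9)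
     (FAnd (fQ 11 9 10) (fB1 11 0 6 7 10))))))))"

definition fId where
  "fId N f D = FAll N (fIff (FMem N f) (fEx (N+1) (FAnd (FMem (N+1) D)
     (fTm (tPair (TV (N+1)) (TV (N+1))) (N+2) N))))"

subsection \<open>Transitive models\<close>

locale zfc_model =
  fixes E :: "'v \<Rightarrow> 'v \<Rightarrow> bool" and M :: "'v set"
  assumes universe: "set_universe E" and model: "transitive_ZFC_model E M"
begin

lemma wf_E: "wfP E"
  using universe by (simp add: set_universe_def)

lemma elts_eqI: "elts E x = elts E y \<Longrightarrow> x = y"
  using universe by (auto simp: set_universe_def elts_def)

lemma mem_M: "E y x \<Longrightarrow> x \<in> M \<Longrightarrow> y \<in> M"
  using model unfolding transitive_ZFC_model_def elts_def by blast

lemma mem_elts [simp]: "y \<in> elts E x \<longleftrightarrow> E y x"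
  by (simp add: elts_def)

lemma E_minimal: "x \<in> Q \<Longrightarrow> \<exists>z\<in>Q. \<forall>y. E y z \<longrightarrow> y \<notin> Q"
  using wf_E unfolding wfp_eq_minimal by blast

lemma E_irrefl [simp]: "\<not> E x x"
  using E_minimal[of x "{x}"] by auto

lemma E_no_3cycle: "E x y \<Longrightarrow> E y z \<Longrightarrow> \<not> E z x"
  using E_minimal[of x "{x, y, z}"] by auto

subsection \<open>Sets of the model\<close>

text \<open>The reasoning takes place with HOL sets: \<open>isset\<close> singles out those
  represented in the model, and the axioms become closure properties of it.\<close>

definition isset :: "'v set \<Rightarrow> bool" where
  "isset X \<longleftrightarrow> (\<exists>x\<in>M. elts E x = X)"

definition mk :: "'v set \<Rightarrow> 'v" where
  "mk X = (THE x. elts E x = X)"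

lemma mk_elts [simp]: "mk (elts E x) = x"
  unfolding mk_def by (rule the_equality) (rule refl, erule elts_eqI)

lemma elts_mk [simp]: "isset X \<Longrightarrow> elts E (mk X) = X"
  unfolding isset_def by (metis mk_elts)

lemma E_mk [simp]: "isset X \<Longrightarrow> E y (mk X) \<longleftrightarrow> y \<in> X"
  using elts_mk[of X] unfolding elts_def by blast

lemma elts_eq_iff: "isset X \<Longrightarrow> elts E x = X \<longleftrightarrow> x = mk X"
  by (metis mk_elts elts_mk)

lemma mk_M [simp]: "isset X \<Longrightarrow> mk X \<in> M"
  unfolding isset_def by (metis mk_elts)

lemma isset_elts [simp]: "x \<in> M \<Longrightarrow> isset (elts E x)"
  unfolding isset_def by blast

lemma isset_subset_M: "isset X \<Longrightarrow> X \<subseteq> M"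
  unfolding isset_def elts_def using mem_M by blast

lemma mk_inject: "isset X \<Longrightarrow> isset Y \<Longrightarrow> mk X = mk Y \<longleftrightarrow> X = Y"
  by (metis elts_mk)

lemma ZFC: "Pairing_ax E M" "Union_ax E M" "Powerset_ax E M" "Infinity_ax E M"
  "Separation_schema E M" "Replacement_schema E M"
  using model unfolding transitive_ZFC_model_def ZFC_model_def by blast+

lemma issetI:
  assumes "b \<in> M" "\<And>y. y \<in> M \<Longrightarrow> E y b \<longleftrightarrow> y \<in> X" "X \<subseteq> M"
  shows "isset X"
proof -
  have "elts E b = X"
    unfolding elts_def using assms mem_M[OF _ assms(1)] by blast
  then show ?thesis using assms(1) unfolding isset_def by blast
qed

lemma isset_pair:
  assumes "a \<in> M" "b \<in> M" shows "isset {a, b}"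
proof -
  obtain c where "c \<in> M" "\<forall>x\<in>M. E x c \<longleftrightarrow> x = a \<or> x = b"
    using ZFC(1) assms unfolding Pairing_ax_def by blast
  then show ?thesis using assms by (intro issetI[of c]) blast+
qed

lemma isset_Union:
  assumes "isset X" shows "isset (\<Union>(elts E ` X))"
proof -
  have X: "E y (mk X) \<longleftrightarrow> y \<in> X" for y using assms by simp
  obtain u where "u \<in> M" "\<forall>x\<in>M. E x u \<longleftrightarrow> (\<exists>y\<in>M. y \<in> X \<and> E x y)"
    using ZFC(2) mk_M[OF assms] unfolding Union_ax_def X[symmetric] by blast
  then show ?thesis
    using isset_subset_M[OF assms] mem_M by (intro issetI[of u]) (auto 0 3)
qed

lemma isset_Pow:
  assumes "isset X" shows "isset {y\<in>M. elts E y \<subseteq> X}"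
proof -
  have X: "E y (mk X) \<longleftrightarrow> y \<in> X" for y using assms by simp
  obtain p where "p \<in> M" "\<forall>x\<in>M. E x p \<longleftrightarrow> (\<forall>z\<in>M. E z x \<longrightarrow> z \<in> X)"
    using ZFC(3) mk_M[OF assms] unfolding Powerset_ax_def X[symmetric] by blast
  then show ?thesis
    using mem_M by (intro issetI[of p]) (auto 0 3)
qed

lemma isset_Sep:
  assumes "isset X" "range v \<subseteq> M" shows "isset {x\<in>X. sat E M \<phi> (v(0 := x))}"
proof -
  have X: "E y (mk X) \<longleftrightarrow> y \<in> X" for y using assms by simp
  obtain b where "b \<in> M" "\<forall>x\<in>M. E x b \<longleftrightarrow> x \<in> X \<and> sat E M \<phi> (v(0 := x))"
    using ZFC(5) mk_M[OF assms(1)] assms(2) unfolding Separation_schema_def X[symmetric] by blast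
  then show ?thesis
    using isset_subset_M[OF assms(1)] by (intro issetI[of b]) blast+
qed

lemma isset_Repl:
  assumes "isset X" "range v \<subseteq> M"
    and "\<And>x y z. x \<in> X \<Longrightarrow> y \<in> M \<Longrightarrow> z \<in> M \<Longrightarrow> sat E M \<phi> (v(0 := x, 1 := y)) \<Longrightarrow>
           sat E M \<phi> (v(0 := x, 1 := z)) \<Longrightarrow> y = z"
  shows "isset {y\<in>M. \<exists>x\<in>X. sat E M \<phi> (v(0 := x, 1 := y))}"
proof -
  have X: "E y (mk X) \<longleftrightarrow> y \<in> X" for y using assms by simp
  have "\<exists>b\<in>M. \<forall>y\<in>M. E y b \<longleftrightarrow> (\<exists>x\<in>M. E x (mk X) \<and> sat E M \<phi> (v(0 := x, 1 := y)))"
    using ZFC(6)[unfolded Replacement_schema_def, rule_format, OF assms(2), of "mk X" \<phi>] assms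
    by (simp only: E_mk mk_M)
  then obtain b where b: "b \<in> M" "\<forall>y\<in>M. E y b \<longleftrightarrow> (\<exists>x\<in>X. sat E M \<phi> (v(0 := x, 1 := y)))"
    using isset_subset_M[OF assms(1)] unfolding X by blast
  then show ?thesis
    by (intro issetI[of b]) blast+
qed

lemma isset_empty [simp]: "isset {}"
proof -
  obtain e where "e \<in> M" "\<forall>z\<in>M. \<not> E z e"
    using ZFC(4) unfolding Infinity_ax_def by blast
  then show ?thesis by (intro issetI[of e]) blast+
qed

lemma isset_Un: "isset X \<Longrightarrow> isset Y \<Longrightarrow> isset (X \<union> Y)"
  using isset_Union[OF isset_pair, of "mk X" "mk Y"] by simp

lemma isset_insert [simp]: "a \<in> M \<Longrightarrow> isset X \<Longrightarrow> isset (insert a X)"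
  using isset_Un[OF isset_pair[of a a], of X] by simp

lemma isset_finite: "finite X \<Longrightarrow> X \<subseteq> M \<Longrightarrow> isset X"
  by (induction rule: finite_induct) auto

subsection \<open>Pairs, numerals, tuples and symbols\<close>

definition opair :: "'v \<Rightarrow> 'v \<Rightarrow> 'v" where
  "opair a b = mk {mk {a}, mk {a, b}}"

lemma opair_M [simp]: "a \<in> M \<Longrightarrow> b \<in> M \<Longrightarrow> opair a b \<in> M"
  by (simp add: opair_def)

lemma is_pair_iff: "a \<in> M \<Longrightarrow> b \<in> M \<Longrightarrow> is_pair E p a b \<longleftrightarrow> p = opair a b"
proof
  assume ab: "a \<in> M" "b \<in> M" and "is_pair E p a b"
  then obtain s t where st: "elts E p = {s, t}" "elts E s = {a}" "elts E t = {a, b}"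
    by (auto simp: is_pair_def)
  have "s = mk {a}" "t = mk {a, b}" using st(2,3) by (metis mk_elts)+
  then show "p = opair a b" using st(1) by (metis mk_elts opair_def)
next
  assume ab: "a \<in> M" "b \<in> M" and "p = opair a b"
  then show "is_pair E p a b" unfolding is_pair_def opair_def
    by (intro exI[of _ "mk {a}"] exI[of _ "mk {a, b}"]) simp
qed

lemma is_pair_M: "is_pair E p a b \<Longrightarrow> p \<in> M \<Longrightarrow> a \<in> M \<and> b \<in> M"
  unfolding is_pair_def by (metis insertCI mem_M mem_elts)

lemma is_pair_iff': "p \<in> M \<Longrightarrow> is_pair E p a b \<longleftrightarrow> p = opair a b \<and> a \<in> M \<and> b \<in> M"
  using is_pair_iff is_pair_M by blast

lemma opair_inject: "a \<in> M \<Longrightarrow> b \<in> M \<Longrightarrow> c \<in> M \<Longrightarrow> d \<in> M \<Longrightarrow>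
    opair a b = opair c d \<longleftrightarrow> a = c \<and> b = d"
  unfolding opair_def by (auto simp: mk_inject doubleton_eq_iff)

lemma opair_eqD: "opair a b = opair c d \<Longrightarrow> a \<in> M \<Longrightarrow> b \<in> M \<Longrightarrow> c \<in> M \<Longrightarrow> d \<in> M \<Longrightarrow> a = c \<and> b = d"
  by (simp add: opair_inject)

text \<open>With Kuratowski pairs, \<open>mk D\<close> lies two membership steps below the pair, so
  the pair in \<open>D\<close> would close a cycle of length three. Such pairs provide points
  outside \<open>D\<close> that carry an arbitrary \<open>x\<close>.\<close>

lemma opair_memD: "opair (mk D) x \<in> D \<Longrightarrow> isset D \<Longrightarrow> x \<in> M \<Longrightarrow> False"
proof -
  assume D: "opair (mk D) x \<in> D" "isset D" "x \<in> M"
  have "E (mk D) (mk {mk D})" "E (mk {mk D}) (opair (mk D) x)"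
    using D by (simp_all add: opair_def)
  then have "\<not> E (opair (mk D) x) (mk D)" by (rule E_no_3cycle)
  then show False using D by simp
qed

fun num :: "nat \<Rightarrow> 'v" where
  "num 0 = mk {}"
| "num (Suc n) = mk (insert (num n) (elts E (num n)))"

lemma num_M [simp]: "num n \<in> M"
  by (induction n) auto

lemma is_num_iff: "is_num E n x \<longleftrightarrow> x = num n"
proof (induction n arbitrary: x)
  case 0 then show ?case by (simp add: elts_eq_iff)
next
  case (Suc n) then show ?case by (simp add: elts_eq_iff)
qed

lemma card_num: "finite (elts E (num n)) \<and> card (elts E (num n)) = n"
  by (induction n) auto

lemma num_inject [simp]: "num n = num m \<longleftrightarrow> n = m"
  using card_num by metis

lemma inj_num: "inj num"
  by (simp add: inj_def)

fun tup :: "'v list \<Rightarrow> 'v" where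
  "tup [] = mk {}"
| "tup (x # xs) = opair x (tup xs)"

lemma tup_M [simp]: "set xs \<subseteq> M \<Longrightarrow> tup xs \<in> M"
  by (induction xs) auto

lemma is_tuple_iff: "set xs \<subseteq> M \<Longrightarrow> is_tuple E xs t \<longleftrightarrow> t = tup xs"
  by (induction xs arbitrary: t) (simp_all add: elts_eq_iff is_pair_iff)

lemma is_tuple_M: "is_tuple E xs t \<Longrightarrow> t \<in> M \<Longrightarrow> set xs \<subseteq> M"
proof (induction xs arbitrary: t)
  case (Cons a xs)
  then obtain u where u: "is_tuple E xs u" "is_pair E t a u" by auto
  then have "a \<in> M" "u \<in> M" using Cons.prems(2) is_pair_M[of t a u] by blast+
  then show ?case using Cons.IH[OF u(1)] by simp
qed simp

lemma is_tuple_iff': "t \<in> M \<Longrightarrow> is_tuple E xs t \<longleftrightarrow> t = tup xs \<and> set xs \<subseteq> M"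
  using is_tuple_iff is_tuple_M by blast

lemma opair_not_empty: "a \<in> M \<Longrightarrow> b \<in> M \<Longrightarrow> opair a b \<noteq> mk {}"
  by (simp add: opair_def mk_inject)

lemma tup_eqD: "set xs \<subseteq> M \<Longrightarrow> set ys \<subseteq> M \<Longrightarrow> tup xs = tup ys \<Longrightarrow> xs = ys"
proof (induction xs arbitrary: ys)
  case Nil
  show ?case
  proof (cases ys)
    case (Cons b zs)
    then have "opair b (tup zs) \<noteq> mk {}" using Nil.prems(2) by (intro opair_not_empty tup_M) auto
    then show ?thesis using Nil.prems(3) Cons by simp
  qed simp
next
  case C: (Cons a xs)
  have M: "a \<in> M" "tup xs \<in> M" using C.prems(1) by simp_all
  show ?case
  proof (cases ys)
    case Nil
    then show ?thesis using C.prems(3) opair_not_empty[OF M] by simp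
  next
    case (Cons b zs)
    have "b \<in> M" "tup zs \<in> M" using C.prems(2) Cons by simp_all
    then have "a = b \<and> tup xs = tup zs"
      using opair_eqD[of a "tup xs" b "tup zs"] M C.prems(3) Cons by simp
    then show ?thesis using C.IH[of zs] C.prems Cons by simp
  qed
qed

lemma tup_inject: "set xs \<subseteq> M \<Longrightarrow> set ys \<subseteq> M \<Longrightarrow> tup xs = tup ys \<longleftrightarrow> xs = ys"
  using tup_eqD by blast

definition sym :: "nat \<Rightarrow> 'v \<Rightarrow> 'v" where
  "sym n a = opair (num 0) (opair (num n) a)"

lemma sym_M [simp]: "a \<in> M \<Longrightarrow> sym n a \<in> M"
  unfolding sym_def by (intro opair_M num_M)

lemma is_symbol_sym: "a \<in> M \<Longrightarrow> is_symbol E k n (sym m a) \<longleftrightarrow> k = 0 \<and> n = m"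
proof
  assume a: "a \<in> M" and "is_symbol E k n (sym m a)"
  then obtain nm t where t: "is_pair E t (num n) nm" "is_pair E (sym m a) (num k) t"
    by (auto simp: is_symbol_def is_num_iff)
  have "t \<in> M" using t(2) is_pair_M[of "sym m a"] a by auto
  then have nm: "nm \<in> M" "t = opair (num n) nm" using t(1) is_pair_iff' by auto
  then have "opair (num 0) (opair (num m) a) = opair (num k) (opair (num n) nm)"
    using t(2) a is_pair_iff' unfolding sym_def[symmetric] by auto
  then have "num 0 = num k \<and> opair (num m) a = opair (num n) nm"
    using a nm by (subst (asm) opair_inject) (auto simp del: num.simps)
  then have "0 = k" "num m = num n"
    using a nm by (simp only: num_inject, subst (asm) opair_inject) auto
  then show "k = 0 \<and> n = m" by auto
next
  assume a: "a \<in> M" and km: "k = 0 \<and> n = m"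
  show "is_symbol E k n (sym m a)"
    unfolding is_symbol_def is_num_iff
    using a km
    by (intro exI[of _ "num 0"] exI[of _ "num m"] exI[of _ a] exI[of _ "opair (num m) a"])
      (simp add: is_pair_iff sym_def del: num.simps)
qed

lemma sym_inject: "a \<in> M \<Longrightarrow> b \<in> M \<Longrightarrow> sym n a = sym m b \<longleftrightarrow> n = m \<and> a = b"
  unfolding sym_def by (simp add: opair_inject del: num.simps)

subsection \<open>Functions in the model\<close>

lemma pairs_in_iff: "f \<in> M \<Longrightarrow> (a, b) \<in> pairs_in E f \<longleftrightarrow> E (opair a b) f \<and> a \<in> M \<and> b \<in> M"
proof -
  assume f: "f \<in> M"
  have "(E p f \<and> is_pair E p a b) \<longleftrightarrow> (E p f \<and> p = opair a b \<and> a \<in> M \<and> b \<in> M)" for p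
    using is_pair_iff'[of p] mem_M[OF _ f, of p] by blast
  then show ?thesis unfolding pairs_in_def by simp
qed

definition fn :: "'v set \<Rightarrow> ('v \<Rightarrow> 'v) \<Rightarrow> 'v" where
  "fn X h = mk ((\<lambda>x. opair x (h x)) ` X)"

text \<open>A function in the model is the graph of its own application map. Together with the next
  lemma this lets functions of the model be handled as HOL functions.\<close>

lemma is_function_fn:
  assumes "f \<in> M" "is_function E f X Y" "X \<subseteq> M"
  shows "f = fn X (app E f)" "app E f ` X \<subseteq> Y" "app E f ` X \<subseteq> M" "isset ((\<lambda>x. opair x (app E f x)) ` X)"
proof -
  have app: "(x, y) \<in> pairs_in E f \<longleftrightarrow> y = app E f x" if "x \<in> X" for x y
  proof -
    have "\<exists>!y. (x, y) \<in> pairs_in E f" using assms(2) that unfolding is_function_def by blast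
    then obtain y0 where "\<And>y. (x, y) \<in> pairs_in E f \<longleftrightarrow> y = y0" by blast
    then show ?thesis unfolding app_def by simp
  qed
  have sub: "app E f x \<in> Y \<and> app E f x \<in> M" if x: "x \<in> X" for x
  proof -
    have "(x, app E f x) \<in> pairs_in E f" using app[OF x] by simp
    then obtain p where p: "E p f" "is_pair E p x (app E f x)" by (auto simp: pairs_in_def)
    then obtain x' y' where xy: "y' \<in> Y" "is_pair E p x' y'" using assms(2) unfolding is_function_def by blast
    have "p \<in> M" using p assms(1) mem_M by blast
    then have "y' = app E f x" "y' \<in> M"
      using p(2) xy(2) opair_inject by (auto simp: is_pair_iff')
    then show ?thesis using xy by simp
  qed
  then show "app E f ` X \<subseteq> Y" "app E f ` X \<subseteq> M" by blast+
  have "p \<in> elts E f \<longleftrightarrow> p \<in> (\<lambda>x. opair x (app E f x)) ` X" for p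
  proof
    assume "p \<in> elts E f"
    then have p: "E p f" by simp
    then obtain x y where xy: "x \<in> X" "is_pair E p x y" using assms(2) unfolding is_function_def by blast
    then have "y = app E f x" using p app[of x y] unfolding pairs_in_def by blast
    then show "p \<in> (\<lambda>x. opair x (app E f x)) ` X"
      using xy sub assms(3) is_pair_iff by blast
  next
    assume "p \<in> (\<lambda>x. opair x (app E f x)) ` X"
    then obtain x where x: "x \<in> X" "p = opair x (app E f x)" by blast
    then have "(x, app E f x) \<in> pairs_in E f" using app by blast
    then show "p \<in> elts E f" using assms(1) pairs_in_iff x by simp
  qed
  then have *: "elts E f = (\<lambda>x. opair x (app E f x)) ` X" by blast
  show "f = fn X (app E f)" unfolding fn_def *[symmetric] by simp
  show "isset ((\<lambda>x. opair x (app E f x)) ` X)"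
    unfolding *[symmetric] using assms(1) by simp
qed

text \<open>Whether the graph is a set of the model is the one set-theoretic question. It is
  automatic on finite domains (\<open>isset_fn_finite\<close>); on others it has to be derived from
  the axioms.\<close>

lemma
  assumes "isset ((\<lambda>x. opair x (h x)) ` X)" "X \<subseteq> M" "h ` X \<subseteq> M"
  shows fn_M: "fn X h \<in> M"
    and pairs_in_fn: "pairs_in E (fn X h) = {(x, h x) | x. x \<in> X}"
    and app_fn: "x \<in> X \<Longrightarrow> app E (fn X h) x = h x"
    and is_function_fnI: "h ` X \<subseteq> Y \<Longrightarrow> is_function E (fn X h) X Y"
proof -
  show fM: "fn X h \<in> M" using assms by (simp add: fn_def)
  have "(x, y) \<in> pairs_in E (fn X h) \<longleftrightarrow> x \<in> X \<and> y = h x" for x y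
    unfolding pairs_in_iff[OF fM] using assms by (auto simp: fn_def opair_inject image_subset_iff subset_iff)
  then show P: "pairs_in E (fn X h) = {(x, h x) | x. x \<in> X}" by auto
  show "app E (fn X h) x = h x" if "x \<in> X" using that unfolding app_def P by auto
  show "is_function E (fn X h) X Y" if "h ` X \<subseteq> Y"
    using assms that unfolding is_function_def P
    by (auto simp: fn_def is_pair_iff image_subset_iff subset_iff intro!: bexI)
qed

lemma fn_cong: "(\<And>x. x \<in> X \<Longrightarrow> h x = h' x) \<Longrightarrow> fn X h = fn X h'"
  unfolding fn_def by (metis (no_types, lifting) image_cong)

lemma isset_fn_finite: "finite X \<Longrightarrow> X \<subseteq> M \<Longrightarrow> h ` X \<subseteq> M \<Longrightarrow> isset ((\<lambda>x. opair x (h x)) ` X)"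
  by (intro isset_finite) (auto simp: image_subset_iff subset_iff)

subsection \<open>Finite relational structures\<close>

text \<open>Only relation symbols will occur, so every clause about function symbols becomes
  vacuous.\<close>

definition rsym :: "nat \<Rightarrow> 'v \<Rightarrow> bool" where
  "rsym n s \<longleftrightarrow> (\<exists>a\<in>M. s = sym n a)"

lemma is_symbol_rsym: "rsym m s \<Longrightarrow> is_symbol E k n s \<longleftrightarrow> k = 0 \<and> n = m"
  using is_symbol_sym unfolding rsym_def by blast

lemma rsym_M: "rsym m s \<Longrightarrow> s \<in> M"
  using sym_M unfolding rsym_def by blast

lemma rsym_unique: "rsym m s \<Longrightarrow> rsym n s \<Longrightarrow> m = n"
  using is_symbol_rsym by blast

definition rlang :: "'v set \<Rightarrow> bool" where
  "rlang L \<longleftrightarrow> finite L \<and> (\<forall>s\<in>L. \<exists>n. rsym n s)"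

lemma rlangD: "rlang L \<Longrightarrow> s \<in> L \<Longrightarrow> \<exists>n. rsym n s"
  unfolding rlang_def by blast

lemma rlang_M: "rlang L \<Longrightarrow> L \<subseteq> M"
  using rsym_M unfolding rlang_def by blast

lemma rlang_isset: "rlang L \<Longrightarrow> isset L"
  using isset_finite[of L] rlang_M[of L] by (simp add: rlang_def)

lemma rlang_is_language: "rlang L \<Longrightarrow> is_language E M L"
proof -
  assume L: "rlang L"
  have "\<exists>n. rel_symbol E n s \<or> fun_symbol E n s" if "s \<in> L" for s
    using rlangD[OF L that] is_symbol_rsym by blast
  moreover have "mk L \<in> M" "elts E (mk L) = L" using rlang_isset[OF L] by simp_all
  ultimately show ?thesis unfolding is_language_def by blast
qed

definition struct :: "'v set \<Rightarrow> ('v \<Rightarrow> 'v list set) \<Rightarrow> 'v set \<Rightarrow> 'v" where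
  "struct D r L = opair (mk D) (fn L (\<lambda>s. mk (tup ` r s)))"

text \<open>The language is finite but the carrier need not be: copies of arbitrary transitive
  closures are covered as well.\<close>

definition good :: "'v set \<Rightarrow> ('v \<Rightarrow> 'v list set) \<Rightarrow> 'v set \<Rightarrow> bool" where
  "good D r L \<longleftrightarrow> rlang L \<and> isset D \<and> D \<noteq> {} \<and>
     (\<forall>s\<in>L. isset (tup ` r s) \<and> (\<forall>n. rsym n s \<longrightarrow> (\<forall>xs\<in>r s. length xs = n \<and> set xs \<subseteq> D)))"

lemma struct_cong:
  "D = D' \<Longrightarrow> L = L' \<Longrightarrow> (\<And>s. s \<in> L' \<Longrightarrow> r s = r' s) \<Longrightarrow> struct D r L = struct D' r' L'"
  unfolding struct_def using fn_cong[of L' "\<lambda>s. mk (tup ` r s)" "\<lambda>s. mk (tup ` r' s)"] by simp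

context
  fixes D r L assumes g: "good D r L"
begin

lemma good_rlang: "rlang L" and good_isset: "isset D" and good_ne: "D \<noteq> {}"
  and good_rel: "s \<in> L \<Longrightarrow> isset (tup ` r s)"
  and good_length: "s \<in> L \<Longrightarrow> rsym n s \<Longrightarrow> xs \<in> r s \<Longrightarrow> length xs = n"
  using g unfolding good_def by blast+

lemma good_D: "D \<subseteq> M"
  using isset_subset_M[OF good_isset] .

lemma good_set: "s \<in> L \<Longrightarrow> xs \<in> r s \<Longrightarrow> set xs \<subseteq> D"
  using g rlangD[OF good_rlang, of s] unfolding good_def by blast

lemma good_set_M: "s \<in> L \<Longrightarrow> xs \<in> r s \<Longrightarrow> set xs \<subseteq> M"
  using good_set good_D by blast

lemma good_interp: "isset ((\<lambda>s. opair s (mk (tup ` r s))) ` L)" "(\<lambda>s. mk (tup ` r s)) ` L \<subseteq> M" "L \<subseteq> M"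
proof -
  show *: "(\<lambda>s. mk (tup ` r s)) ` L \<subseteq> M" using good_rel by auto
  show **: "L \<subseteq> M" using rlang_M[OF good_rlang] .
  show "isset ((\<lambda>s. opair s (mk (tup ` r s))) ` L)"
    using isset_fn_finite[OF _ ** *] good_rlang unfolding rlang_def by blast
qed

lemma struct_M: "struct D r L \<in> M"
  unfolding struct_def using fn_M[OF good_interp(1,3,2)] good_isset by simp

lemma is_pair_struct: "is_pair E (struct D r L) a b \<longleftrightarrow> a = mk D \<and> b = fn L (\<lambda>s. mk (tup ` r s))"
proof -
  have M: "mk D \<in> M" "fn L (\<lambda>s. mk (tup ` r s)) \<in> M"
    using fn_M[OF good_interp(1,3,2)] good_isset by simp_all
  show ?thesis
    unfolding is_pair_iff'[OF struct_M] using M opair_inject[OF M, of a b] by (auto simp: struct_def)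
qed

lemma univ_struct: "univ E (struct D r L) = D"
  unfolding univ_def is_pair_struct using good_isset by simp

lemma app_struct: "s \<in> L \<Longrightarrow> app E (fn L (\<lambda>s. mk (tup ` r s))) s = mk (tup ` r s)"
  using app_fn[OF good_interp(1,3,2)] .

lemma rel_holds_struct: "s \<in> L \<Longrightarrow> rel_holds E (struct D r L) s xs \<longleftrightarrow> xs \<in> r s"
proof -
  assume s: "s \<in> L"
  have "rel_holds E (struct D r L) s xs \<longleftrightarrow> (\<exists>t. is_tuple E xs t \<and> t \<in> tup ` r s)"
    unfolding rel_holds_def is_pair_struct using app_struct[OF s] good_rel[OF s] by auto
  also have "\<dots> \<longleftrightarrow> xs \<in> r s"
  proof
    assume "\<exists>t. is_tuple E xs t \<and> t \<in> tup ` r s"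
    then obtain ys where ys: "is_tuple E xs (tup ys)" "ys \<in> r s" by blast
    have M: "set ys \<subseteq> M" using good_set_M[OF s ys(2)] .
    then have "tup ys = tup xs \<and> set xs \<subseteq> M" using ys(1) is_tuple_iff'[OF tup_M[OF M]] by blast
    then have "ys = xs" using tup_inject[OF M, of xs] by blast
    then show "xs \<in> r s" using ys by simp
  next
    assume xs: "xs \<in> r s"
    then have "is_tuple E xs (tup xs)" using is_tuple_iff[OF good_set_M[OF s xs]] by blast
    then show "\<exists>t. is_tuple E xs t \<and> t \<in> tup ` r s" using xs by blast
  qed
  finally show ?thesis .
qed

lemma is_structure_struct: "is_structure E L (struct D r L)"
proof -
  have I: "is_function E (fn L (\<lambda>s. mk (tup ` r s))) L UNIV"
    using is_function_fnI[OF good_interp(1,3,2)] by simp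
  have T: "elts E (mk (tup ` r s)) \<subseteq> tuples E n D" if s: "s \<in> L" "rsym n s" for s n
  proof -
    have "tup xs \<in> tuples E n D" if "xs \<in> r s" for xs
      unfolding tuples_def using good_length[OF s that] good_set[OF s(1) that]
        is_tuple_iff[OF good_set_M[OF s(1) that]] by blast
    then show ?thesis using good_rel[OF s(1)] by auto
  qed
  have S: "(rel_symbol E n s \<longrightarrow> elts E (app E (fn L (\<lambda>s. mk (tup ` r s))) s) \<subseteq> tuples E n (elts E (mk D)))
      \<and> \<not> fun_symbol E n s" if s: "s \<in> L" for s n
  proof -
    obtain m where m: "rsym m s" using rlangD[OF good_rlang s] by blast
    show ?thesis
      unfolding is_symbol_rsym[OF m] app_struct[OF s] elts_mk[OF good_isset] using T[OF s m] by simp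
  qed
  have "elts E (mk D) \<noteq> {}" using good_isset good_ne by simp
  then show ?thesis
    unfolding is_structure_def is_pair_struct using I S by simp
qed

end

text \<open>Every structure of the model for such a language has the form \<open>struct\<close>.
  This turns isomorphic copies and substructures, which are only given abstractly, into explicit
  data.\<close>

lemma structure_repr:
  assumes L: "rlang L" and A: "is_structure E L A" "A \<in> M"
  defines "r \<equiv> \<lambda>s. {xs. rel_holds E A s xs}"
  shows "good (univ E A) r L" "A = struct (univ E A) r L"
proof -
  obtain D I where DI: "is_pair E A D I" "elts E D \<noteq> {}" "is_function E I L UNIV"
    and S: "\<And>s n. s \<in> L \<Longrightarrow> rel_symbol E n s \<Longrightarrow> elts E (app E I s) \<subseteq> tuples E n (elts E D)"
    using A(1) unfolding is_structure_def by blast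
  have DM: "D \<in> M" "I \<in> M" "A = opair D I" using DI(1) is_pair_iff'[OF A(2), of D I] by simp_all
  have P: "is_pair E A x y \<longleftrightarrow> x = D \<and> y = I" for x y
    using is_pair_iff'[OF A(2), of x y] opair_inject[of D I x y] DM by auto
  have U: "univ E A = elts E D"
    unfolding univ_def P by auto
  note I = is_function_fn[OF DM(2) DI(3) rlang_M[OF L]]
  have R: "r s = {xs. \<exists>t. is_tuple E xs t \<and> E t (app E I s)}" for s
    unfolding r_def rel_holds_def P by blast
  have T: "\<exists>xs. t = tup xs \<and> set xs \<subseteq> elts E D \<and> length xs = n"
    if s: "s \<in> L" "rsym n s" and t: "E t (app E I s)" for s n t
  proof -
    have "app E I s \<in> M" using I(3) s by blast
    then have "t \<in> M" using mem_M[OF t] by simp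
    moreover have "t \<in> tuples E n (elts E D)"
      using S[OF s(1)] is_symbol_rsym[OF s(2), of 0 n] t unfolding elts_def by blast
    ultimately show ?thesis unfolding tuples_def using is_tuple_iff'[of t] by auto
  qed
  have DsubM: "elts E D \<subseteq> M" using isset_subset_M[OF isset_elts[OF DM(1)]] .
  have TR: "tup ` r s = elts E (app E I s)" if s: "s \<in> L" for s
  proof
    obtain n where n: "rsym n s" using rlangD[OF L s] by blast
    have AM: "app E I s \<in> M" using I(3) s by blast
    show "tup ` r s \<subseteq> elts E (app E I s)"
    proof
      fix t assume "t \<in> tup ` r s"
      then obtain xs u where xs: "t = tup xs" "is_tuple E xs u" "E u (app E I s)" unfolding R by blast
      then have "u = t" using is_tuple_iff'[OF mem_M[OF xs(3) AM]] by simp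
      then show "t \<in> elts E (app E I s)" using xs by simp
    qed
    show "elts E (app E I s) \<subseteq> tup ` r s"
    proof
      fix t assume "t \<in> elts E (app E I s)"
      then have t: "E t (app E I s)" by simp
      then obtain xs where xs: "t = tup xs" "set xs \<subseteq> elts E D" using T[OF s n] by blast
      then have "is_tuple E xs t" using is_tuple_iff[of xs t] DsubM by simp
      then show "t \<in> tup ` r s" unfolding R using t xs by blast
    qed
  qed
  have len: "length xs = n \<and> set xs \<subseteq> elts E D" if s: "s \<in> L" "rsym n s" "xs \<in> r s" for s n xs
  proof -
    obtain t where t: "is_tuple E xs t" "E t (app E I s)" using s(3) R by blast
    have "app E I s \<in> M" using I(3) s by blast
    then have "t \<in> M" using mem_M[OF t(2)] by simp
    then have "t = tup xs" "set xs \<subseteq> M" using t(1) is_tuple_iff' by simp_all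
    moreover obtain ys where "t = tup ys" "set ys \<subseteq> elts E D" "length ys = n"
      using T[OF s(1,2) t(2)] by blast
    ultimately show ?thesis using tup_inject[of xs ys] DsubM by auto
  qed
  have iss: "isset (tup ` r s)" if "s \<in> L" for s
    unfolding TR[OF that] using I(3) that by (intro isset_elts) blast
  show "good (univ E A) r L"
    unfolding good_def U using L iss len DI(2) DM(1) by auto
  have "I = fn L (\<lambda>s. mk (tup ` r s))"
    using TR I(1) fn_cong[of L "app E I" "\<lambda>s. mk (tup ` r s)"] by simp
  then show "A = struct (univ E A) r L"
    unfolding struct_def U mk_elts using DM(3) by (rule subst)
qed

text \<open>Arities drop out of the condition, since a tuple of the wrong length lies in neither
  relation.\<close>

lemma is_iso_struct:
  assumes A: "good D r L" and B: "good D' r' L"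
  shows "is_iso E M L (struct D r L) (struct D' r' L) f \<longleftrightarrow>
    f \<in> M \<and> is_function E f D D' \<and> bij_betw (app E f) D D' \<and>
    (\<forall>s\<in>L. \<forall>xs. set xs \<subseteq> D \<longrightarrow> (xs \<in> r s \<longleftrightarrow> map (app E f) xs \<in> r' s))"
proof -
  have "(\<forall>n xs. length xs = n \<and> set xs \<subseteq> D \<longrightarrow>
        (rel_symbol E n s \<longrightarrow> (rel_holds E (struct D r L) s xs \<longleftrightarrow> rel_holds E (struct D' r' L) s (map (app E f) xs))) \<and>
        (fun_symbol E n s \<longrightarrow>
          (\<forall>y \<in> D. fun_maps E (struct D r L) s xs y \<longleftrightarrow> fun_maps E (struct D' r' L) s (map (app E f) xs) (app E f y))))
     \<longleftrightarrow> (\<forall>xs. set xs \<subseteq> D \<longrightarrow> (xs \<in> r s \<longleftrightarrow> map (app E f) xs \<in> r' s))" if s: "s \<in> L" for s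
  proof -
    obtain m where m: "rsym m s" using rlangD[OF good_rlang[OF A] s] by blast
    have l: "xs \<in> r s \<Longrightarrow> length xs = m" "map (app E f) xs \<in> r' s \<Longrightarrow> length xs = m" for xs
      using good_length[OF A s m, of xs] good_length[OF B s m, of "map (app E f) xs"] by simp_all
    show ?thesis
      unfolding is_symbol_rsym[OF m] rel_holds_struct[OF A s] rel_holds_struct[OF B s] using l by (simp add: l) (metis l)
  qed
  then show ?thesis
    unfolding is_iso_def univ_struct[OF A] univ_struct[OF B] by simp
qed

text \<open>The minus part is unique as a set: by \<open>structure_repr\<close> a structure is
  determined by its universe and its relations.\<close>

lemma is_minus_struct:
  assumes B: "good D r L" and L': "L' \<subseteq> L" and P: "P \<in> L"
    and D': "D' = {x \<in> D. [x] \<in> r P}" and r': "\<And>s. s \<in> L' \<Longrightarrow> r' s = {xs \<in> r s. set xs \<subseteq> D'}"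
    and A': "good D' r' L'" and AM: "A \<in> M"
  shows "is_minus E L' P (struct D r L) A \<longleftrightarrow> A = struct D' r' L'"
proof -
  have rl: "rlang L'" using good_rlang[OF A'] .
  have U: "{x \<in> univ E (struct D r L). rel_holds E (struct D r L) P [x]} = D'"
    unfolding univ_struct[OF B] rel_holds_struct[OF B P] D' ..
  show ?thesis
  proof
    assume m: "is_minus E L' P (struct D r L) A"
    have st: "is_structure E L' A" "univ E A = D'" using m U unfolding is_minus_def by auto
    note R = structure_repr[OF rl st(1) AM]
    have "{xs. rel_holds E A s xs} = r' s" if s: "s \<in> L'" for s
    proof -
      obtain n where n: "rsym n s" using rlangD[OF rl s] by blast
      have sL: "s \<in> L" using s L' by blast
      have eq: "rel_holds E A s xs \<longleftrightarrow> xs \<in> r s" if "length xs = n" "set xs \<subseteq> D'" for xs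
        using m that s is_symbol_rsym[OF n, of 0 n] rel_holds_struct[OF B sL]
        unfolding is_minus_def st(2) by blast
      have l: "length xs = n \<and> set xs \<subseteq> D'" if "rel_holds E A s xs" for xs
        using good_length[OF R(1) s n, of xs] good_set[OF R(1) s, of xs] that st(2) by simp
      have l': "length xs = n" if "xs \<in> r s" for xs
        using good_length[OF B sL n that] .
      show ?thesis unfolding r'[OF s] using eq l l' by blast
    qed
    then show "A = struct D' r' L'"
      by (subst R(2)) (intro struct_cong st(2) refl, simp)
  next
    assume A: "A = struct D' r' L'"
    have "(rel_symbol E n s \<longrightarrow> (rel_holds E A s xs \<longleftrightarrow> rel_holds E (struct D r L) s xs)) \<and> \<not> fun_symbol E n s"
      if s: "s \<in> L'" and xs: "set xs \<subseteq> D'" for s n xs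
    proof -
      obtain m where m: "rsym m s" using rlangD[OF rl s] by blast
      have "s \<in> L" using s L' by blast
      then show ?thesis
        unfolding A rel_holds_struct[OF A' s] using rel_holds_struct[OF B] r'[OF s] xs is_symbol_rsym[OF m] by simp
    qed
    then show "is_minus E L' P (struct D r L) A"
      unfolding is_minus_def U using is_structure_struct[OF A'] univ_struct[OF A'] unfolding A by simp
  qed
qed

lemma struct_inject:
  assumes "good D r L" "good D' r' L" "struct D r L = struct D' r' L"
  shows "D = D'" "s \<in> L \<Longrightarrow> r s = r' s"
  using univ_struct[OF assms(1)] univ_struct[OF assms(2)] assms(3)
    rel_holds_struct[OF assms(1)] rel_holds_struct[OF assms(2)] by auto

subsection \<open>The finite construction\<close>

text \<open>The arities of \<open>sA\<close> and \<open>sB\<close> are the lengths of the two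
  enumerations, since one tuple lists a whole carrier. The names 0 to 3 keep the symbols
  distinct.\<close>

definition sP where "sP = sym 1 (num 0)"
definition sA where "sA = sym (length base_pts) (num 1)"
definition sB where "sB = sym (length pts) (num 2)"
definition sE where "sE = sym 2 (num 3)"

lemma rsyms: "rsym 1 sP" "rsym (length base_pts) sA" "rsym (length pts) sB" "rsym 2 sE"
  unfolding sP_def sA_def sB_def sE_def rsym_def by (metis num_M)+

lemma syms_distinct: "sP \<noteq> sA" "sP \<noteq> sB" "sA \<noteq> sB" "sP \<noteq> sE"
  unfolding sP_def sA_def sB_def sE_def by (simp_all del: num.simps add: sym_inject)

lemma syms_M: "sP \<in> M" "sA \<in> M" "sB \<in> M" "sE \<in> M"
  using rsyms rsym_M by blast+

text \<open>Naming the orbit of one enumeration of all points by a relation makes the automorphisms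
  exactly the given permutations.\<close>

definition orb :: "'v \<Rightarrow> pt list set" where
  "orb s = (if s = sP then (\<lambda>p. [p]) ` base else
            if s = sA then (\<lambda>u. map u base_pts) ` unip else (\<lambda>u. map u pts) ` unip)"

lemma orb_simps: "orb sP = (\<lambda>p. [p]) ` base" "orb sA = (\<lambda>u. map u base_pts) ` unip"
  "orb sB = (\<lambda>u. map u pts) ` unip"
  using syms_distinct by (auto simp: orb_def)

lemma orb_map:
  assumes "u \<in> unip" "ps \<in> orb s" shows "map u ps \<in> orb s"
proof -
  have *: "map u (map u' l) \<in> (\<lambda>u. map u l) ` unip" if "u' \<in> unip" for u' and l :: "pt list"
    using comp_unip[OF assms(1) that] by (auto intro!: image_eqI[of _ _ "u \<circ> u'"])
  show ?thesis
    using assms(2) * unip_base[OF assms(1)] unfolding orb_def by (auto split: if_splits simp del: map_map)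
qed

lemma orb_map_iff:
  assumes "u \<in> unip" shows "map u ps \<in> orb s \<longleftrightarrow> ps \<in> orb s"
proof
  obtain u' where u': "u' \<in> unip" "u' \<circ> u = id" using inv_unip[OF assms] by blast
  assume "map u ps \<in> orb s"
  then show "ps \<in> orb s" using orb_map[OF u'(1), of "map u ps"] u'(2) by simp
qed (rule orb_map[OF assms])

definition L2 where "L2 = {sP, sA, sB}"

definition str2 :: "(pt \<Rightarrow> 'v) \<Rightarrow> pt set \<Rightarrow> 'v set \<Rightarrow> 'v" where
  "str2 d S L = struct (d ` S) (\<lambda>s. map d ` orb s) L"

text \<open>The full structure and its base are treated together: each has a relation that is the
  orbit of an enumeration of its carrier, see \<open>pair2_enum\<close>.\<close>

definition pair2 :: "pt set \<Rightarrow> 'v set \<Rightarrow> bool" where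
  "pair2 S L \<longleftrightarrow> S = UNIV \<and> L = L2 \<or> S = base \<and> L = {sA}"

definition inM :: "(pt \<Rightarrow> 'v) \<Rightarrow> bool" where
  "inM d \<longleftrightarrow> inj d \<and> range d \<subseteq> M"

lemma pair2_unip: "pair2 S L \<Longrightarrow> u \<in> unip \<Longrightarrow> p \<in> S \<Longrightarrow> u p \<in> S"
  using unip_base unfolding pair2_def by auto

lemma pair2_orb:
  assumes "pair2 S L" "s \<in> L" "ps \<in> orb s" shows "set ps \<subseteq> S"
proof (cases "S = UNIV")
  case False
  then have S: "S = base" "s = sA" using assms unfolding pair2_def by auto
  then obtain u where u: "u \<in> unip" "ps = map u base_pts" using assms(3) orb_simps(2) by auto
  then show ?thesis using S(1) unip_base[OF u(1)] base_pts by auto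
qed simp

lemma pair2_enum:
  assumes "pair2 S L" obtains s l where "s \<in> L" "set l = S" "orb s = (\<lambda>u. map u l) ` unip"
  using assms orb_simps pts base_pts unfolding pair2_def L2_def by auto

lemma orb_length:
  assumes "s \<in> L2" "rsym n s" "ps \<in> orb s" shows "length ps = n"
proof -
  have "s = sP \<or> s = sA \<or> s = sB" using assms(1) unfolding L2_def by auto
  then show ?thesis
    using assms(3) orb_simps rsym_unique[OF assms(2)] rsyms by auto
qed

lemma finite_orb: "finite (orb s)"
  unfolding orb_def by (auto intro!: finite_imageI)

lemma good_str2:
  assumes d: "inM d" and S: "pair2 S L" shows "good (d ` S) (\<lambda>s. map d ` orb s) L"
  unfolding good_def
proof (intro conjI ballI allI impI)
  have L: "L \<subseteq> L2" using S unfolding pair2_def L2_def by auto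
  then have "finite L" unfolding L2_def by (rule finite_subset) simp
  then show "rlang L" using L rsyms unfolding rlang_def L2_def by blast
  show "isset (d ` S)" using d unfolding inM_def by (intro isset_finite) auto
  show "d ` S \<noteq> {}" using S unfolding pair2_def by auto
  show "isset (tup ` map d ` orb s)" for s
  proof (rule isset_finite)
    have "set (map d ps) \<subseteq> M" for ps using d unfolding inM_def by auto
    then show "tup ` map d ` orb s \<subseteq> M" using tup_M by blast
  qed (simp add: finite_orb)
  fix s n xs assume s: "s \<in> L" "rsym n s" "xs \<in> map d ` orb s"
  then obtain ps where ps: "xs = map d ps" "ps \<in> orb s" by blast
  then show "length xs = n" using orb_length[OF _ s(2)] L s by auto
  show "set xs \<subseteq> d ` S" using pair2_orb[OF S s(1) ps(2)] ps(1) by auto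
qed

lemma pair2_L2: "pair2 UNIV L2" and pair2_base: "pair2 base {sA}"
  unfolding pair2_def by simp_all

lemma str2_M: "inM d \<Longrightarrow> pair2 S L \<Longrightarrow> str2 d S L \<in> M"
  unfolding str2_def using struct_M[OF good_str2] by blast

lemma univ_str2: "inM d \<Longrightarrow> pair2 S L \<Longrightarrow> univ E (str2 d S L) = d ` S"
  unfolding str2_def using univ_struct[OF good_str2] by blast

lemma minus_str2:
  assumes "inM d" "A \<in> M"
  shows "is_minus E {sA} sP (str2 d UNIV L2) A \<longleftrightarrow> A = str2 d base {sA}"
  unfolding str2_def
proof (rule is_minus_struct[OF good_str2[OF assms(1) pair2_L2] _ _ _ _ good_str2[OF assms(1) pair2_base] assms(2)])
  show "{sA} \<subseteq> L2" "sP \<in> L2" unfolding L2_def by auto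
  show "d ` base = {x \<in> range d. [x] \<in> map d ` orb sP}"
  proof -
    have "map d ` orb sP = (\<lambda>x. [x]) ` d ` base"
      unfolding orb_simps image_image by simp
    moreover have "[x] \<in> (\<lambda>x. [x]) ` X \<longleftrightarrow> x \<in> X" for x and X :: "'v set" by auto
    moreover have "Y = {x \<in> X. x \<in> Y}" if "Y \<subseteq> X" for X Y :: "'v set" using that by blast
    ultimately show ?thesis using image_mono[OF subset_UNIV, of d base] by (simp only:)
  qed
  show "map d ` orb s = {xs \<in> map d ` orb s. set xs \<subseteq> d ` base}" if "s \<in> {sA}" for s
  proof -
    have "xs \<in> map d ` orb s \<Longrightarrow> set xs \<subseteq> d ` base" for xs
      using pair2_orb[OF pair2_base that] by (elim imageE) (simp, blast)
    then show ?thesis by blast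
  qed
qed

text \<open>The tuple \<open>map d l\<close> is in the orbit relation, so its image is
  \<open>map d' (map u l)\<close> for some \<open>u\<close> in \<open>unip\<close>. Since
  \<open>l\<close> runs through the carrier, \<open>f\<close> is \<open>u\<close> up to the
  labellings.\<close>

lemma iso_str2D:
  assumes d: "inM d" "inM d'" and S: "pair2 S L" and f: "is_iso E M L (str2 d S L) (str2 d' S L) f"
  obtains u where "u \<in> unip" "\<And>p. p \<in> S \<Longrightarrow> app E f (d p) = d' (u p)"
proof -
  obtain s l where s: "s \<in> L" "set l = S" "orb s = (\<lambda>u. map u l) ` unip"
    using pair2_enum[OF S] .
  have "map d (map id l) \<in> map d ` orb s" unfolding s(3) using id_unip by blast
  moreover have "set (map d l) \<subseteq> d ` S" using s(2) by simp
  ultimately have "map (app E f) (map d l) \<in> map d' ` orb s"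
    using f s(1) unfolding str2_def is_iso_struct[OF good_str2[OF d(1) S] good_str2[OF d(2) S]]
    by simp
  then obtain u where u: "u \<in> unip" "map (app E f) (map d l) = map d' (map u l)"
    unfolding s(3) by blast
  show thesis
    by (rule that[OF u(1)]) (use u(2) s(2) in simp)
qed

lemma bij_betw_inM:
  assumes d: "inM d" "inM d'" and S: "pair2 S L" and u: "u \<in> unip"
    and f: "\<And>p. p \<in> S \<Longrightarrow> f (d p) = d' (u p)"
  shows "bij_betw f (d ` S) (d' ` S)"
proof -
  obtain u' where u': "u' \<in> unip" "u \<circ> u' = id" "u' \<circ> u = id" using inv_unip[OF u] by blast
  have inj: "inj d" "inj d'" "inj u" using d bij_unip[OF u] unfolding inM_def bij_def by auto
  have "inj_on f (d ` S)"
  proof (rule inj_onI, elim imageE)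
    fix x y p q assume "f x = f y" "x = d p" "y = d q" "p \<in> S" "q \<in> S"
    then have "d' (u p) = d' (u q)" using f by metis
    then have "p = q" using inj(2,3) by (metis injD)
    then show "x = y" using \<open>x = d p\<close> \<open>y = d q\<close> by simp
  qed
  moreover have "f ` d ` S = d' ` S"
  proof
    show "f ` d ` S \<subseteq> d' ` S" using f pair2_unip[OF S u] by auto
    show "d' ` S \<subseteq> f ` d ` S"
    proof
      fix x assume "x \<in> d' ` S"
      then obtain p where p: "x = d' p" "p \<in> S" by blast
      have "u (u' p) = p" using u'(2) by (metis comp_apply id_apply)
      then have "x = f (d (u' p))" using f[OF pair2_unip[OF S u'(1) p(2)]] p by simp
      then show "x \<in> f ` d ` S" using pair2_unip[OF S u'(1) p(2)] by blast
    qed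
  qed
  ultimately show ?thesis unfolding bij_betw_def by simp
qed

definition transp :: "(pt \<Rightarrow> 'v) \<Rightarrow> (pt \<Rightarrow> 'v) \<Rightarrow> (pt \<Rightarrow> pt) \<Rightarrow> 'v \<Rightarrow> 'v" where
  "transp d d' u x = d' (u (inv_into UNIV d x))"

lemma transp_apply: "inM d \<Longrightarrow> transp d d' u (d p) = d' (u p)"
  unfolding transp_def inM_def by (simp add: inv_f_f)

text \<open>Orbits are invariant under \<open>unip\<close>, and finiteness puts the graph of the
  transported map into the model; so every matrix is realised by an isomorphism there.\<close>

lemma iso_str2I:
  assumes d: "inM d" "inM d'" and S: "pair2 S L" and u: "u \<in> unip"
  defines "f \<equiv> fn (d ` S) (transp d d' u)"
  shows "is_iso E M L (str2 d S L) (str2 d' S L) f" "p \<in> S \<Longrightarrow> app E f (d p) = d' (u p)"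
proof -
  let ?h = "transp d d' u"
  have h: "?h (d p) = d' (u p)" for p by (rule transp_apply[OF d(1)])
  have sub: "d ` S \<subseteq> M" "?h ` d ` S \<subseteq> M"
    using d h unfolding inM_def by auto
  have "finite (d ` S)" by simp
  note fn = isset_fn_finite[OF this sub] sub
  show a: "app E f (d p) = d' (u p)" if "p \<in> S" for p
    unfolding f_def using app_fn[OF fn] h that by simp
  have "?h ` d ` S \<subseteq> d' ` S" using h pair2_unip[OF S u] by auto
  then have "is_function E f (d ` S) (d' ` S)" unfolding f_def by (rule is_function_fnI[OF fn])
  moreover have "xs \<in> map d ` orb s \<longleftrightarrow> map (app E f) xs \<in> map d' ` orb s"
    if xs: "set xs \<subseteq> d ` S" for s xs
  proof -
    have "\<exists>ps. xs = map d ps \<and> set ps \<subseteq> S"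
      using ex_map_list[OF xs] by metis
    then obtain ps where ps: "xs = map d ps" "set ps \<subseteq> S" by blast
    have inj: "inj (map d)" "inj (map d')" using d unfolding inM_def by auto
    have "map (app E f) xs = map d' (map u ps)" unfolding ps(1) using ps(2) a by auto
    then have "map (app E f) xs \<in> map d' ` orb s \<longleftrightarrow> map u ps \<in> orb s"
      using inj_image_mem_iff[OF inj(2)] by metis
    also have "\<dots> \<longleftrightarrow> ps \<in> orb s" by (rule orb_map_iff[OF u])
    also have "\<dots> \<longleftrightarrow> xs \<in> map d ` orb s" unfolding ps(1) by (rule inj_image_mem_iff[OF inj(1), symmetric])
    finally show ?thesis by blast
  qed
  moreover have "f \<in> M" unfolding f_def by (rule fn_M[OF fn])
  ultimately show "is_iso E M L (str2 d S L) (str2 d' S L) f"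
    unfolding str2_def is_iso_struct[OF good_str2[OF d(1) S] good_str2[OF d(2) S]]
    using bij_betw_inM[OF d S u a] by blast
qed

text \<open>The copy \<open>A\<close> supplies only the base points, while membership in the domain
  asks for a labelling of all points. The missing ones have to be added outside
  \<open>A\<close>.\<close>

lemma iso_closed_str2:
  assumes d: "inM d" and A: "A \<in> M" "is_structure E {sA} A"
    and f: "is_iso E M {sA} (str2 d base {sA}) A f"
  obtains d' where "inM d'" "A = str2 d' base {sA}"
proof -
  note good = good_str2[OF d pair2_base]
  define D r where "D = univ E A" and "r = (\<lambda>s. {xs. rel_holds E A s xs})"
  have g: "good D r {sA}" and Ar: "A = struct D r {sA}"
    using structure_repr[OF good_rlang[OF good] A(2,1)] unfolding D_def r_def by blast+
  have bij: "bij_betw (app E f) (d ` base) D"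
    and rel: "\<And>xs. set xs \<subseteq> d ` base \<Longrightarrow> xs \<in> map d ` orb sA \<longleftrightarrow> map (app E f) xs \<in> r sA"
    using f[unfolded str2_def Ar is_iso_struct[OF good g]] by blast+
  \<comment> \<open>The new points are outside \<open>D\<close> by \<open>opair_memD\<close>, and
    distinct because \<open>d\<close> is injective.\<close>
  define d' where "d' p = (if p \<in> base then app E f (d p) else opair (mk D) (d p))" for p
  have dM: "d p \<in> M" "d p = d q \<longleftrightarrow> p = q" for p q using d unfolding inM_def inj_def by auto
  have D: "isset D" "D \<subseteq> M" using good_isset[OF g] good_D[OF g] by auto
  have d'b: "d' ` base = D" using bij unfolding bij_betw_def d'_def by auto
  have fD: "app E f (d p) \<in> D" if "p \<in> base" for p using bij that unfolding bij_betw_def by blast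
  have new: "opair (mk D) (d p) \<notin> D" for p using opair_memD[OF _ D(1) dM(1)] by blast
  have d'D: "d' p \<in> D \<longleftrightarrow> p \<in> base" for p
  proof (cases "p \<in> base")
    case True
    then show ?thesis using fD[OF True] unfolding d'_def by (simp only: if_True)
  next
    case False
    then show ?thesis using new[of p] unfolding d'_def by (simp only: if_False)
  qed
  have "inj d'"
  proof (rule injI)
    fix p q assume eq: "d' p = d' q"
    show "p = q"
    proof (cases "p \<in> base"; cases "q \<in> base")
      assume "p \<in> base" "q \<in> base"
      moreover have "inj_on (app E f) (d ` base)" using bij unfolding bij_betw_def by blast
      ultimately have "d p = d q" using eq unfolding d'_def by (simp only: if_True) (blast dest: inj_onD)
      then show ?thesis using dM(2) by simp
    next
      assume "p \<notin> base" "q \<notin> base"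
      then have "opair (mk D) (d p) = opair (mk D) (d q)" using eq unfolding d'_def by simp
      then show ?thesis using opair_eqD[of "mk D" "d p" "mk D" "d q"] D(1) dM by simp
    next
      assume "p \<in> base" "q \<notin> base"
      then show ?thesis using eq d'D by metis
    next
      assume "p \<notin> base" "q \<in> base"
      then show ?thesis using eq d'D by metis
    qed
  qed
  moreover have "range d' \<subseteq> M"
    using fD D dM(1) unfolding d'_def by auto
  ultimately have d': "inM d'" unfolding inM_def by blast
  have mapd': "map (app E f) (map d ps) = map d' ps" if "set ps \<subseteq> base" for ps
    using that unfolding d'_def by auto
  have sub: "set (map d ps) \<subseteq> d ` base" if "set ps \<subseteq> base" for ps
    unfolding set_map using that by (rule image_mono)
  have "r sA = map d' ` orb sA"
  proof (rule Set.set_eqI)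
    fix ys
    show "ys \<in> r sA \<longleftrightarrow> ys \<in> map d' ` orb sA"
    proof
      assume ys: "ys \<in> r sA"
      then have "set ys \<subseteq> d' ` base" using good_set[OF g, of sA] d'b by auto
      then obtain ps where ps: "ys = map d' ps" "set ps \<subseteq> base"
        by (rule ex_map_list)
      then have "map d ps \<in> map d ` orb sA"
        using rel[OF sub[OF ps(2)]] mapd'[OF ps(2)] ys by (simp del: map_map)
      then have "ps \<in> orb sA" using d unfolding inM_def by (simp add: inj_image_mem_iff)
      then show "ys \<in> map d' ` orb sA" using ps by blast
    next
      assume "ys \<in> map d' ` orb sA"
      then obtain ps where ps: "ys = map d' ps" "ps \<in> orb sA" by blast
      have b: "set ps \<subseteq> base" using pair2_orb[OF pair2_base _ ps(2)] by blast
      then show "ys \<in> r sA" using rel[OF sub[OF b]] mapd'[OF b] ps by (simp del: map_map)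
    qed
  qed
  then have "A = str2 d' base {sA}"
    unfolding str2_def Ar using d'b by (intro struct_cong) auto
  then show thesis using that d' by blast
qed

subsection \<open>Automorphism groups of the finite structures\<close>

context
  fixes d :: "pt \<Rightarrow> 'v" and S L
  assumes d: "inM d" and S: "pair2 S L"
begin

definition act2 :: "(pt \<Rightarrow> pt) \<Rightarrow> 'v \<Rightarrow> 'v" where
  "act2 u = restrict (transp d d u) (d ` S)"

lemma act2_apply: "p \<in> S \<Longrightarrow> act2 u (d p) = d (u p)"
  unfolding act2_def using transp_apply[OF d] by simp

lemma act2_eq_iff: "act2 u = act2 v \<longleftrightarrow> (\<forall>p\<in>S. u p = v p)"
proof
  assume "act2 u = act2 v"
  then have "d (u p) = d (v p)" if "p \<in> S" for p using act2_apply[OF that] by metis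
  then show "\<forall>p\<in>S. u p = v p" using d unfolding inM_def inj_def by blast
next
  assume "\<forall>p\<in>S. u p = v p"
  then show "act2 u = act2 v"
    unfolding act2_def using transp_apply[OF d] by (intro restrict_ext) auto
qed

text \<open>This is \<open>iso_str2D\<close> and \<open>iso_str2I\<close> combined. On the full
  carrier \<open>act2\<close> is injective; on the base it identifies the matrices with equal
  superdiagonal, by \<open>act2_eq_iff\<close>, and gives the abelianisation.\<close>

lemma carrier_Aut: "carrier (Aut E M L (str2 d S L)) = act2 ` unip"
proof -
  have "perm_of E (str2 d S L) f \<in> act2 ` unip" if f: "is_iso E M L (str2 d S L) (str2 d S L) f" for f
  proof -
    obtain u where u: "u \<in> unip" "\<And>p. p \<in> S \<Longrightarrow> app E f (d p) = d (u p)"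
      using iso_str2D[OF d d S f] by blast
    have "perm_of E (str2 d S L) f = act2 u"
      unfolding perm_of_def univ_str2[OF d S] act2_def
      using u(2) transp_apply[OF d] by (intro restrict_ext) auto
    then show ?thesis using u(1) by blast
  qed
  moreover have "act2 u \<in> perm_of E (str2 d S L) ` {f. is_iso E M L (str2 d S L) (str2 d S L) f}"
    if u: "u \<in> unip" for u
  proof -
    let ?f = "fn (d ` S) (transp d d u)"
    have "perm_of E (str2 d S L) ?f = act2 u"
      unfolding perm_of_def univ_str2[OF d S] act2_def
      using iso_str2I(2)[OF d d S u] transp_apply[OF d] by (intro restrict_ext) auto
    then show ?thesis using iso_str2I(1)[OF d d S u] by (intro image_eqI[of _ _ ?f]) simp_all
  qed
  ultimately show ?thesis unfolding Aut_def by auto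
qed

lemma act2_Bij: "u \<in> unip \<Longrightarrow> act2 u \<in> Bij (d ` S)"
proof -
  assume u: "u \<in> unip"
  have "bij_betw (act2 u) (d ` S) (d ` S)"
    by (rule bij_betw_inM[OF d d S u]) (rule act2_apply)
  then show ?thesis unfolding Bij_def act2_def by simp
qed

lemma mult_Aut:
  assumes u: "u \<in> unip" and v: "v \<in> unip"
  shows "act2 u \<otimes>\<^bsub>Aut E M L (str2 d S L)\<^esub> act2 v = act2 (u \<circ> v)"
proof -
  have "compose (d ` S) (act2 u) (act2 v) x = act2 (u \<circ> v) x" for x
  proof (cases "x \<in> d ` S")
    case True
    then obtain p where p: "x = d p" "p \<in> S" by blast
    then show ?thesis
      using True pair2_unip[OF S v p(2)] by (simp add: compose_def act2_apply)
  next
    case False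
    then show ?thesis by (simp add: compose_def act2_def)
  qed
  then have "compose (d ` S) (act2 u) (act2 v) = act2 (u \<circ> v)" by blast
  then show ?thesis
    unfolding Aut_def univ_str2[OF d S] by (simp add: BijGroup_def act2_Bij u v)
qed

lemma one_Aut: "\<one>\<^bsub>Aut E M L (str2 d S L)\<^esub> = act2 id"
  unfolding Aut_def univ_str2[OF d S] act2_def
  using transp_apply[OF d] by (auto simp: BijGroup_def intro!: restrict_ext)

lemma group_Aut: "group (Aut E M L (str2 d S L))"
proof (rule groupI)
  let ?G = "Aut E M L (str2 d S L)"
  show "\<one>\<^bsub>?G\<^esub> \<in> carrier ?G" unfolding one_Aut carrier_Aut using id_unip by blast
  fix x assume "x \<in> carrier ?G"
  then obtain u where u: "u \<in> unip" "x = act2 u" unfolding carrier_Aut by blast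
  show "\<one>\<^bsub>?G\<^esub> \<otimes>\<^bsub>?G\<^esub> x = x"
    unfolding one_Aut u(2) mult_Aut[OF id_unip u(1)] by simp
  obtain u' where u': "u' \<in> unip" "u' \<circ> u = id" using inv_unip[OF u(1)] by blast
  have "act2 u' \<otimes>\<^bsub>?G\<^esub> x = \<one>\<^bsub>?G\<^esub>"
    unfolding one_Aut u(2) mult_Aut[OF u'(1) u(1)] u'(2) ..
  then show "\<exists>y\<in>carrier ?G. y \<otimes>\<^bsub>?G\<^esub> x = \<one>\<^bsub>?G\<^esub>" unfolding carrier_Aut using u'(1) by blast
  fix y assume "y \<in> carrier ?G"
  then obtain v where v: "v \<in> unip" "y = act2 v" unfolding carrier_Aut by blast
  show "x \<otimes>\<^bsub>?G\<^esub> y \<in> carrier ?G"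
    unfolding u(2) v(2) mult_Aut[OF u(1) v(1)] carrier_Aut using comp_unip[OF u(1) v(1)] by blast
  fix z assume "z \<in> carrier ?G"
  then obtain w where w: "w \<in> unip" "z = act2 w" unfolding carrier_Aut by blast
  show "x \<otimes>\<^bsub>?G\<^esub> y \<otimes>\<^bsub>?G\<^esub> z = x \<otimes>\<^bsub>?G\<^esub> (y \<otimes>\<^bsub>?G\<^esub> z)"
    unfolding u(2) v(2) w(2) mult_Aut[OF u(1) v(1)] mult_Aut[OF v(1) w(1)]
      mult_Aut[OF comp_unip[OF u(1) v(1)] w(1)] mult_Aut[OF u(1) comp_unip[OF v(1) w(1)]] comp_assoc ..
qed

end

section \<open>Absence of splittings and weak splittings for the finite structure\<close>

context
  fixes d :: "pt \<Rightarrow> 'v"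
  assumes d: "inM d"
begin

abbreviation GB where "GB \<equiv> Aut E M L2 (str2 d UNIV L2)"
abbreviation GA where "GA \<equiv> Aut E M {sA} (str2 d base {sA})"
abbreviation actB where "actB \<equiv> act2 d UNIV"
abbreviation actA where "actA \<equiv> act2 d base"
abbreviation nu where "nu \<equiv> \<lambda>\<pi>. restrict \<pi> (univ E (str2 d base {sA}))"

text \<open>Values of a section are turned into matrices: \<open>u\<close> acts on the base as
  \<open>v\<close> does, so it is a lift in the sense of \<open>lift_unip\<close>.\<close>

lemma lift_unipB:
  assumes "s \<in> carrier GA \<rightarrow> carrier GB" "\<forall>h\<in>carrier GA. nu (s h) = h" "v \<in> unip"
  obtains u where "u \<in> unip" "s (actA v) = actB u" "\<forall>p\<in>base. u p = v p"
proof -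
  note cA = carrier_Aut[OF d pair2_base] and cB = carrier_Aut[OF d pair2_L2]
  have vA: "actA v \<in> carrier GA" unfolding cA using assms(3) by blast
  then have "s (actA v) \<in> carrier GB" using assms(1) by blast
  then obtain u where u: "u \<in> unip" "s (actA v) = actB u" unfolding cB by blast
  have "restrict (actB u) (d ` base) = actA v"
    using assms(2) vA u(2) unfolding univ_str2[OF d pair2_base] by metis
  then have "d (u p) = d (v p)" if "p \<in> base" for p
    using act2_apply[OF d pair2_L2 UNIV_I, of u p] act2_apply[OF d pair2_base that, of v] that
    by (metis image_eqI restrict_apply')
  then have "\<forall>p\<in>base. u p = v p" using d unfolding inM_def inj_def by blast
  then show thesis using that u by blast
qed

lemma actA_commute:
  assumes "u \<in> unip" "v \<in> unip"
  shows "actA u \<otimes>\<^bsub>GA\<^esub> actA v = actA v \<otimes>\<^bsub>GA\<^esub> actA u"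
  unfolding mult_Aut[OF d pair2_base assms] mult_Aut[OF d pair2_base assms(2,1)] act2_eq_iff[OF d pair2_base]
  using unip_comm_base[OF assms] by simp

lemma actB_inject: "actB u = actB v \<longleftrightarrow> u = v"
  unfolding act2_eq_iff[OF d pair2_L2] by auto

text \<open>\<open>GA\<close> is commutative, so a homomorphism would send the generators to
  commuting lifts. The equations in \<open>lifts_not_commuting\<close> would then hold for
  \<open>x = y = id\<close>, but the identity commutes with itself.\<close>

lemma no_splitting: "\<not> splitting GB GA nu s"
proof
  assume sp: "splitting GB GA nu s"
  then have s: "s \<in> carrier GA \<rightarrow> carrier GB" "\<forall>h\<in>carrier GA. nu (s h) = h"
    and hom: "s \<in> hom GA GB" unfolding splitting_def hom_def by auto
  have comm: "u \<circ> v = v \<circ> u" if u: "u \<in> unip" "s (actA u0) = actB u" "u0 \<in> unip"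
    and v: "v \<in> unip" "s (actA v0) = actB v" "v0 \<in> unip" for u v u0 v0
  proof -
    have c: "actA u0 \<in> carrier GA" "actA v0 \<in> carrier GA"
      unfolding carrier_Aut[OF d pair2_base] using u v by blast+
    have "actB u \<otimes>\<^bsub>GB\<^esub> actB v = s (actA u0 \<otimes>\<^bsub>GA\<^esub> actA v0)"
      using hom_mult[OF hom c] u(2) v(2) by simp
    also have "\<dots> = s (actA v0 \<otimes>\<^bsub>GA\<^esub> actA u0)" using actA_commute[OF u(3) v(3)] by simp
    also have "\<dots> = actB v \<otimes>\<^bsub>GB\<^esub> actB u" using hom_mult[OF hom c(2,1)] u(2) v(2) by simp
    finally show ?thesis
      unfolding mult_Aut[OF d pair2_L2 u(1) v(1)] mult_Aut[OF d pair2_L2 v(1) u(1)] actB_inject .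
  qed
  obtain u1 where u1: "u1 \<in> unip" "s (actA gen1) = actB u1" "\<forall>p\<in>base. u1 p = gen1 p"
    using lift_unipB[OF s gens_unip(1)] .
  obtain u2 where u2: "u2 \<in> unip" "s (actA gen2) = actB u2" "\<forall>p\<in>base. u2 p = gen2 p"
    using lift_unipB[OF s gens_unip(2)] .
  obtain u3 where u3: "u3 \<in> unip" "s (actA gen3) = actB u3" "\<forall>p\<in>base. u3 p = gen3 p"
    using lift_unipB[OF s gens_unip(3)] .
  obtain u4 where u4: "u4 \<in> unip" "s (actA gen4) = actB u4" "\<forall>p\<in>base. u4 p = gen4 p"
    using lift_unipB[OF s gens_unip(4)] .
  have "id \<circ> (u2 \<circ> u1) = u1 \<circ> u2" "id \<circ> (u4 \<circ> u3) = u3 \<circ> u4"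
    using comm[OF u1(1,2) gens_unip(1) u2(1,2) gens_unip(2)]
      comm[OF u3(1,2) gens_unip(3) u4(1,2) gens_unip(4)] by simp_all
  then show False
    using lifts_not_commuting[OF u1(1) u2(1) u3(1) u4(1) id_unip id_unip u1(3) u2(3) u3(3) u4(3)] by blast
qed

text \<open>The commutator words in \<open>gen1\<close>, \<open>gen2\<close> and in
  \<open>gen3\<close>, \<open>gen4\<close> are trivial in \<open>GA\<close>. Their values on the
  lifts therefore lie in \<open>G0\<close> and commute, against
  \<open>lifts_not_commuting\<close>.\<close>

lemma no_weak_splitting: "\<not> weak_splitting GB GA nu s G0"
proof
  assume ws: "weak_splitting GB GA nu s G0"
  interpret A: group GA by (rule group_Aut[OF d pair2_base])
  interpret B: group GB by (rule group_Aut[OF d pair2_L2])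
  have s: "s \<in> carrier GA \<rightarrow> carrier GB" "\<forall>h\<in>carrier GA. nu (s h) = h"
    and G0: "subgroup G0 GB" "\<And>x y. x \<in> G0 \<Longrightarrow> y \<in> G0 \<Longrightarrow> x \<otimes>\<^bsub>GB\<^esub> y = y \<otimes>\<^bsub>GB\<^esub> x"
    and words: "\<And>w. set w \<subseteq> carrier GA \<times> {1, -1} \<Longrightarrow> signed_prod GA (\<lambda>h. h) w = \<one>\<^bsub>GA\<^esub> \<Longrightarrow> signed_prod GB s w \<in> G0"
    using ws unfolding weak_splitting_def by blast+
  have comm: "\<exists>x\<in>unip. actB x \<in> G0 \<and> x \<circ> (v \<circ> u) = u \<circ> v"
    if u: "u \<in> unip" "s (actA u0) = actB u" "u0 \<in> unip"
    and v: "v \<in> unip" "s (actA v0) = actB v" "v0 \<in> unip" for u v u0 v0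
  proof -
    let ?a = "actA u0" and ?b = "actA v0"
    let ?w = "[(?a, 1), (?b, 1), (?a, -1), (?b, -1)] :: (('v \<Rightarrow> 'v) \<times> int) list"
    have c: "?a \<in> carrier GA" "?b \<in> carrier GA"
      unfolding carrier_Aut[OF d pair2_base] using u v by blast+
    have cB: "actB u \<in> carrier GB" "actB v \<in> carrier GB"
      unfolding carrier_Aut[OF d pair2_L2] using u v by blast+
    have "signed_prod GA (\<lambda>h. h) ?w = ?a \<otimes>\<^bsub>GA\<^esub> (?b \<otimes>\<^bsub>GA\<^esub> (inv\<^bsub>GA\<^esub> ?a \<otimes>\<^bsub>GA\<^esub> inv\<^bsub>GA\<^esub> ?b))"
      using c by (simp add: A.int_pow_neg A.int_pow_1)
    also have "\<dots> = (?a \<otimes>\<^bsub>GA\<^esub> ?b) \<otimes>\<^bsub>GA\<^esub> inv\<^bsub>GA\<^esub> (?b \<otimes>\<^bsub>GA\<^esub> ?a)"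
      using c by (simp add: A.m_assoc A.inv_mult_group)
    also have "\<dots> = \<one>\<^bsub>GA\<^esub>" using actA_commute[OF u(3) v(3)] c by simp
    finally have G: "signed_prod GB s ?w \<in> G0" using c by (intro words) auto
    have "signed_prod GB s ?w = actB u \<otimes>\<^bsub>GB\<^esub> (actB v \<otimes>\<^bsub>GB\<^esub> (inv\<^bsub>GB\<^esub> actB u \<otimes>\<^bsub>GB\<^esub> inv\<^bsub>GB\<^esub> actB v))"
      using cB u(2) v(2) by (simp add: B.int_pow_neg B.int_pow_1)
    also have "\<dots> = (actB u \<otimes>\<^bsub>GB\<^esub> actB v) \<otimes>\<^bsub>GB\<^esub> inv\<^bsub>GB\<^esub> (actB v \<otimes>\<^bsub>GB\<^esub> actB u)"
      using cB by (simp add: B.m_assoc B.inv_mult_group)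
    finally have w: "signed_prod GB s ?w = \<dots>" .
    \<comment> \<open>Multiplying the commutator by the product in reverse order removes the
      inverses and gives the equation that \<open>lifts_not_commuting\<close> expects.\<close>
    have "(p \<otimes>\<^bsub>GB\<^esub> inv\<^bsub>GB\<^esub> q) \<otimes>\<^bsub>GB\<^esub> q = p" if "p \<in> carrier GB" "q \<in> carrier GB" for p q
      using that by (simp add: B.m_assoc)
    then have eq: "signed_prod GB s ?w \<otimes>\<^bsub>GB\<^esub> (actB v \<otimes>\<^bsub>GB\<^esub> actB u) = actB u \<otimes>\<^bsub>GB\<^esub> actB v"
      unfolding w using cB by blast
    have "signed_prod GB s ?w \<in> carrier GB" using G subgroup.subset[OF G0(1)] by blast
    then obtain x where x: "x \<in> unip" "signed_prod GB s ?w = actB x"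
      unfolding carrier_Aut[OF d pair2_L2] by blast
    have "actB (x \<circ> (v \<circ> u)) = actB (u \<circ> v)"
      using eq unfolding x(2) mult_Aut[OF d pair2_L2 u(1) v(1)] mult_Aut[OF d pair2_L2 v(1) u(1)]
        mult_Aut[OF d pair2_L2 x(1) comp_unip[OF v(1) u(1)]] .
    then show ?thesis using x G unfolding actB_inject by auto
  qed
  obtain u1 where u1: "u1 \<in> unip" "s (actA gen1) = actB u1" "\<forall>p\<in>base. u1 p = gen1 p"
    using lift_unipB[OF s gens_unip(1)] .
  obtain u2 where u2: "u2 \<in> unip" "s (actA gen2) = actB u2" "\<forall>p\<in>base. u2 p = gen2 p"
    using lift_unipB[OF s gens_unip(2)] .
  obtain u3 where u3: "u3 \<in> unip" "s (actA gen3) = actB u3" "\<forall>p\<in>base. u3 p = gen3 p"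
    using lift_unipB[OF s gens_unip(3)] .
  obtain u4 where u4: "u4 \<in> unip" "s (actA gen4) = actB u4" "\<forall>p\<in>base. u4 p = gen4 p"
    using lift_unipB[OF s gens_unip(4)] .
  obtain x where x: "x \<in> unip" "actB x \<in> G0" "x \<circ> (u2 \<circ> u1) = u1 \<circ> u2"
    using comm[OF u1(1,2) gens_unip(1) u2(1,2) gens_unip(2)] by blast
  obtain y where y: "y \<in> unip" "actB y \<in> G0" "y \<circ> (u4 \<circ> u3) = u3 \<circ> u4"
    using comm[OF u3(1,2) gens_unip(3) u4(1,2) gens_unip(4)] by blast
  have "actB (x \<circ> y) = actB (y \<circ> x)"
    using G0(2)[OF x(2) y(2)]
    unfolding mult_Aut[OF d pair2_L2 x(1) y(1)] mult_Aut[OF d pair2_L2 y(1) x(1)] .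
  then show False
    using lifts_not_commuting[OF u1(1) u2(1) u3(1) u4(1) x(1) y(1) u1(3) u2(3) u3(3) u4(3) x(3) y(3)]
    unfolding actB_inject by blast
qed

end

subsection \<open>The finite construction is a construction\<close>

context
  fixes C :: "'v construction"
  assumes pfm: "pfm_over M (con_L C)" "pfm_over M (con_Lminus C)" "pfm_over M (con_graph C)"
    and lang: "lang E M C = L2" "lang_minus E M C = {sA}"
    and P: "con_P C = sP"
    and graph: "graph E M C = {str2 d UNIV L2 | d. inM d}"
begin

text \<open>From here on everything about the finite construction is derived from its languages,
  \<open>P\<close> and its graph; that formulas with these extents exist is settled later, by
  \<open>C2\<close>.\<close>

lemma minus_of_C2: "inM d \<Longrightarrow> minus_of E M C (str2 d UNIV L2) A \<longleftrightarrow> A = str2 d base {sA}"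
  unfolding minus_of_def lang P using minus_str2[of d A] str2_M[of d base "{sA}"] pair2_base by blast

lemma con_domain_C2: "con_domain E M C = {str2 d base {sA} | d. inM d}"
  unfolding con_domain_def graph using minus_of_C2 by blast

lemma rlang_L2: "rlang L2" and rlang_sA: "rlang {sA}"
  unfolding rlang_def L2_def using rsyms by auto

lemma ex_inM: "\<exists>d. inM d"
proof -
  obtain h :: "pt \<Rightarrow> nat" where "inj h" using finite_imp_inj_to_nat_seg[of "UNIV :: pt set"] by auto
  then have "inM (num \<circ> h)" unfolding inM_def using inj_num num_M by (auto intro: inj_compose)
  then show ?thesis by blast
qed

text \<open>An isomorphism between bases is induced by some \<open>u\<close> in \<open>unip\<close>,
  and \<open>u\<close> acts on all points: the same matrix gives the required extension.\<close>

lemma is_construction_C2: "is_construction E M C"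
  unfolding is_construction_def lang P
proof (intro conjI ballI allI impI pfm)
  show "is_language E M L2" "is_language E M {sA}"
    using rlang_is_language rlang_L2 rlang_sA by blast+
  show "{sA} \<subseteq> L2" "sP \<in> L2 - {sA}" "rel_symbol E 1 sP"
    using syms_distinct is_symbol_rsym[OF rsyms(1)] unfolding L2_def by auto
  fix B assume "B \<in> graph E M C"
  then obtain d where d: "inM d" "B = str2 d UNIV L2" unfolding graph by blast
  show "is_structure E L2 B" unfolding d(2) str2_def by (rule is_structure_struct[OF good_str2[OF d(1) pair2_L2]])
  show "\<exists>A. minus_of E M C B A" unfolding d(2) minus_of_C2[OF d(1)] by blast
next
  fix A A' assume "A \<in> con_domain E M C" "A' \<in> M" and st: "is_structure E {sA} A' \<and> (\<exists>f. is_iso E M {sA} A A' f)"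
  then obtain d where d: "inM d" "A = str2 d base {sA}" unfolding con_domain_C2 by blast
  obtain f where "is_iso E M {sA} (str2 d base {sA}) A' f" using st d by blast
  then obtain d' where "inM d'" "A' = str2 d' base {sA}"
    using iso_closed_str2[OF d(1) \<open>A' \<in> M\<close>] st by blast
  then show "A' \<in> con_domain E M C" unfolding con_domain_C2 by blast
next
  fix A B A' B' f assume "A \<in> graph E M C" "B \<in> graph E M C"
    and m: "minus_of E M C A A' \<and> minus_of E M C B B' \<and> is_iso E M {sA} A' B' f"
  then obtain d d' where d: "inM d" "A = str2 d UNIV L2" and d': "inM d'" "B = str2 d' UNIV L2"
    unfolding graph by blast
  have A': "A' = str2 d base {sA}" "B' = str2 d' base {sA}"
    using m minus_of_C2[OF d(1)] minus_of_C2[OF d'(1)] d(2) d'(2) by simp_all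
  obtain u where u: "u \<in> unip" "\<And>p. p \<in> base \<Longrightarrow> app E f (d p) = d' (u p)"
    using iso_str2D[OF d(1) d'(1) pair2_base] m A' by blast
  note g = iso_str2I[OF d(1) d'(1) pair2_L2 u(1)]
  have "app E (fn (range d) (transp d d' u)) x = app E f x" if x: "x \<in> univ E A'" for x
  proof -
    obtain p where p: "p \<in> base" "x = d p" using x unfolding A' univ_str2[OF d(1) pair2_base] by blast
    show ?thesis unfolding p(2) using g(2)[OF UNIV_I, of p] u(2)[OF p(1)] by simp
  qed
  then show "\<exists>g. is_iso E M L2 A B g \<and> (\<forall>x\<in>univ E A'. app E g x = app E f x)"
    using g(1) d(2) d'(2) by blast
qed

lemma unitype_C2: "unitype E M C"
  unfolding unitype_def lang con_domain_C2
  using ex_inM iso_str2I(1)[OF _ _ pair2_base id_unip] by blast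

lemma not_weakly_natural_C2: "\<not> weakly_natural E M C"
proof -
  obtain d where d: "inM d" using ex_inM by blast
  have "str2 d UNIV L2 \<in> graph E M C" unfolding graph using d by blast
  moreover have "minus_of E M C (str2 d UNIV L2) (str2 d base {sA})"
    unfolding minus_of_C2[OF d] ..
  ultimately show ?thesis
    unfolding weakly_natural_def lang using no_weak_splitting[OF d] by blast
qed

lemma not_natural_C2: "\<not> natural E M C"
proof -
  obtain d where d: "inM d" using ex_inM by blast
  have "str2 d UNIV L2 \<in> graph E M C" unfolding graph using d by blast
  moreover have "minus_of E M C (str2 d UNIV L2) (str2 d base {sA})"
    unfolding minus_of_C2[OF d] ..
  ultimately show ?thesis
    unfolding natural_def lang using no_splitting[OF d] by blast
qed

end

section \<open>Satisfaction of compound formulas and values of terms\<close>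

definition asg :: "(nat \<Rightarrow> 'v) \<Rightarrow> bool" where
  "asg v \<longleftrightarrow> range v \<subseteq> M"

lemma asg_upd [simp]: "asg v \<Longrightarrow> a \<in> M \<Longrightarrow> asg (v(i := a))"
  by (auto simp: asg_def)

lemma asg_M [simp]: "asg v \<Longrightarrow> v i \<in> M"
  by (auto simp: asg_def)

lemma sat_connectives [simp]:
  "sat E M (fEx i \<phi>) v \<longleftrightarrow> (\<exists>a\<in>M. sat E M \<phi> (v(i := a)))"
  "sat E M (fOr \<phi> \<psi>) v \<longleftrightarrow> sat E M \<phi> v \<or> sat E M \<psi> v"
  "sat E M (fImp \<phi> \<psi>) v \<longleftrightarrow> (sat E M \<phi> v \<longrightarrow> sat E M \<psi> v)"
  "sat E M (fIff \<phi> \<psi>) v \<longleftrightarrow> (sat E M \<phi> v \<longleftrightarrow> sat E M \<psi> v)"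
  by (auto simp: fEx_def fOr_def fImp_def fIff_def)

lemma sat_fDisj [simp]: "sat E M (fDisj fs) v \<longleftrightarrow> (\<exists>f\<in>set fs. sat E M f v)"
  by (induction fs) (auto simp: fDisj_def)

lemma sat_fConj [simp]: "sat E M (fConj fs) v \<longleftrightarrow> (\<forall>f\<in>set fs. sat E M f v)"
  by (induction fs) (auto simp: fConj_def)

lemma sat_fExs:
  "sat E M (fExs is \<phi>) v \<longleftrightarrow> (\<exists>w. (\<forall>i. i \<notin> set is \<longrightarrow> w i = v i) \<and> (\<forall>i\<in>set is. w i \<in> M) \<and> sat E M \<phi> w)"
proof (induction "is" arbitrary: v)
  case Nil
  have "(\<forall>i. w i = v i) \<longleftrightarrow> w = v" for w by auto
  then show ?case by (simp add: fExs_def)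
next
  case (Cons i "is")
  have "sat E M (fExs (i # is) \<phi>) v \<longleftrightarrow> (\<exists>a\<in>M. sat E M (fExs is \<phi>) (v(i := a)))"
    by (simp add: fExs_def)
  also have "\<dots> \<longleftrightarrow> (\<exists>w. (\<forall>j. j \<notin> set (i # is) \<longrightarrow> w j = v j) \<and> (\<forall>j\<in>set (i # is). w j \<in> M) \<and> sat E M \<phi> w)"
    (is "?l \<longleftrightarrow> ?r")
  proof
    assume ?l
    then obtain a w where aw: "a \<in> M" "\<forall>j. j \<notin> set is \<longrightarrow> w j = (v(i := a)) j" "\<forall>j\<in>set is. w j \<in> M" "sat E M \<phi> w"
      unfolding Cons.IH by blast
    have "w i \<in> M" using aw by (cases "i \<in> set is") auto
    then show ?r using aw by (intro exI[of _ w]) auto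
  next
    assume ?r
    then obtain w where w: "\<forall>j. j \<notin> set (i # is) \<longrightarrow> w j = v j" "\<forall>j\<in>set (i # is). w j \<in> M" "sat E M \<phi> w" by blast
    then show ?l unfolding Cons.IH by (intro bexI[of _ "w i"] exI[of _ w]) auto
  qed
  finally show ?case .
qed

fun tval :: "tm \<Rightarrow> (nat \<Rightarrow> 'v) \<Rightarrow> 'v" where
  "tval (TV i) v = v i"
| "tval (TS ts) v = mk ((\<lambda>t. tval t v) ` set ts)"

lemma tval_M [simp]: "asg v \<Longrightarrow> tval t v \<in> M"
proof (induction t)
  case (TS ts)
  then show ?case by (auto intro!: mk_M isset_finite)
qed simp

lemma tval_cong: "(\<And>i. i \<in> tvars t \<Longrightarrow> v i = w i) \<Longrightarrow> tval t v = tval t w"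
proof (induction t)
  case (TS ts)
  have "tval t v = tval t w" if "t \<in> set ts" for t using TS that by auto
  then show ?case by (simp cong: image_cong)
qed simp

lemma isset_tvals: "asg v \<Longrightarrow> isset ((\<lambda>t. tval t v) ` set ts)"
  by (rule isset_finite) auto

text \<open>As \<open>M\<close> is transitive, quantifying over \<open>M\<close> reaches all
  elements of \<open>y\<close>. This turns definitions by extension inside formulas into
  equations.\<close>

lemma elts_iff_M: "y \<in> M \<Longrightarrow> isset X \<Longrightarrow> y = mk X \<longleftrightarrow> (\<forall>a\<in>M. E a y \<longleftrightarrow> a \<in> X)"
proof
  assume y: "y \<in> M" "isset X" "\<forall>a\<in>M. E a y \<longleftrightarrow> a \<in> X"
  have "elts E y = X"
    using y(3) isset_subset_M[OF y(2)] mem_M[OF _ y(1)] unfolding elts_def by blast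
  then show "y = mk X" using elts_eq_iff[OF y(2)] by blast
qed simp

lemma sat_fTm:
  "asg v \<Longrightarrow> x < N \<Longrightarrow> \<forall>i\<in>tvars t. i < N \<Longrightarrow> sat E M (fTm t N x) v \<longleftrightarrow> v x = tval t v"
proof (induction t arbitrary: N x v)
  case (TS ts)
  have "sat E M (fTm t (Suc N) N) (v(N := a)) \<longleftrightarrow> a = tval t v" if t: "t \<in> set ts" and a: "a \<in> M" for t a
  proof -
    have "\<forall>i\<in>tvars t. i < N" using TS.prems(3) t by auto
    then have "tval t (v(N := a)) = tval t v" by (intro tval_cong) auto
    moreover have "sat E M (fTm t (Suc N) N) (v(N := a)) \<longleftrightarrow> (v(N := a)) N = tval t (v(N := a))"
      using TS.prems(3) t by (intro TS.IH[OF t asg_upd[OF TS.prems(1) a]]) (auto simp: less_Suc_eq)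
    ultimately show ?thesis by simp
  qed
  then have "sat E M (fTm (TS ts) N x) v \<longleftrightarrow> (\<forall>a\<in>M. E a (v x) \<longleftrightarrow> a \<in> (\<lambda>t. tval t v) ` set ts)"
    using TS.prems(2) by auto
  also have "\<dots> \<longleftrightarrow> v x = tval (TS ts) v"
    using elts_iff_M[OF asg_M[OF TS.prems(1)] isset_tvals[OF TS.prems(1)], of x ts] by simp
  finally show ?case .
qed simp

lemma tval_tPair [simp]: "tval (tPair a b) v = opair (tval a v) (tval b v)"
  by (simp add: tPair_def opair_def)

lemma tval_tTup [simp]: "tval (tTup ts) v = tup (map (\<lambda>t. tval t v) ts)"
  by (induction ts) (simp_all add: tTup_def)

lemma sat_fPairIn:
  assumes "asg v" "x < N" "y < N" "f < N"
  shows "sat E M (fPairIn N x y f) v \<longleftrightarrow> E (opair (v x) (v y)) (v f)"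
proof -
  have "sat E M (fPairIn N x y f) v \<longleftrightarrow> (\<exists>a\<in>M. E a (v f) \<and> a = opair (v x) (v y))"
    using assms by (simp add: fPairIn_def sat_fTm)
  then show ?thesis using assms by auto
qed

subsection \<open>Definability of the finite construction\<close>

definition ptsof :: "nat \<Rightarrow> (nat \<Rightarrow> 'v) \<Rightarrow> pt \<Rightarrow> 'v" where
  "ptsof K v p = v (K + pidx p)"

lemma tval_pvar [simp]: "tval (pvar K p) v = ptsof K v p"
  by (simp add: pvar_def ptsof_def)

lemma tval_tOrb: "tval (tOrb K pss) v = mk (tup ` map (ptsof K v) ` set pss)"
  by (simp add: tOrb_def image_image o_def)

lemma tval_pvars: "tval (TS (map (pvar K) ps)) v = mk (ptsof K v ` set ps)"
  by (simp add: image_image)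

lemma tval_tA2: "v 4 = sA \<Longrightarrow> tval (tA2 K) v = str2 (ptsof K v) base {sA}"
proof -
  assume v: "v 4 = sA"
  have "set (map (\<lambda>u. map u base_pts) unips) = orb sA"
    by (simp add: orb_simps set_unips)
  then show ?thesis
    by (simp add: tA2_def str2_def struct_def fn_def tval_pvars base_pts del: set_map tval.simps(2))
      (simp add: tval_tOrb v)
qed

lemma tval_tB2:
  "v 3 = sP \<Longrightarrow> v 4 = sA \<Longrightarrow> v 5 = sB \<Longrightarrow> tval (tB2 K) v = str2 (ptsof K v) UNIV L2"
proof -
  assume v: "v 3 = sP" "v 4 = sA" "v 5 = sB"
  have *: "set (map (\<lambda>u. map u base_pts) unips) = orb sA" "set (map (\<lambda>u. map u pts) unips) = orb sB"
    "set (map (\<lambda>p. [p]) base_pts) = orb sP"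
    by (simp_all add: orb_simps set_unips base_pts)
  then show ?thesis
    by (simp add: tB2_def str2_def struct_def fn_def L2_def tval_pvars pts del: set_map tval.simps(2))
      (simp add: tval_tOrb v)
qed

lemma tvars_pvar: "i \<in> tvars (pvar K p) \<Longrightarrow> i < K + length pts"
  using pidx(2) by (auto simp: pvar_def)

lemma tvars_tA2: "5 < K \<Longrightarrow> \<forall>i\<in>tvars (tA2 K). i < K + length pts"
  and tvars_tB2: "5 < K \<Longrightarrow> \<forall>i\<in>tvars (tB2 K). i < K + length pts"
  by (auto simp: tA2_def tB2_def tOrb_def dest!: tvars_pvar)

lemma sat_fDist: "sat E M (fDist K) v \<longleftrightarrow> inj (ptsof K v)"
proof -
  have "sat E M (fDist K) v \<longleftrightarrow> (\<forall>i\<in>{..<length pts}. \<forall>j\<in>{..<length pts}. i \<noteq> j \<longrightarrow> v (K + i) \<noteq> v (K + j))"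
    by (auto simp: fDist_def)
  also have "\<dots> \<longleftrightarrow> (\<forall>p q. pidx p \<noteq> pidx q \<longrightarrow> v (K + pidx p) \<noteq> v (K + pidx q))"
    unfolding pidx(2)[symmetric] by blast
  also have "\<dots> \<longleftrightarrow> inj (ptsof K v)"
    using pidx(1) unfolding inj_def ptsof_def by metis
  finally show ?thesis .
qed

text \<open>Both constructions rest on this relation: it yields the graph of \<open>C2\<close>, and
  in \<open>C1\<close> it ties the extra point to the transitive closure below it.\<close>

definition Q2 :: "'v \<Rightarrow> 'v \<Rightarrow> bool" where
  "Q2 A B \<longleftrightarrow> (\<exists>d. inM d \<and> A = str2 d base {sA} \<and> B = str2 d UNIV L2)"

lemma sat_fQ:
  assumes v: "asg v" "v 3 = sP" "v 4 = sA" "v 5 = sB" and K: "5 < K" "a < K" "b < K"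
  shows "sat E M (fQ K a b) v \<longleftrightarrow> Q2 (v a) (v b)"
proof -
  let ?n = "length pts"
  let ?\<phi> = "FAnd (fDist K) (FAnd (fTm (tA2 K) (K + ?n) a) (fTm (tB2 K) (K + ?n) b))"
  have body: "sat E M ?\<phi> w \<longleftrightarrow>
      inM (ptsof K w) \<and> v a = str2 (ptsof K w) base {sA} \<and> v b = str2 (ptsof K w) UNIV L2"
    if w: "\<forall>i. i \<notin> set [K..<K + ?n] \<longrightarrow> w i = v i" "\<forall>i\<in>set [K..<K + ?n]. w i \<in> M" for w
  proof -
    have wM: "asg w" unfolding asg_def using w v(1) by (metis asg_M image_subsetI)
    have eq: "w 3 = sP" "w 4 = sA" "w 5 = sB" "w a = v a" "w b = v b" using w v K by simp_all
    have "range (ptsof K w) \<subseteq> M" unfolding ptsof_def using wM by auto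
    then show ?thesis
      using sat_fTm[OF wM _ tvars_tA2[OF K(1)], of a] sat_fTm[OF wM _ tvars_tB2[OF K(1)], of b] K
      by (simp add: sat_fDist tval_tA2 tval_tB2 eq inM_def)
  qed
  have "Q2 (v a) (v b)" if "sat E M (fQ K a b) v"
    using that body unfolding fQ_def sat_fExs Q2_def by blast
  moreover have "sat E M (fQ K a b) v" if Q: "Q2 (v a) (v b)"
  proof -
    obtain d where d: "inM d" "v a = str2 d base {sA}" "v b = str2 d UNIV L2"
      using Q unfolding Q2_def by blast
    \<comment> \<open>Inverting \<open>pidx\<close> spreads the labelling \<open>d\<close> over the
      block of quantified variables.\<close>
    define w where "w i = (if i \<in> set [K..<K + ?n] then d (inv_into UNIV pidx (i - K)) else v i)" for i
    have "pidx p < ?n" for p using pidx(2) by auto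
    then have "ptsof K w = d"
      unfolding ptsof_def w_def using pidx(1) by (auto simp: fun_eq_iff)
    moreover have "\<forall>i. i \<notin> set [K..<K + ?n] \<longrightarrow> w i = v i" "\<forall>i\<in>set [K..<K + ?n]. w i \<in> M"
      using d(1) unfolding w_def inM_def by auto
    ultimately show ?thesis
      unfolding fQ_def sat_fExs using body[of w] d by blast
  qed
  ultimately show ?thesis by blast
qed

subsection \<open>Transitive closures\<close>

text \<open>The transitive closure of the singleton of \<open>a\<close>, formed outside the model.
  As \<open>a\<close> itself is included, it is the top and can be recovered from the closure, by
  \<open>cone_antisym\<close>.\<close>

definition cone :: "'v \<Rightarrow> 'v set" where
  "cone a = {z. E\<^sup>*\<^sup>* z a}"

lemma cone_refl: "a \<in> cone a"
  by (simp add: cone_def)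

lemma cone_trans: "x \<in> cone a \<Longrightarrow> E y x \<Longrightarrow> y \<in> cone a"
  unfolding cone_def by (simp add: converse_rtranclp_into_rtranclp)

lemma cone_least: "a \<in> T \<Longrightarrow> (\<And>x y. x \<in> T \<Longrightarrow> E y x \<Longrightarrow> y \<in> T) \<Longrightarrow> cone a \<subseteq> T"
proof
  fix z assume T: "a \<in> T" "\<And>x y. x \<in> T \<Longrightarrow> E y x \<Longrightarrow> y \<in> T" and "z \<in> cone a"
  then have "E\<^sup>*\<^sup>* z a" by (simp add: cone_def)
  then show "z \<in> T" by (induction rule: converse_rtranclp_induct) (use T in blast)+
qed

lemma cone_unfold: "cone a = insert a (\<Union>y\<in>elts E a. cone y)"
proof
  show "cone a \<subseteq> insert a (\<Union>y\<in>elts E a. cone y)"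
  proof (rule cone_least)
    fix x y assume x: "x \<in> insert a (\<Union>y\<in>elts E a. cone y)" and yx: "E y x"
    show "y \<in> insert a (\<Union>y\<in>elts E a. cone y)"
    proof (cases "x = a")
      case True
      then show ?thesis using yx cone_refl[of y] by auto
    next
      case False
      then obtain z where "E z a" "x \<in> cone z" using x by auto
      then show ?thesis using cone_trans[OF _ yx, of z] by auto
    qed
  qed simp
  have "cone y \<subseteq> cone a" if "E y a" for y
    using cone_trans[OF cone_refl that] by (rule cone_least) (rule cone_trans)
  then show "insert a (\<Union>y\<in>elts E a. cone y) \<subseteq> cone a"
    using cone_refl[of a] UN_least[of "elts E a" cone "cone a"] by (simp only: insert_subset mem_elts)
qed

lemma cone_antisym: "a \<in> cone b \<Longrightarrow> b \<in> cone a \<Longrightarrow> a = b"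
proof (rule ccontr)
  assume ab: "a \<in> cone b" "b \<in> cone a" "a \<noteq> b"
  then have "E\<^sup>+\<^sup>+ a b" "E\<^sup>+\<^sup>+ b a" unfolding cone_def by (auto dest: rtranclpD)
  then have "E\<^sup>+\<^sup>+ a a" by (rule tranclp_trans)
  moreover have "wfP E\<^sup>+\<^sup>+" using wf_E by (rule wfp_tranclp)
  moreover have "\<not> R x x" if "wfP R" for R and x :: 'v
    using that by (induction x rule: wfp_induct_rule) blast
  ultimately show False by blast
qed

lemma sat_fTrans:
  "asg v \<Longrightarrow> t < N \<Longrightarrow> sat E M (fTrans N t) v \<longleftrightarrow> (\<forall>x y. E x (v t) \<longrightarrow> E y x \<longrightarrow> E y (v t))"
proof -
  assume v: "asg v" "t < N"
  have "sat E M (fTrans N t) v \<longleftrightarrow> (\<forall>x\<in>M. E x (v t) \<longrightarrow> (\<forall>y\<in>M. E y x \<longrightarrow> E y (v t)))"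
    using v by (simp add: fTrans_def)
  then show ?thesis using mem_M asg_M[OF v(1), of t] by blast
qed

lemma sat_fCone_raw:
  assumes v: "asg v" "t < N" "a < N"
  shows "sat E M (fCone N t a) v \<longleftrightarrow>
    (\<forall>x y. E x (v t) \<longrightarrow> E y x \<longrightarrow> E y (v t)) \<and> E (v a) (v t) \<and>
    (\<forall>s\<in>M. (\<forall>x y. E x s \<longrightarrow> E y x \<longrightarrow> E y s) \<and> E (v a) s \<longrightarrow> (\<forall>x\<in>M. E x (v t) \<longrightarrow> E x s))"
  using v by (simp add: fCone_def sat_fTrans)

text \<open>Minimality is tested only against sets of the model. It pins down the external closure
  once that closure is itself such a set, which \<open>isset_cone\<close> will provide.\<close>

lemma sat_fCone:
  assumes v: "asg v" "t < N" "a < N" and c: "isset (cone (v a))"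
  shows "sat E M (fCone N t a) v \<longleftrightarrow> v t = mk (cone (v a))"
proof
  let ?c = "mk (cone (v a))"
  have C: "E z ?c \<longleftrightarrow> z \<in> cone (v a)" for z using c by simp
  have trans_c: "(\<forall>x y. E x ?c \<longrightarrow> E y x \<longrightarrow> E y ?c) \<and> E (v a) ?c"
    unfolding C using cone_trans[of _ "v a"] cone_refl[of "v a"] by blast
  have sub: "E x s" if s: "(\<forall>x y. E x s \<longrightarrow> E y x \<longrightarrow> E y s) \<and> E (v a) s" and x: "x \<in> cone (v a)" for s x
  proof -
    have "cone (v a) \<subseteq> elts E s" by (rule cone_least; unfold mem_elts; use s in blast)
    then show ?thesis using x by auto
  qed
  show "sat E M (fCone N t a) v" if "v t = ?c"
    unfolding sat_fCone_raw[OF v] that using trans_c sub unfolding C by blast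
  assume "sat E M (fCone N t a) v"
  note T = this[unfolded sat_fCone_raw[OF v]]
  have "x \<in> cone (v a)" if "E x (v t)" for x
    using T trans_c mk_M[OF c] mem_M[OF that asg_M[OF v(1)]] that C[of x] by blast
  moreover have "E x (v t)" if "x \<in> cone (v a)" for x
    using sub[OF _ that, of "v t"] T by blast
  ultimately have "elts E (v t) = cone (v a)" by auto
  then show "v t = ?c" using elts_eq_iff[OF c] by blast
qed

text \<open>By \<in>-induction: the hypothesis makes \<open>fCone\<close> a function on the elements
  of \<open>a\<close>, so Replacement collects their closures and Union joins them. The formula is
  evaluated only where its meaning is already known.\<close>

lemma isset_cone: "a \<in> M \<Longrightarrow> isset (cone a)"
proof (induction a rule: wfp_induct_rule[OF wf_E])
  case (1 a)
  have IH: "isset (cone y)" if "E y a" for y using 1 that mem_M by blast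
  define v :: "nat \<Rightarrow> 'v" where "v = (\<lambda>_. a)"
  have v: "asg v" "range v \<subseteq> M" using 1 unfolding v_def asg_def by auto
  have s: "sat E M (fCone 2 1 0) (v(0 := y, 1 := t)) \<longleftrightarrow> t = mk (cone y)"
    if "y \<in> elts E a" "t \<in> M" for y t
    using sat_fCone[of "v(0 := y, 1 := t)" 1 2 0] v IH that mem_M[of y a] 1(2) by simp
  have "isset {t\<in>M. \<exists>y\<in>elts E a. sat E M (fCone 2 1 0) (v(0 := y, 1 := t))}"
    by (rule isset_Repl[OF isset_elts[OF 1(2)] v(2)]) (use s in blast)
  moreover have "{t\<in>M. \<exists>y\<in>elts E a. sat E M (fCone 2 1 0) (v(0 := y, 1 := t))}
      = {t\<in>M. \<exists>y\<in>elts E a. t = mk (cone y)}"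
    using s by blast
  moreover have "{t\<in>M. \<exists>y\<in>elts E a. t = mk (cone y)} = (\<lambda>y. mk (cone y)) ` elts E a"
    using IH by auto
  ultimately have "isset ((\<lambda>y. mk (cone y)) ` elts E a)" by simp
  then have "isset (\<Union>(elts E ` (\<lambda>y. mk (cone y)) ` elts E a))"
    by (rule isset_Union)
  moreover have "\<Union>(elts E ` (\<lambda>y. mk (cone y)) ` elts E a) = (\<Union>y\<in>elts E a. cone y)"
    using IH by simp
  ultimately show ?case
    unfolding cone_unfold[of a] using 1(2) by simp
qed

subsection \<open>The rigid construction\<close>

text \<open>Kuratowski pairs lie in the double power set of the union, from which Separation cuts
  out the product.\<close>

lemma isset_prod:
  assumes "isset X" "isset Y" shows "isset {opair x y | x y. x \<in> X \<and> y \<in> Y}"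
proof -
  let ?PP = "{p\<in>M. elts E p \<subseteq> {y\<in>M. elts E y \<subseteq> X \<union> Y}}"
  let ?\<phi> = "fEx 3 (fEx 4 (FAnd (FMem 3 1) (FAnd (FMem 4 2) (fTm (tPair (TV 3) (TV 4)) 5 0))))"
  define v :: "nat \<Rightarrow> 'v" where "v = (\<lambda>_. mk {})(1 := mk X, 2 := mk Y)"
  have v: "asg v" unfolding v_def using assms by (simp add: asg_def image_subset_iff)
  have PP: "isset ?PP" by (intro isset_Pow isset_Un assms)
  have XM: "X \<subseteq> M" "Y \<subseteq> M" using isset_subset_M assms by blast+
  have s: "sat E M ?\<phi> (v(0 := p)) \<longleftrightarrow> (\<exists>x\<in>X. \<exists>y\<in>Y. p = opair x y)" if "p \<in> M" for p
  proof -
    have "sat E M ?\<phi> (v(0 := p)) \<longleftrightarrow> (\<exists>x\<in>M. \<exists>y\<in>M. x \<in> X \<and> y \<in> Y \<and> p = opair x y)"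
      using v that assms by (simp add: sat_fTm v_def)
    then show ?thesis using XM by blast
  qed
  have "opair x y \<in> ?PP" if "x \<in> X" "y \<in> Y" for x y
  proof -
    have xy: "x \<in> M" "y \<in> M" using that XM by blast+
    have "isset {x}" "isset {x, y}" "isset {mk {x}, mk {x, y}}" using xy by simp_all
    then show ?thesis using xy that by (simp add: opair_def)
  qed
  then have "{opair x y | x y. x \<in> X \<and> y \<in> Y} = {p\<in>?PP. sat E M ?\<phi> (v(0 := p))}"
    using s by blast
  then show ?thesis using isset_Sep[OF PP, of v ?\<phi>] v unfolding asg_def by simp
qed

text \<open>\<open>h\<close> is the Mostowski collapse of the relation it pulls back to
  \<open>D\<close>. Arbitrary carriers \<open>D\<close> are allowed besides the closure itself,
  because a domain is closed under isomorphism.\<close>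

definition cfun :: "'v set \<Rightarrow> ('v \<Rightarrow> 'v) \<Rightarrow> 'v \<Rightarrow> bool" where
  "cfun D h A \<longleftrightarrow> isset D \<and> A \<in> M \<and> isset ((\<lambda>x. opair x (h x)) ` D) \<and> bij_betw h D (cone A)"

definition r1 :: "'v set \<Rightarrow> ('v \<Rightarrow> 'v) \<Rightarrow> 'v \<Rightarrow> 'v list set" where
  "r1 D h s = (if s = sE then {[x, y] | x y. x \<in> D \<and> y \<in> D \<and> E (h x) (h y)} else {[x] | x. x \<in> D})"

lemma r1_simps: "r1 D h sE = {[x, y] | x y. x \<in> D \<and> y \<in> D \<and> E (h x) (h y)}" "r1 D h sP = {[x] | x. x \<in> D}"
  using syms_distinct by (auto simp: r1_def)

definition A1 :: "'v set \<Rightarrow> ('v \<Rightarrow> 'v) \<Rightarrow> 'v" where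
  "A1 D h = struct D (r1 D h) {sE}"

text \<open>Pairing \<open>b\<close> with the carrier keeps the extra point out of \<open>D\<close>
  for every \<open>b\<close> and still lets \<open>b\<close> be read off, see
  \<open>B1_inject\<close>. No relation involves the extra point.\<close>

definition B1 :: "'v set \<Rightarrow> ('v \<Rightarrow> 'v) \<Rightarrow> 'v \<Rightarrow> 'v" where
  "B1 D h b = struct (insert (opair (mk D) b) D) (r1 D h) {sE, sP}"

lemma sat_fRel:
  assumes "asg v" "z < N" "f < N"
  shows "sat E M (fRel N z f) v \<longleftrightarrow>
    (\<exists>x\<in>M. \<exists>y\<in>M. \<exists>x'\<in>M. \<exists>y'\<in>M. E (opair x x') (v f) \<and> E (opair y y') (v f) \<and> E x' y' \<and> v z = tup [x, y])"
  using assms by (simp add: fRel_def sat_fTm sat_fPairIn)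

context
  fixes D h A assumes c: "cfun D h A"
begin

lemma cfun_D: "isset D" "D \<subseteq> M" and cfun_A: "A \<in> M" "isset (cone A)" and cfun_bij: "bij_betw h D (cone A)"
  using c isset_cone[of A] isset_subset_M[of D] unfolding cfun_def by blast+

lemma cfun_hM: "h ` D \<subseteq> M"
  using cfun_bij isset_subset_M[OF cfun_A(2)] unfolding bij_betw_def by blast

lemma cfun_graph: "isset ((\<lambda>x. opair x (h x)) ` D)"
  using c unfolding cfun_def by blast

lemmas cfun_fn = fn_M[OF cfun_graph cfun_D(2) cfun_hM]

lemma E_fn: "x \<in> M \<Longrightarrow> y \<in> M \<Longrightarrow> E (opair x y) (fn D h) \<longleftrightarrow> x \<in> D \<and> y = h x"
  using pairs_in_fn[OF cfun_graph cfun_D(2) cfun_hM] pairs_in_iff[OF cfun_fn, of x y] by auto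

lemma sat_fRel_cfun:
  assumes "asg v" "z < N" "f < N" "v f = fn D h"
  shows "sat E M (fRel N z f) v \<longleftrightarrow> v z \<in> tup ` r1 D h sE"
proof -
  have "sat E M (fRel N z f) v \<longleftrightarrow>
    (\<exists>x\<in>M. \<exists>y\<in>M. \<exists>x'\<in>M. \<exists>y'\<in>M. (x \<in> D \<and> x' = h x) \<and> (y \<in> D \<and> y' = h y) \<and> E x' y' \<and> v z = tup [x, y])"
    unfolding sat_fRel[OF assms(1-3)] assms(4) by (intro bex_cong refl) (simp only: E_fn)
  also have "\<dots> \<longleftrightarrow> (\<exists>x\<in>D. \<exists>y\<in>D. E (h x) (h y) \<and> v z = tup [x, y])"
    using cfun_D(2) cfun_hM by blast
  also have "\<dots> \<longleftrightarrow> v z \<in> tup ` r1 D h sE"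
    unfolding r1_simps by (auto simp del: tup.simps)
  finally show ?thesis .
qed

lemma isset_r1: "s \<in> {sE, sP} \<Longrightarrow> isset (tup ` r1 D h s)"
proof -
  \<comment> \<open>Coded tuples end in the empty tuple, so these iterated products are the sets of
    codes of length one and two.\<close>
  let ?D1 = "{opair x y | x y. x \<in> D \<and> y \<in> {mk {}}}"
  let ?D2 = "{opair x y | x y. x \<in> D \<and> y \<in> ?D1}"
  have "isset {mk {}}" by simp
  then have D1: "isset ?D1" by (rule isset_prod[OF cfun_D(1)])
  then have D2: "isset ?D2" by (rule isset_prod[OF cfun_D(1)])
  have "r1 D h sP = (\<lambda>x. [x]) ` D" unfolding r1_simps by blast
  then have "tup ` r1 D h sP = ?D1" by (auto simp: image_image)
  then have P: "isset (tup ` r1 D h sP)" using D1 by simp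
  define v :: "nat \<Rightarrow> 'v" where "v = (\<lambda>_. fn D h)"
  have v: "asg v" unfolding v_def asg_def using cfun_fn by auto
  have D2M: "?D2 \<subseteq> M" by (rule isset_subset_M[OF D2])
  have s: "sat E M (fRel 2 0 1) (v(0 := z)) \<longleftrightarrow> z \<in> tup ` r1 D h sE" if "z \<in> ?D2" for z
  proof -
    have "z \<in> M" using that D2M by blast
    then show ?thesis using sat_fRel_cfun[of "v(0 := z)" 0 2 1] v by (simp add: v_def)
  qed
  have "tup [x, y] \<in> ?D2" if "x \<in> D" "y \<in> D" for x y
    unfolding tup.simps using that by blast
  then have "tup ` r1 D h sE \<subseteq> ?D2" unfolding r1_simps by blast
  then have "tup ` r1 D h sE = {z \<in> ?D2. sat E M (fRel 2 0 1) (v(0 := z))}" using s by blast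
  moreover have "isset {z \<in> ?D2. sat E M (fRel 2 0 1) (v(0 := z))}"
    using isset_Sep[OF D2] v unfolding asg_def by blast
  ultimately show "s \<in> {sE, sP} \<Longrightarrow> isset (tup ` r1 D h s)" using P by auto
qed

lemma cfun_ne: "D \<noteq> {}"
  using cfun_bij cone_refl[of A] unfolding bij_betw_def by auto

lemma rlang1: "rlang {sE}" "rlang {sE, sP}"
  unfolding rlang_def using rsyms by auto

lemma r1_length: "s \<in> {sE, sP} \<Longrightarrow> rsym n s \<Longrightarrow> xs \<in> r1 D h s \<Longrightarrow> length xs = n \<and> set xs \<subseteq> D"
  using rsym_unique[of 2 sE n] rsym_unique[of 1 sP n] rsyms r1_simps by auto

lemma good_A1: "good D (r1 D h) {sE}"
  unfolding good_def
proof (intro conjI ballI allI impI rlang1 cfun_D cfun_ne)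
  show "isset (tup ` r1 D h s)" if "s \<in> {sE}" for s using isset_r1[of s] that by simp
  fix s n xs assume "s \<in> {sE}" and n: "rsym n s" "xs \<in> r1 D h s"
  then have "s \<in> {sE, sP}" by simp
  from r1_length[OF this n] show "length xs = n" "set xs \<subseteq> D" by blast+
qed

lemma good_B1: "b \<in> M \<Longrightarrow> good (insert (opair (mk D) b) D) (r1 D h) {sE, sP}"
  unfolding good_def
proof (intro conjI ballI allI impI rlang1)
  assume b: "b \<in> M"
  show "isset (insert (opair (mk D) b) D)" using b cfun_D(1) by simp
  show "isset (tup ` r1 D h s)" if "s \<in> {sE, sP}" for s using isset_r1[OF that] .
  fix s n xs assume "s \<in> {sE, sP}" "rsym n s" "xs \<in> r1 D h s"
  from r1_length[OF this] show "length xs = n" "set xs \<subseteq> insert (opair (mk D) b) D" by blast+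
qed simp

lemma A1_M: "A1 D h \<in> M" and univ_A1: "univ E (A1 D h) = D"
  unfolding A1_def using struct_M[OF good_A1] univ_struct[OF good_A1] by blast+

lemma B1_M: "b \<in> M \<Longrightarrow> B1 D h b \<in> M"
  and univ_B1: "b \<in> M \<Longrightarrow> univ E (B1 D h b) = insert (opair (mk D) b) D"
  unfolding B1_def using struct_M[OF good_B1] univ_struct[OF good_B1] by blast+

lemma point_notin: "b \<in> M \<Longrightarrow> opair (mk D) b \<notin> D"
  using opair_memD cfun_D(1) by blast

lemma minus_B1: "b \<in> M \<Longrightarrow> X \<in> M \<Longrightarrow> is_minus E {sE} sP (B1 D h b) X \<longleftrightarrow> X = A1 D h"
  unfolding A1_def B1_def
proof (rule is_minus_struct[OF good_B1 _ _ _ _ good_A1])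
  assume b: "b \<in> M"
  show "D = {x \<in> insert (opair (mk D) b) D. [x] \<in> r1 D h sP}"
    unfolding r1_simps using point_notin[OF b] by auto
  show "r1 D h s = {xs \<in> r1 D h s. set xs \<subseteq> D}" if "s \<in> {sE}" for s
    using that r1_simps by auto
qed simp_all

end

lemma B1_inject:
  assumes c: "cfun D h A" and b: "b \<in> M" "b' \<in> M" shows "B1 D h b = B1 D h b' \<longleftrightarrow> b = b'"
proof
  assume "B1 D h b = B1 D h b'"
  then have "insert (opair (mk D) b) D = insert (opair (mk D) b') D"
    using univ_B1[OF c b(1)] univ_B1[OF c b(2)] by simp
  then have "opair (mk D) b \<in> insert (opair (mk D) b') D" by auto
  then have "opair (mk D) b = opair (mk D) b'"
    using point_notin[OF c b(1)] by simp
  then show "b = b'" using opair_eqD[OF _ _ b(1) _ b(2)] mk_M[OF cfun_D(1)[OF c]] by blast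
qed simp

text \<open>Uniqueness of the Mostowski collapse, by induction on the value \<open>u\<close>: images
  of collapses are transitive, so the elements of \<open>h x\<close> and of \<open>h' x\<close> are
  values at the same points below \<open>x\<close>. Equal closures then have equal tops.\<close>

lemma collapse_unique:
  assumes c: "cfun D h A" "cfun D h' A'"
    and rel: "\<And>x y. x \<in> D \<Longrightarrow> y \<in> D \<Longrightarrow> E (h x) (h y) \<longleftrightarrow> E (h' x) (h' y)"
  shows "(\<forall>x\<in>D. h x = h' x) \<and> A = A'"
proof -
  have *: "\<forall>x\<in>D. h x = u \<longrightarrow> h' x = u" for u
  proof (induction u rule: wfp_induct_rule[OF wf_E])
    case (1 u)
    show ?case
    proof (intro ballI impI)
      fix x assume x: "x \<in> D" "h x = u"
      have hx: "h x \<in> cone A" "h' x \<in> cone A'"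
        using x(1) bij_betwE[OF cfun_bij[OF c(1)]] bij_betwE[OF cfun_bij[OF c(2)]] by simp_all
      have "E z u \<longleftrightarrow> E z (h' x)" for z
      proof
        assume z: "E z u"
        then have "z \<in> cone A" using cone_trans[OF hx(1), of z] x(2) by simp
        then obtain y where y: "y \<in> D" "h y = z"
          using bij_betw_imp_surj_on[OF cfun_bij[OF c(1)]] by (metis imageE)
        then have "h' y = z" using "1"[OF z] by simp
        then show "E z (h' x)" using rel[OF y(1) x(1)] z x(2) y(2) by simp
      next
        assume z: "E z (h' x)"
        then have "z \<in> cone A'" using cone_trans[OF hx(2), of z] by simp
        then obtain y where y: "y \<in> D" "h' y = z"
          using bij_betw_imp_surj_on[OF cfun_bij[OF c(2)]] by (metis imageE)
        then have "E (h y) u" using rel[OF y(1) x(1)] z x(2) by simp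
        then have "h' y = h y" using "1"[of "h y"] y(1) by simp
        then show "E z u" using \<open>E (h y) u\<close> y(2) by simp
      qed
      then show "h' x = u" by (intro elts_eqI) (simp add: elts_def)
    qed
  qed
  then have eq: "\<forall>x\<in>D. h x = h' x" by metis
  then have "cone A = cone A'"
    using bij_betw_imp_surj_on[OF cfun_bij[OF c(1)]] bij_betw_imp_surj_on[OF cfun_bij[OF c(2)]]
      image_cong[of D D h h'] by simp
  then show ?thesis using eq cone_antisym[of A A'] cone_refl[of A] cone_refl[of A'] by simp
qed

text \<open>The carrier may be infinite, so the graph of the composite is obtained by Separation
  from a product.\<close>

lemma cfun_comp:
  assumes c: "cfun D h A" and f: "f \<in> M" "is_function E f D' D" "bij_betw (app E f) D' D" and D': "isset D'"
  shows "cfun D' (h \<circ> app E f) A"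
  unfolding cfun_def
proof (intro conjI D' cfun_A[OF c])
  show "bij_betw (h \<circ> app E f) D' (cone A)" by (rule bij_betw_trans[OF f(3) cfun_bij[OF c]])
  let ?X = "{opair x y | x y. x \<in> D' \<and> y \<in> cone A}"
  let ?\<phi> = "fEx 3 (fEx 4 (fEx 5 (FAnd (fPairIn 6 3 4 1) (FAnd (fPairIn 6 4 5 2) (fTm (tPair (TV 3) (TV 5)) 6 0)))))"
  define v :: "nat \<Rightarrow> 'v" where "v = (\<lambda>_. f)(2 := fn D h)"
  have v: "asg v" unfolding v_def using f cfun_fn[OF c] by (simp add: asg_def image_subset_iff)
  have D'M: "D' \<subseteq> M" by (rule isset_subset_M[OF D'])
  have DM: "D \<subseteq> M" by (rule cfun_D(2)[OF c])
  have X: "isset ?X" by (rule isset_prod[OF D' cfun_A(2)[OF c]])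
  have XM: "?X \<subseteq> M" by (rule isset_subset_M[OF X])
  note F = is_function_fn[OF f(1,2) D'M]
  have Ef: "E (opair x y) f \<longleftrightarrow> x \<in> D' \<and> y = app E f x" if "x \<in> M" "y \<in> M" for x y
    using pairs_in_fn[OF F(4) D'M F(3)] pairs_in_iff[OF f(1), of x y] F(1) that by auto
  have s: "sat E M ?\<phi> (v(0 := p)) \<longleftrightarrow> (\<exists>x\<in>D'. p = opair x ((h \<circ> app E f) x))" if "p \<in> M" for p
  proof -
    have "sat E M ?\<phi> (v(0 := p)) \<longleftrightarrow>
       (\<exists>x\<in>M. \<exists>y\<in>M. \<exists>z\<in>M. E (opair x y) f \<and> E (opair y z) (fn D h) \<and> p = opair x z)"
      using v that by (simp add: sat_fTm sat_fPairIn v_def)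
    also have "\<dots> \<longleftrightarrow> (\<exists>x\<in>M. \<exists>y\<in>M. \<exists>z\<in>M. (x \<in> D' \<and> y = app E f x) \<and> (y \<in> D \<and> z = h y) \<and> p = opair x z)"
      by (intro bex_cong refl) (simp only: E_fn[OF c] Ef)
    also have "\<dots> \<longleftrightarrow> (\<exists>x\<in>D'. p = opair x ((h \<circ> app E f) x))"
      using D'M DM F(2) cfun_hM[OF c] by (simp, blast)
    finally show ?thesis .
  qed
  have "(h \<circ> app E f) ` D' = cone A"
    using \<open>bij_betw (h \<circ> app E f) D' (cone A)\<close> unfolding bij_betw_def by blast
  then have "(\<lambda>x. opair x ((h \<circ> app E f) x)) ` D' \<subseteq> ?X" by blast
  then have "(\<lambda>x. opair x ((h \<circ> app E f) x)) ` D' = {p \<in> ?X. sat E M ?\<phi> (v(0 := p))}"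
    using s XM by blast
  then show "isset ((\<lambda>x. opair x ((h \<circ> app E f) x)) ` D')"
    using isset_Sep[OF X, of v ?\<phi>] v unfolding asg_def by simp
qed

text \<open>Composing \<open>h'\<close> with \<open>f\<close> gives a second collapse of the same
  relation, which \<open>collapse_unique\<close> identifies with \<open>h\<close>.\<close>

lemma iso_A1:
  assumes c: "cfun D h A" "cfun D' h' A'" and f: "is_iso E M {sE} (A1 D h) (A1 D' h') f"
  shows "bij_betw (app E f) D D'" "x \<in> D \<Longrightarrow> h' (app E f x) = h x"
proof -
  note F = f[unfolded A1_def is_iso_struct[OF good_A1[OF c(1)] good_A1[OF c(2)]]]
  show bij: "bij_betw (app E f) D D'" using F by blast
  have c': "cfun D (h' \<circ> app E f) A'"
    by (rule cfun_comp[OF c(2) _ _ bij cfun_D(1)[OF c(1)]]) (use F in blast)+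
  have fD: "app E f x \<in> D'" if "x \<in> D" for x using bij that unfolding bij_betw_def by blast
  have "E (h x) (h y) \<longleftrightarrow> E ((h' \<circ> app E f) x) ((h' \<circ> app E f) y)" if xy: "x \<in> D" "y \<in> D" for x y
  proof -
    have "[x, y] \<in> r1 D h sE \<longleftrightarrow> map (app E f) [x, y] \<in> r1 D' h' sE"
      using F xy by simp
    then show ?thesis using xy fD by (auto simp: r1_simps)
  qed
  from collapse_unique[OF c(1) c' this] show "h' (app E f x) = h x" if "x \<in> D" using that by simp
qed

text \<open>The extra points carry no structure, so sending one to the other extends
  \<open>f\<close> whatever \<open>b\<close> and \<open>b'\<close> are. This is what leaves the
  choice of \<open>b\<close> free.\<close>

lemma iso_extends_B1:
  assumes c: "cfun D h A" "cfun D' h' A'" and b: "b \<in> M" "b' \<in> M"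
    and f: "is_iso E M {sE} (A1 D h) (A1 D' h') f"
  shows "\<exists>g. is_iso E M {sE, sP} (B1 D h b) (B1 D' h' b') g \<and> (\<forall>x\<in>D. app E g x = app E f x)"
proof -
  let ?p = "opair (mk D) b" and ?p' = "opair (mk D') b'"
  note bij = iso_A1(1)[OF c f] and hf = iso_A1(2)[OF c f]
  have fM: "f \<in> M" "is_function E f D D'"
    using f unfolding A1_def is_iso_struct[OF good_A1[OF c(1)] good_A1[OF c(2)]] by blast+
  note F = is_function_fn[OF fM cfun_D(2)[OF c(1)]]
  define g where "g x = (if x = ?p then ?p' else app E f x)" for x
  have pM: "?p \<in> M" "?p' \<in> M" using b cfun_D(1)[OF c(1)] cfun_D(1)[OF c(2)] by simp_all
  have p: "?p \<notin> D" "?p' \<notin> D'" using point_notin[OF c(1) b(1)] point_notin[OF c(2) b(2)] .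
  have gD: "g x = app E f x" if "x \<in> D" for x using p(1) that unfolding g_def by auto
  have gp: "g ?p = ?p'" unfolding g_def by simp
  have fD: "app E f x \<in> D'" if "x \<in> D" for x using bij that unfolding bij_betw_def by blast
  \<comment> \<open>The extended graph has just one new element, so it remains a set of the
    model.\<close>
  have im: "(\<lambda>x. opair x (g x)) ` insert ?p D = insert (opair ?p ?p') ((\<lambda>x. opair x (app E f x)) ` D)"
    using gD gp by auto
  have "isset ((\<lambda>x. opair x (g x)) ` insert ?p D)"
    unfolding im by (rule isset_insert[OF _ F(4)]) (use pM in simp)
  moreover have "insert ?p D \<subseteq> M" using pM cfun_D(2)[OF c(1)] by simp
  moreover have "g ` insert ?p D \<subseteq> M" using gD gp pM F(3) by auto
  ultimately have I: "isset ((\<lambda>x. opair x (g x)) ` insert ?p D)" "insert ?p D \<subseteq> M" "g ` insert ?p D \<subseteq> M" .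
  have "g ` insert ?p D \<subseteq> insert ?p' D'" using fD gD gp by auto
  note G = fn_M[OF I] app_fn[OF I] is_function_fnI[OF I this]
  let ?g = "fn (insert ?p D) g"
  have "bij_betw g (insert ?p D) (insert ?p' D')"
  proof -
    have "bij_betw g D D'" using bij bij_betw_cong[of D g "app E f" D'] gD by simp
    moreover have "bij_betw g {?p} {?p'}" using gp by (simp add: bij_betw_def)
    ultimately have "bij_betw g (D \<union> {?p}) (D' \<union> {?p'})" using p(2) by (intro bij_betw_combine) auto
    then show ?thesis by simp
  qed
  then have B: "bij_betw (app E ?g) (insert ?p D) (insert ?p' D')"
    using G(2) bij_betw_cong[of "insert ?p D" "app E ?g" g "insert ?p' D'"] by simp
  have gin: "g x \<in> D' \<longleftrightarrow> x \<in> D" if "x \<in> insert ?p D" for x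
    using that fD gD gp p by (cases "x = ?p") auto
  have "xs \<in> r1 D h s \<longleftrightarrow> map (app E ?g) xs \<in> r1 D' h' s"
    if s: "s \<in> {sE, sP}" and xs: "set xs \<subseteq> insert ?p D" for s xs
  proof -
    have m: "map (app E ?g) xs = map g xs" using G(2) xs by auto
    show ?thesis
    proof (cases "s = sE")
      case True
      have "xs \<in> r1 D h sE \<longleftrightarrow> map g xs \<in> r1 D' h' sE"
      proof (cases "\<exists>x y. xs = [x, y]")
        case True
        then obtain x y where xy: "xs = [x, y]" by blast
        have mem: "x \<in> insert ?p D" "y \<in> insert ?p D" using xs xy by simp_all
        have "xs \<in> r1 D h sE \<longleftrightarrow> x \<in> D \<and> y \<in> D \<and> E (h x) (h y)"
          unfolding xy r1_simps by simp
        moreover have "map g xs \<in> r1 D' h' sE \<longleftrightarrow> g x \<in> D' \<and> g y \<in> D' \<and> E (h' (g x)) (h' (g y))"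
          unfolding xy r1_simps by simp
        moreover have "h' (g z) = h z" if "z \<in> D" for z using gD[OF that] hf[OF that] by simp
        ultimately show ?thesis using gin[OF mem(1)] gin[OF mem(2)] by (simp cong: conj_cong)
      next
        case False
        then show ?thesis unfolding r1_simps by (auto simp: map_eq_Cons_conv)
      qed
      then show ?thesis unfolding m True .
    next
      case False
      then have s: "s = sP" using s by simp
      have "xs \<in> r1 D h sP \<longleftrightarrow> map g xs \<in> r1 D' h' sP"
      proof (cases "\<exists>x. xs = [x]")
        case True
        then obtain x where x: "xs = [x]" by blast
        then have "x \<in> insert ?p D" using xs by simp
        then show ?thesis using gin[of x] unfolding x r1_simps by simp
      next
        case False
        then show ?thesis unfolding r1_simps by (auto simp: map_eq_Cons_conv)
      qed
      then show ?thesis unfolding m s .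
    qed
  qed
  then have "is_iso E M {sE, sP} (B1 D h b) (B1 D' h' b') ?g"
    unfolding B1_def is_iso_struct[OF good_B1[OF c(1) b(1)] good_B1[OF c(2) b(2)]]
    using G(1,3) B by blast
  moreover have "app E ?g x = app E f x" if "x \<in> D" for x using G(2) gD that by simp
  ultimately show ?thesis by blast
qed

text \<open>The collapse of the copy is \<open>h\<close> after the inverse of \<open>f\<close>. Once
  the graph of the inverse is in the model, \<open>cfun_comp\<close> applies, and the target
  \<open>A\<close> stays the same.\<close>

lemma iso_closed_A1:
  assumes c: "cfun D h A" and X: "X \<in> M" "is_structure E {sE} X" and f: "is_iso E M {sE} (A1 D h) X f"
  obtains D' h' where "cfun D' h' A" "X = A1 D' h'"
proof -
  define D' r where "D' = univ E X" and "r = (\<lambda>s. {xs. rel_holds E X s xs})"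
  have g: "good D' r {sE}" and Xr: "X = struct D' r {sE}"
    using structure_repr[OF rlang1(1)[OF c] X(2,1)] unfolding D'_def r_def by blast+
  note F = f[unfolded A1_def Xr is_iso_struct[OF good_A1[OF c] g]]
  have fM: "f \<in> M" "is_function E f D D'" and bij: "bij_betw (app E f) D D'"
    and rel: "\<And>xs. set xs \<subseteq> D \<Longrightarrow> xs \<in> r1 D h sE \<longleftrightarrow> map (app E f) xs \<in> r sE"
    using F by blast+
  note Ff = is_function_fn[OF fM cfun_D(2)[OF c]]
  define i where "i = the_inv_into D (app E f)"
  have inj: "inj_on (app E f) D" and im: "app E f ` D = D'" using bij unfolding bij_betw_def by blast+
  have i: "i (app E f x) = x" if "x \<in> D" for x unfolding i_def by (rule the_inv_into_f_f[OF inj that])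
  have bij_i: "bij_betw i D' D" unfolding i_def by (rule bij_betw_the_inv_into[OF bij])
  have D': "isset D'" "D' \<subseteq> M" using good_isset[OF g] good_D[OF g] .
  have DM: "D \<subseteq> M" by (rule cfun_D(2)[OF c])
  have iM: "i ` D' \<subseteq> M" using bij_i DM unfolding bij_betw_def by blast
  have "isset ((\<lambda>y. opair y (i y)) ` D')"
  proof -
    let ?X = "{opair x y | x y. x \<in> D' \<and> y \<in> D}"
    let ?\<phi> = "fEx 3 (fEx 4 (FAnd (fPairIn 6 4 3 1) (fTm (tPair (TV 3) (TV 4)) 6 0)))"
    define v :: "nat \<Rightarrow> 'v" where "v = (\<lambda>_. f)"
    have v: "asg v" unfolding v_def using fM by (simp add: asg_def image_subset_iff)
    have X: "isset ?X" by (rule isset_prod[OF D'(1) cfun_D(1)[OF c]])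
    have XM: "?X \<subseteq> M" by (rule isset_subset_M[OF X])
    have Ef: "E (opair x y) f \<longleftrightarrow> x \<in> D \<and> y = app E f x" if "x \<in> M" "y \<in> M" for x y
      using pairs_in_fn[OF Ff(4) DM Ff(3)] pairs_in_iff[OF fM(1), of x y] Ff(1) that by auto
    have s: "sat E M ?\<phi> (v(0 := p)) \<longleftrightarrow> (\<exists>y\<in>D'. p = opair y (i y))" if "p \<in> M" for p
    proof -
      have "sat E M ?\<phi> (v(0 := p)) \<longleftrightarrow> (\<exists>x\<in>M. \<exists>y\<in>M. E (opair y x) f \<and> p = opair x y)"
        using v that by (simp add: sat_fTm sat_fPairIn v_def)
      also have "\<dots> \<longleftrightarrow> (\<exists>x\<in>M. \<exists>y\<in>M. (y \<in> D \<and> x = app E f y) \<and> p = opair x y)"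
        by (intro bex_cong refl) (simp only: Ef)
      also have "\<dots> \<longleftrightarrow> (\<exists>y\<in>D. p = opair (app E f y) y)"
        using DM Ff(3) by blast
      also have "\<dots> \<longleftrightarrow> (\<exists>y\<in>D. p = opair (app E f y) (i (app E f y)))"
        by (intro bex_cong refl) (simp only: i)
      also have "\<dots> \<longleftrightarrow> (\<exists>y\<in>D'. p = opair y (i y))"
        unfolding im[symmetric] by blast
      finally show ?thesis .
    qed
    have "i ` D' = D" using bij_i unfolding bij_betw_def by blast
    then have "(\<lambda>y. opair y (i y)) ` D' \<subseteq> ?X" by blast
    then have "(\<lambda>y. opair y (i y)) ` D' = {p \<in> ?X. sat E M ?\<phi> (v(0 := p))}"
      using s XM by blast
    then show ?thesis using isset_Sep[OF X, of v ?\<phi>] v unfolding asg_def by simp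
  qed
  note I = this D'(2) iM
  have iD: "i ` D' \<subseteq> D" using bij_i unfolding bij_betw_def by blast
  have app_i: "app E (fn D' i) y = i y" if "y \<in> D'" for y by (rule app_fn[OF I that])
  have "bij_betw (app E (fn D' i)) D' D"
    using bij_i app_i bij_betw_cong[of D' "app E (fn D' i)" i D] by simp
  then have c': "cfun D' (h \<circ> app E (fn D' i)) A"
    by (rule cfun_comp[OF c fn_M[OF I] is_function_fnI[OF I iD] _ D'(1)])
  have "r1 D' (h \<circ> app E (fn D' i)) sE = r sE"
  proof (rule Set.set_eqI)
    fix ys
    have "ys \<in> r sE \<longleftrightarrow> (\<exists>x\<in>D. \<exists>y\<in>D. ys = [app E f x, app E f y] \<and> E (h x) (h y))"
    proof
      assume ys: "ys \<in> r sE"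
      then have "set ys \<subseteq> app E f ` D" using good_set[OF g, of sE] im by auto
      then obtain ps where ps: "ys = map (app E f) ps" "set ps \<subseteq> D" by (rule ex_map_list)
      then have "ps \<in> r1 D h sE" using rel[OF ps(2)] ys by simp
      then obtain x y where "ps = [x, y]" "x \<in> D" "y \<in> D" "E (h x) (h y)" unfolding r1_simps by blast
      then show "\<exists>x\<in>D. \<exists>y\<in>D. ys = [app E f x, app E f y] \<and> E (h x) (h y)"
        unfolding ps(1) by (intro bexI[of _ x] bexI[of _ y]) simp_all
    next
      assume "\<exists>x\<in>D. \<exists>y\<in>D. ys = [app E f x, app E f y] \<and> E (h x) (h y)"
      then obtain x y where xy: "x \<in> D" "y \<in> D" "ys = [app E f x, app E f y]" "E (h x) (h y)" by blast
      then show "ys \<in> r sE" using rel[of "[x, y]"] by (simp add: r1_simps)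
    qed
    also have "\<dots> \<longleftrightarrow> (\<exists>x\<in>D'. \<exists>y\<in>D'. ys = [x, y] \<and> E (h (i x)) (h (i y)))"
      unfolding im[symmetric] using i by simp
    also have "\<dots> \<longleftrightarrow> ys \<in> r1 D' (h \<circ> app E (fn D' i)) sE"
      unfolding r1_simps using app_i by auto
    finally show "ys \<in> r1 D' (h \<circ> app E (fn D' i)) sE \<longleftrightarrow> ys \<in> r sE" by blast
  qed
  then have "X = A1 D' (h \<circ> app E (fn D' i))"
    unfolding A1_def Xr by (intro struct_cong) auto
  then show thesis using that c' by blast
qed

subsection \<open>Definability of the rigid construction\<close>

text \<open>In the third conjunct one equivalence states single-valuedness (left to right) and
  injectivity (right to left) at once.\<close>

lemma bij_internal:
  assumes M: "D \<in> M" "f \<in> M" "t \<in> M"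
  shows "(\<forall>p\<in>M. E p f \<longrightarrow> (\<exists>x\<in>M. \<exists>y\<in>M. E x D \<and> E y t \<and> p = opair x y)) \<and>
     (\<forall>x\<in>M. E x D \<longrightarrow> (\<exists>y\<in>M. E (opair x y) f)) \<and>
     (\<forall>x\<in>M. \<forall>y\<in>M. \<forall>x'\<in>M. \<forall>y'\<in>M. E (opair x y) f \<and> E (opair x' y') f \<longrightarrow> (x = x' \<longleftrightarrow> y = y')) \<and>
     (\<forall>y\<in>M. E y t \<longrightarrow> (\<exists>x\<in>M. E (opair x y) f))
   \<longleftrightarrow> (\<exists>h. isset ((\<lambda>x. opair x (h x)) ` elts E D) \<and> f = fn (elts E D) h \<and> bij_betw h (elts E D) (elts E t))"
  (is "?a \<and> ?b \<and> ?c \<and> ?d \<longleftrightarrow> ?R")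
proof
  have DM: "x \<in> M" if "E x D" for x using mem_M[OF that M(1)] .
  have tM: "x \<in> M" if "E x t" for x using mem_M[OF that M(3)] .
  have fM: "x \<in> M" if "E x f" for x using mem_M[OF that M(2)] .
  {
    assume L: "?a \<and> ?b \<and> ?c \<and> ?d"
    have "\<forall>x\<in>elts E D. \<exists>y\<in>M. E (opair x y) f" using L DM by simp
    then obtain h where h: "\<And>x. E x D \<Longrightarrow> h x \<in> M \<and> E (opair x (h x)) f"
      by (metis mem_elts)
    have in_D: "E x D \<and> E y t" if xy: "E (opair x y) f" "x \<in> M" "y \<in> M" for x y
    proof -
      obtain x' y' where xy': "x' \<in> M" "y' \<in> M" "E x' D" "E y' t" "opair x y = opair x' y'"
        using conjunct1[OF L] fM[OF xy(1)] xy(1) by blast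
      then show ?thesis using opair_eqD[OF xy'(5) xy(2,3) xy'(1,2)] by simp
    qed
    have c: "x = x' \<longleftrightarrow> y = y'" if "E (opair x y) f" "E (opair x' y') f" "x \<in> M" "y \<in> M" "x' \<in> M" "y' \<in> M" for x y x' y'
      using L that by blast
    have inj: "inj_on h (elts E D)"
    proof (rule inj_onI)
      fix x y assume "x \<in> elts E D" "y \<in> elts E D" "h x = h y"
      then show "x = y" using c[of x "h x" y "h y"] h[of x] h[of y] DM by simp
    qed
    have sub: "h ` elts E D \<subseteq> elts E t"
      using in_D[OF conjunct2[OF h]] h DM by auto
    have "y \<in> h ` elts E D" if y: "E y t" for y
    proof -
      obtain x where x: "x \<in> M" "E (opair x y) f"
        using conjunct2[OF conjunct2[OF conjunct2[OF L]]] y tM[OF y] by blast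
      then have xD: "E x D" using in_D[of x y] tM[OF y] by blast
      then have "y = h x" using c[of x y x "h x"] x h[OF xD] tM[OF y] by simp
      then show ?thesis using xD by simp
    qed
    then have bij: "bij_betw h (elts E D) (elts E t)"
      using inj sub unfolding bij_betw_def by auto
    have "p \<in> elts E f \<longleftrightarrow> p \<in> (\<lambda>x. opair x (h x)) ` elts E D" for p
    proof
      assume "p \<in> elts E f"
      then have pf: "E p f" by simp
      then obtain x y where xy: "x \<in> M" "y \<in> M" "E x D" "p = opair x y"
        using conjunct1[OF L] fM[OF pf] pf by blast
      then have "y = h x" using c[of x y x "h x"] pf h[of x] by simp
      then show "p \<in> (\<lambda>x. opair x (h x)) ` elts E D" using xy by simp
    next
      assume "p \<in> (\<lambda>x. opair x (h x)) ` elts E D"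
      then show "p \<in> elts E f" using h by auto
    qed
    then have "(\<lambda>x. opair x (h x)) ` elts E D = elts E f" by blast
    then have "isset ((\<lambda>x. opair x (h x)) ` elts E D)" "f = fn (elts E D) h"
      unfolding fn_def using M(2) by simp_all
    then show ?R using bij by blast
  next
    assume ?R
    then obtain h where h: "isset ((\<lambda>x. opair x (h x)) ` elts E D)" "f = fn (elts E D) h"
      and bij: "bij_betw h (elts E D) (elts E t)" by blast
    have inj: "x = y" if "h x = h y" "E x D" "E y D" for x y
      using bij_betw_imp_inj_on[OF bij] that by (simp add: inj_on_def)
    have ht: "E (h x) t" if "E x D" for x using bij_betwE[OF bij] that by simp
    have D: "elts E D \<subseteq> M" using DM by auto
    have hM: "h ` elts E D \<subseteq> M" using ht tM by auto
    have Ef: "E (opair x y) f \<longleftrightarrow> E x D \<and> y = h x" if "x \<in> M" "y \<in> M" for x y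
      using pairs_in_fn[OF h(1) D hM] pairs_in_iff[OF M(2), of x y] that h(2) by auto
    have Ef': "E p f \<longleftrightarrow> (\<exists>x. E x D \<and> p = opair x (h x))" for p
      unfolding h(2) fn_def using h(1) by auto
    have surj: "\<exists>x. E x D \<and> h x = y" if "E y t" for y
      using bij_betw_imp_surj_on[OF bij] that by (metis imageE mem_elts)
    have a: ?a using Ef' ht DM tM by blast
    have b: ?b using Ef ht tM by blast
    have c: ?c using Ef inj by metis
    have d: ?d using surj Ef DM by blast
    show "?a \<and> ?b \<and> ?c \<and> ?d" using a b c d by blast
  }
qed

lemma sat_fBij:
  assumes v: "asg v" "D < N" "f < N" "t < N"
  shows "sat E M (fBij N D f t) v \<longleftrightarrow>
    (\<exists>h. isset ((\<lambda>x. opair x (h x)) ` elts E (v D)) \<and> v f = fn (elts E (v D)) h \<and>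
         bij_betw h (elts E (v D)) (elts E (v t)))"
  unfolding bij_internal[OF asg_M[OF v(1), of D] asg_M[OF v(1), of f] asg_M[OF v(1), of t], symmetric]
  using v by (simp add: fBij_def sat_fTm sat_fPairIn)

lemma A1_eq: "A1 D h = opair (mk D) (mk {opair sE (mk (tup ` r1 D h sE))})"
  by (simp add: A1_def struct_def fn_def)

lemma B1_eq: "B1 D h b = opair (mk (insert (opair (mk D) b) D))
    (mk {opair sE (mk (tup ` r1 D h sE)), opair sP (mk (tup ` r1 D h sP))})"
  by (simp add: B1_def struct_def fn_def)

lemma sat_fA1:
  assumes v: "asg v" "a < N" "D < N" "f < N" "2 < N" "v 2 = sE"
    and c: "cfun (elts E (v D)) h A" "v f = fn (elts E (v D)) h"
  shows "sat E M (fA1 N a D f) v \<longleftrightarrow> v a = A1 (elts E (v D)) h"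
proof -
  let ?R = "tup ` r1 (elts E (v D)) h sE"
  have R: "isset ?R" using isset_r1[OF c(1)] by simp
  have "sat E M (fA1 N a D f) v \<longleftrightarrow> (\<exists>r\<in>M. (\<forall>z\<in>M. E z r \<longleftrightarrow> z \<in> ?R) \<and> v a = opair (v D) (mk {opair sE r}))"
    using v by (simp add: fA1_def sat_fTm sat_fRel_cfun[OF c(1)] c(2) del: tup.simps)
  also have "\<dots> \<longleftrightarrow> (\<exists>r\<in>M. r = mk ?R \<and> v a = opair (v D) (mk {opair sE r}))"
    by (intro bex_cong refl) (simp only: elts_iff_M[OF _ R])
  also have "\<dots> \<longleftrightarrow> v a = A1 (elts E (v D)) h"
    unfolding A1_eq using mk_M[OF R] by (simp only: mk_elts) blast
  finally show ?thesis .
qed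

lemma sat_fB1:
  assumes v: "asg v" "b' < N" "D < N" "f < N" "b < N" "3 < N" "v 2 = sE" "v 3 = sP"
    and c: "cfun (elts E (v D)) h A" "v f = fn (elts E (v D)) h"
  shows "sat E M (fB1 N b' D f b) v \<longleftrightarrow> v b' = B1 (elts E (v D)) h (v b)"
proof -
  let ?R = "tup ` r1 (elts E (v D)) h sE" and ?Q = "tup ` r1 (elts E (v D)) h sP"
  let ?U = "insert (opair (v D) (v b)) (elts E (v D))"
  have R: "isset ?R" "isset ?Q" using isset_r1[OF c(1)] by simp_all
  have U: "isset ?U" using v(1) by simp
  have Q: "z \<in> ?Q \<longleftrightarrow> (\<exists>x. E x (v D) \<and> z = tup [x])" for z
    unfolding r1_simps by (auto simp del: tup.simps)
  have Q': "(\<exists>x\<in>M. E x (v D) \<and> z = tup [x]) \<longleftrightarrow> z \<in> ?Q" for z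
    unfolding Q using mem_M[OF _ asg_M[OF v(1), of D]] by blast
  have "sat E M (fB1 N b' D f b) v \<longleftrightarrow> (\<exists>r\<in>M. \<exists>q\<in>M. \<exists>u\<in>M.
      (\<forall>z\<in>M. E z r \<longleftrightarrow> z \<in> ?R) \<and> (\<forall>z\<in>M. E z q \<longleftrightarrow> (\<exists>x\<in>M. E x (v D) \<and> z = tup [x])) \<and>
      (\<forall>z\<in>M. E z u \<longleftrightarrow> z \<in> ?U) \<and> v b' = opair u (mk {opair sE r, opair sP q}))"
    using v by (simp add: fB1_def sat_fTm sat_fRel_cfun[OF c(1)] c(2) disj_commute del: tup.simps)
  also have "\<dots> \<longleftrightarrow> (\<exists>r\<in>M. \<exists>q\<in>M. \<exists>u\<in>M. r = mk ?R \<and> q = mk ?Q \<and> u = mk ?U \<and>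
      v b' = opair u (mk {opair sE r, opair sP q}))"
    unfolding Q' by (intro bex_cong refl) (simp only: elts_iff_M[OF _ R(1)] elts_iff_M[OF _ R(2)] elts_iff_M[OF _ U])
  also have "\<dots> \<longleftrightarrow> v b' = B1 (elts E (v D)) h (v b)"
    unfolding B1_eq using mk_M[OF R(1)] mk_M[OF R(2)] mk_M[OF U] by (simp only: mk_elts) blast
  finally show ?thesis .
qed

text \<open>In all formulas the variables 2 to 5 stand for the four symbols and the variables 0 and 1
  for the arguments.\<close>

definition par :: "nat \<Rightarrow> 'v" where
  "par i = (if i = 2 then sE else if i = 3 then sP else if i = 4 then sA else if i = 5 then sB else mk {})"

lemma asg_par: "asg par"
  unfolding asg_def par_def using syms_M by auto

lemma par_simps [simp]: "par 2 = sE" "par 3 = sP" "par 4 = sA" "par 5 = sB"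
  by (simp_all add: par_def)

definition C1 :: "'v construction" where
  "C1 = \<lparr>con_L = (fOr (FEq 0 2) (FEq 0 3), par), con_Lminus = (FEq 0 2, par),
     con_graph = (fG1, par), con_P = sP\<rparr>"

definition C2 :: "'v construction" where
  "C2 = \<lparr>con_L = (fOr (FEq 0 3) (fOr (FEq 0 4) (FEq 0 5)), par), con_Lminus = (FEq 0 4, par),
     con_graph = (fEx 1 (fQ 6 1 0), par), con_P = sP\<rparr>"

lemma pfm_C: "pfm_over M (con_L C1)" "pfm_over M (con_Lminus C1)" "pfm_over M (con_graph C1)"
   "pfm_over M (con_L C2)" "pfm_over M (con_Lminus C2)" "pfm_over M (con_graph C2)"
  using asg_par by (simp_all add: pfm_over_def C1_def C2_def asg_def)

lemma lang_C: "lang E M C1 = {sE, sP}" "lang_minus E M C1 = {sE}" "lang E M C2 = L2" "lang_minus E M C2 = {sA}"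
  using syms_M by (auto simp: lang_def lang_minus_def extent_def holds1_def C1_def C2_def L2_def)

lemma P_C: "con_P C1 = sP" "con_P C2 = sP"
  by (simp_all add: C1_def C2_def)

lemma Q2_M: "Q2 A B \<Longrightarrow> A \<in> M \<and> B \<in> M"
  unfolding Q2_def using str2_M pair2_L2 pair2_base by blast

lemma graph_C2: "graph E M C2 = {str2 d UNIV L2 | d. inM d}"
proof -
  have "B \<in> graph E M C2 \<longleftrightarrow> B \<in> M \<and> (\<exists>A\<in>M. Q2 A B)" for B
    unfolding graph_def extent_def holds1_def C2_def
    using asg_par by (simp add: sat_fQ cong: conj_cong)
  then have "B \<in> graph E M C2 \<longleftrightarrow> (\<exists>A. Q2 A B)" for B using Q2_M[of _ B] by blast
  then show ?thesis unfolding Q2_def by blast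
qed

lemma graph_C1: "graph E M C1 = {B1 D h B | D h A B. cfun D h A \<and> Q2 A B}"
proof -
  \<comment> \<open>The conjunct \<open>fB1\<close> is left unevaluated: \<open>sat_fB1\<close>
    needs a collapse \<open>cfun\<close>, which only the other conjuncts together supply.\<close>
  have sat_fG1: "sat E M fG1 (par(0 := X)) \<longleftrightarrow> (\<exists>D\<in>M. \<exists>f\<in>M. \<exists>t\<in>M. \<exists>A\<in>M. \<exists>B\<in>M.
     (\<exists>h. isset ((\<lambda>x. opair x (h x)) ` elts E D) \<and> f = fn (elts E D) h \<and> bij_betw h (elts E D) (elts E t)) \<and>
     t = mk (cone A) \<and> Q2 A B \<and> sat E M (fB1 11 0 6 7 10) (par(0 := X, 6 := D, 7 := f, 8 := t, 9 := A, 10 := B)))"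
    if "X \<in> M" for X
    unfolding fG1_def using that asg_par
    by (simp add: sat_fBij sat_fCone sat_fQ isset_cone cong: conj_cong)
  have sat_B: "sat E M (fB1 11 0 6 7 10) (par(0 := X, 6 := D, 7 := f, 8 := t, 9 := A, 10 := B)) \<longleftrightarrow> X = B1 (elts E D) h B"
    if "X \<in> M" "D \<in> M" "f \<in> M" "t \<in> M" "A \<in> M" "B \<in> M" and c: "cfun (elts E D) h A" "f = fn (elts E D) h" for X D f t A B h
  proof -
    let ?v = "par(0 := X, 6 := D, 7 := f, 8 := t, 9 := A, 10 := B)"
    have "asg ?v" using that asg_par by simp
    then show ?thesis using sat_fB1[of ?v 0 11 6 7 10 h A] c by simp
  qed
  have "X \<in> graph E M C1 \<longleftrightarrow> (\<exists>D h A B. X = B1 D h B \<and> cfun D h A \<and> Q2 A B)" for X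
  proof
    assume "X \<in> graph E M C1"
    then have X: "X \<in> M" "sat E M fG1 (par(0 := X))"
      unfolding graph_def extent_def holds1_def C1_def by simp_all
    then obtain D f t A B h where M: "D \<in> M" "f \<in> M" "t \<in> M" "A \<in> M" "B \<in> M"
      and h: "isset ((\<lambda>x. opair x (h x)) ` elts E D)" "f = fn (elts E D) h" "bij_betw h (elts E D) (elts E t)"
      and tAB: "t = mk (cone A)" "Q2 A B" "sat E M (fB1 11 0 6 7 10) (par(0 := X, 6 := D, 7 := f, 8 := t, 9 := A, 10 := B))"
      unfolding sat_fG1[OF X(1)] by blast
    have c: "cfun (elts E D) h A"
      unfolding cfun_def using M h tAB(1) isset_cone[OF M(4)] by simp
    show "\<exists>D h A B. X = B1 D h B \<and> cfun D h A \<and> Q2 A B"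
      using sat_B[OF X(1) M c h(2)] tAB c by blast
  next
    assume "\<exists>D h A B. X = B1 D h B \<and> cfun D h A \<and> Q2 A B"
    then obtain D h A B where X: "X = B1 D h B" "cfun D h A" "Q2 A B" by blast
    have AB: "A \<in> M" "B \<in> M" using Q2_M[OF X(3)] by blast+
    have XM: "X \<in> M" unfolding X(1) by (rule B1_M[OF X(2) AB(2)])
    have D: "isset D" "mk D \<in> M" "elts E (mk D) = D" using cfun_D[OF X(2)] by simp_all
    have cA: "mk (cone A) \<in> M" "elts E (mk (cone A)) = cone A" using isset_cone[OF AB(1)] by simp_all
    have f: "fn D h \<in> M" by (rule cfun_fn[OF X(2)])
    have s: "sat E M (fB1 11 0 6 7 10) (par(0 := X, 6 := mk D, 7 := fn D h, 8 := mk (cone A), 9 := A, 10 := B))"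
      using sat_B[OF XM D(2) f cA(1) AB, of h] D(3) X by simp
    have h: "isset ((\<lambda>x. opair x (h x)) ` elts E (mk D)) \<and> fn D h = fn (elts E (mk D)) h \<and>
        bij_betw h (elts E (mk D)) (elts E (mk (cone A)))"
      unfolding D(3) cA(2) using X(2) unfolding cfun_def by simp
    have "sat E M fG1 (par(0 := X))"
      unfolding sat_fG1[OF XM]
      by (rule bexI[OF _ D(2)], rule bexI[OF _ f], rule bexI[OF _ cA(1)], rule bexI[OF _ AB(1)], rule bexI[OF _ AB(2)])
        (intro conjI exI[of _ h] h refl X(3) s)
    then show "X \<in> graph E M C1" using XM unfolding graph_def extent_def holds1_def C1_def by simp
  qed
  then show ?thesis by blast
qed

lemma minus_of_C1:
  assumes c: "cfun D h A" and b: "b \<in> M"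
  shows "minus_of E M C1 (B1 D h b) X \<longleftrightarrow> X = A1 D h"
  unfolding minus_of_def lang_C P_C using minus_B1[OF c b, of X] A1_M[OF c] by blast

lemma con_domain_C1: "con_domain E M C1 = {A1 D h | D h A B. cfun D h A \<and> Q2 A B}"
proof -
  have "X \<in> con_domain E M C1 \<longleftrightarrow> (\<exists>D h A B. cfun D h A \<and> Q2 A B \<and> minus_of E M C1 (B1 D h B) X)" for X
    unfolding con_domain_def graph_C1 by blast
  also have "\<dots> X \<longleftrightarrow> (\<exists>D h A B. cfun D h A \<and> Q2 A B \<and> X = A1 D h)" for X
    using minus_of_C1 Q2_M by metis
  finally show ?thesis by blast
qed

section \<open>The rigid construction is a construction, rigid-based and natural\<close>

lemma is_construction_C1: "is_construction E M C1"
  unfolding is_construction_def lang_C P_C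
proof (intro conjI ballI allI impI pfm_C)
  have L: "rlang {sE}" "rlang {sE, sP}" unfolding rlang_def using rsyms by auto
  show "is_language E M {sE, sP}" "is_language E M {sE}"
    by (rule rlang_is_language[OF L(2)], rule rlang_is_language[OF L(1)])
  show "{sE} \<subseteq> {sE, sP}" "sP \<in> {sE, sP} - {sE}" "rel_symbol E 1 sP"
    using syms_distinct is_symbol_rsym[OF rsyms(1)] by auto
  fix B assume "B \<in> graph E M C1"
  then obtain D h A b where c: "cfun D h A" "Q2 A b" "B = B1 D h b" unfolding graph_C1 by blast
  have b: "b \<in> M" using Q2_M[OF c(2)] by blast
  show "is_structure E {sE, sP} B" unfolding c(3) B1_def by (rule is_structure_struct[OF good_B1[OF c(1) b]])
  show "\<exists>A. minus_of E M C1 B A" unfolding c(3) minus_of_C1[OF c(1) b] by blast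
next
  fix X X' assume "X \<in> con_domain E M C1" "X' \<in> M" and st: "is_structure E {sE} X' \<and> (\<exists>f. is_iso E M {sE} X X' f)"
  then obtain D h A B where c: "cfun D h A" "Q2 A B" "X = A1 D h" unfolding con_domain_C1 by blast
  obtain f where f: "is_iso E M {sE} (A1 D h) X' f" using st c(3) by blast
  \<comment> \<open>The copy collapses to the same \<open>A\<close>, so the same \<open>B\<close>
    witnesses that it is in the domain.\<close>
  obtain D' h' where "cfun D' h' A" "X' = A1 D' h'"
    using iso_closed_A1[OF c(1) \<open>X' \<in> M\<close> conjunct1[OF st] f] .
  then show "X' \<in> con_domain E M C1" unfolding con_domain_C1 using c(2) by blast
next
  fix X Y X' Y' f assume "X \<in> graph E M C1" "Y \<in> graph E M C1"
    and m: "minus_of E M C1 X X' \<and> minus_of E M C1 Y Y' \<and> is_iso E M {sE} X' Y' f"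
  then obtain D h A b where c: "cfun D h A" "Q2 A b" "X = B1 D h b" unfolding graph_C1 by blast
  obtain D' h' A' b' where c': "cfun D' h' A'" "Q2 A' b'" "Y = B1 D' h' b'"
    using \<open>Y \<in> graph E M C1\<close> unfolding graph_C1 by blast
  have b: "b \<in> M" "b' \<in> M" using Q2_M[OF c(2)] Q2_M[OF c'(2)] by blast+
  have X': "X' = A1 D h" using m minus_of_C1[OF c(1) b(1)] c(3) by simp
  have Y': "Y' = A1 D' h'" using m minus_of_C1[OF c'(1) b(2)] c'(3) by simp
  have "\<exists>g. is_iso E M {sE, sP} (B1 D h b) (B1 D' h' b') g \<and> (\<forall>x\<in>D. app E g x = app E f x)"
    by (rule iso_extends_B1[OF c(1) c'(1) b]) (use m X' Y' in simp)
  then show "\<exists>g. is_iso E M {sE, sP} X Y g \<and> (\<forall>x\<in>univ E X'. app E g x = app E f x)"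
    unfolding X' univ_A1[OF c(1)] c(3) c'(3) .
qed

text \<open>An automorphism preserves the collapse \<open>h\<close>, and \<open>h\<close> is
  injective.\<close>

lemma rigid_A1:
  assumes c: "cfun D h A" and f: "is_iso E M {sE} (A1 D h) (A1 D h) f" and x: "x \<in> D"
  shows "app E f x = x"
proof -
  have "app E f x \<in> D" using bij_betwE[OF iso_A1(1)[OF c c f]] x by blast
  then show ?thesis
    using iso_A1(2)[OF c c f x] x bij_betw_imp_inj_on[OF cfun_bij[OF c]] by (simp add: inj_onD)
qed

lemma rigid_based_C1: "rigid_based E M C1"
  unfolding rigid_based_def lang_C
proof (intro ballI allI impI)
  fix B X f x assume "B \<in> graph E M C1" and m: "minus_of E M C1 B X \<and> is_iso E M {sE} X X f" and x: "x \<in> univ E X"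
  then obtain D h A b where c: "cfun D h A" "Q2 A b" "B = B1 D h b" unfolding graph_C1 by blast
  have b: "b \<in> M" using Q2_M[OF c(2)] by blast
  have X: "X = A1 D h" using m minus_of_C1[OF c(1) b] c(3) by simp
  show "app E f x = x"
    by (rule rigid_A1[OF c(1)]) (use m x X univ_A1[OF c(1)] in simp_all)
qed

lemma isset_id: assumes X: "isset X" shows "isset ((\<lambda>x. opair x x) ` X)"
proof -
  let ?\<phi> = "fEx 1 (fTm (tPair (TV 1) (TV 1)) 2 0)"
  have P: "isset {opair x y | x y. x \<in> X \<and> y \<in> X}" by (rule isset_prod[OF X X])
  have XM: "X \<subseteq> M" by (rule isset_subset_M[OF X])
  have s: "sat E M ?\<phi> (par(0 := p)) \<longleftrightarrow> (\<exists>x\<in>M. p = opair x x)" if "p \<in> M" for p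
    using that asg_par by (simp add: sat_fTm)
  have "(\<lambda>x. opair x x) ` X = {p \<in> {opair x y | x y. x \<in> X \<and> y \<in> X}. sat E M ?\<phi> (par(0 := p))}"
  proof (rule Set.set_eqI)
    fix p
    show "p \<in> (\<lambda>x. opair x x) ` X \<longleftrightarrow> p \<in> {p \<in> {opair x y | x y. x \<in> X \<and> y \<in> X}. sat E M ?\<phi> (par(0 := p))}"
    proof
      assume "p \<in> (\<lambda>x. opair x x) ` X"
      then obtain x where x: "x \<in> X" "p = opair x x" by blast
      then have "x \<in> M" using XM by blast
      then show "p \<in> {p \<in> {opair x y | x y. x \<in> X \<and> y \<in> X}. sat E M ?\<phi> (par(0 := p))}"
        using s[of p] x by auto
    next
      assume "p \<in> {p \<in> {opair x y | x y. x \<in> X \<and> y \<in> X}. sat E M ?\<phi> (par(0 := p))}"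
      then obtain x y where xy: "p = opair x y" "x \<in> X" "y \<in> X" "sat E M ?\<phi> (par(0 := p))" by blast
      have M: "x \<in> M" "y \<in> M" using xy XM by blast+
      then obtain z where "z \<in> M" "p = opair z z" using s[of p] xy by auto
      then have "x = z \<and> y = z" using opair_eqD M xy(1) by blast
      then show "p \<in> (\<lambda>x. opair x x) ` X" using xy by simp
    qed
  qed
  then show ?thesis using isset_Sep[OF P, of par ?\<phi>] asg_par unfolding asg_def by simp
qed

lemma iso_id:
  assumes g: "good D r L"
  shows "is_iso E M L (struct D r L) (struct D r L) (fn D (\<lambda>x. x))"
    and "x \<in> D \<Longrightarrow> app E (fn D (\<lambda>x. x)) x = x"
proof -
  have I: "isset ((\<lambda>x. opair x x) ` D)" "D \<subseteq> M" "(\<lambda>x. x) ` D \<subseteq> M"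
    using isset_id[OF good_isset[OF g]] good_D[OF g] by simp_all
  show a: "app E (fn D (\<lambda>x. x)) x = x" if "x \<in> D" for x by (rule app_fn[OF I that])
  have F: "is_function E (fn D (\<lambda>x. x)) D D" by (rule is_function_fnI[OF I]) simp
  have "bij_betw (app E (fn D (\<lambda>x. x))) D D"
    using bij_betw_cong[of D "app E (fn D (\<lambda>x. x))" id D] a by simp
  moreover have "map (app E (fn D (\<lambda>x. x))) xs = xs" if "set xs \<subseteq> D" for xs
    using a that by (intro map_idI) blast
  ultimately show "is_iso E M L (struct D r L) (struct D r L) (fn D (\<lambda>x. x))"
    unfolding is_iso_struct[OF g g] using fn_M[OF I] F by simp
qed

lemma iso_fn:
  assumes g: "good D r L" and f: "is_iso E M L (struct D r L) (struct D r L) f" and "\<And>x. x \<in> D \<Longrightarrow> app E f x = x"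
  shows "f = fn D (\<lambda>x. x)"
proof -
  have "f \<in> M" "is_function E f D D" using f unfolding is_iso_struct[OF g g] by blast+
  then have "f = fn D (app E f)" using is_function_fn(1) good_D[OF g] by blast
  also have "\<dots> = fn D (\<lambda>x. x)" using assms(3) by (rule fn_cong)
  finally show ?thesis .
qed

text \<open>The base has only the identity automorphism, so sending it to the identity of
  \<open>B\<close> is a splitting. As a set of the model this map is a single ordered pair.\<close>

lemma natural_C1: "natural E M C1"
  unfolding natural_def lang_C
proof (intro ballI allI impI)
  fix B X assume "B \<in> graph E M C1" and m: "minus_of E M C1 B X"
  then obtain D h A b where c: "cfun D h A" "Q2 A b" "B = B1 D h b" unfolding graph_C1 by blast
  have b: "b \<in> M" using Q2_M[OF c(2)] by blast
  have X: "X = A1 D h" using m minus_of_C1[OF c(1) b] c(3) by simp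
  define U where "U = insert (opair (mk D) b) D"
  let ?iA = "fn D (\<lambda>x. x)" and ?iB = "fn U (\<lambda>x. x)"
  note gA = good_A1[OF c(1)] and gB = good_B1[OF c(1) b, folded U_def]
  have uX: "univ E X = D" and uB: "univ E B = U"
    unfolding X c(3) U_def using univ_A1[OF c(1)] univ_B1[OF c(1) b] .
  have XB: "X = struct D (r1 D h) {sE}" "B = struct U (r1 D h) {sE, sP}"
    unfolding X c(3) A1_def B1_def U_def by blast+
  have isoA: "is_iso E M {sE} X X f \<longleftrightarrow> f = ?iA" for f
  proof
    assume f: "is_iso E M {sE} X X f"
    have "app E f x = x" if "x \<in> D" for x
      by (rule rigid_A1[OF c(1) f[unfolded X] that])
    then show "f = ?iA" using iso_fn[OF gA, folded XB, OF f] by blast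
  qed (use iso_id(1)[OF gA, folded XB] in simp)
  have isoB: "is_iso E M {sE, sP} B B ?iB" using iso_id(1)[OF gB, folded XB] .
  have permA: "perm_of E X ?iA = (\<lambda>x\<in>D. x)"
    unfolding perm_of_def uX using iso_id(2)[OF gA] by (intro restrict_ext) blast
  have permB: "perm_of E B ?iB = (\<lambda>x\<in>U. x)"
    unfolding perm_of_def uB using iso_id(2)[OF gB] by (intro restrict_ext) blast
  \<comment> \<open>\<open>map_in_model\<close> prescribes the whole set of pairs, hence
    \<open>?iB\<close> has to be the only code of the identity permutation.\<close>
  have permB_iff: "is_iso E M {sE, sP} B B g \<and> (\<lambda>x\<in>U. x) = perm_of E B g \<longleftrightarrow> g = ?iB" for g
  proof
    assume g: "is_iso E M {sE, sP} B B g \<and> (\<lambda>x\<in>U. x) = perm_of E B g"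
    have "app E g x = x" if "x \<in> U" for x
      using g that unfolding perm_of_def uB by (metis restrict_apply')
    then show "g = ?iB" using iso_fn[OF gB, folded XB, OF conjunct1[OF g]] by blast
  qed (use isoB permB in simp)
  let ?s = "\<lambda>_. (\<lambda>x\<in>U. x)"
  have iM: "?iA \<in> M" "?iB \<in> M" using isoA isoB unfolding is_iso_def by blast+
  have S: "mk {opair ?iA ?iB} \<in> M" using iM by simp
  have "pairs_in E (mk {opair ?iA ?iB}) = {(f, g). is_iso E M {sE} X X f \<and> is_iso E M {sE, sP} B B g \<and>
      ?s (perm_of E X f) = perm_of E B g}"
  proof -
    have "(f, g) \<in> pairs_in E (mk {opair ?iA ?iB}) \<longleftrightarrow> f = ?iA \<and> g = ?iB" for f g
      unfolding pairs_in_iff[OF S] using iM opair_eqD[of f g ?iA ?iB] by auto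
    then show ?thesis using isoA permB_iff by auto
  qed
  then have "map_in_model E M {sE} X {sE, sP} B ?s" unfolding map_in_model_def using S by blast
  moreover have "splitting (Aut E M {sE, sP} B) (Aut E M {sE} X) (\<lambda>\<pi>. restrict \<pi> (univ E X)) ?s"
  proof -
    have cA: "carrier (Aut E M {sE} X) = {\<lambda>x\<in>D. x}"
    proof -
      have "{f. is_iso E M {sE} X X f} = {?iA}" using isoA by blast
      then show ?thesis unfolding Aut_def using permA by simp
    qed
    have cB: "(\<lambda>x\<in>U. x) \<in> carrier (Aut E M {sE, sP} B)"
      unfolding Aut_def using isoB permB by (simp add: image_iff) metis
    have mB: "(\<lambda>x\<in>U. x) \<otimes>\<^bsub>Aut E M {sE, sP} B\<^esub> (\<lambda>x\<in>U. x) = (\<lambda>x\<in>U. x)"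
      unfolding Aut_def uB using id_Bij[of U] by (simp add: BijGroup_def compose_def restrict_def fun_eq_iff)
    have "D \<subseteq> U" unfolding U_def by blast
    then have "restrict (\<lambda>x\<in>U. x) D = (\<lambda>x\<in>D. x)" by (auto simp: restrict_def fun_eq_iff)
    then show ?thesis
      unfolding splitting_def hom_def cA uX using cB mB by simp
  qed
  ultimately show "\<exists>s. map_in_model E M {sE} X {sE, sP} B s \<and>
      splitting (Aut E M {sE, sP} B) (Aut E M {sE} X) (\<lambda>\<pi>. restrict \<pi> (univ E X)) s" by blast
qed

subsection \<open>Uniformising the finite construction\<close>

lemma sat_fId:
  assumes v: "asg v" "f < N" "D < N"
  shows "sat E M (fId N f D) v \<longleftrightarrow> v f = fn (elts E (v D)) (\<lambda>x. x)"
proof -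
  have I: "isset ((\<lambda>x. opair x x) ` elts E (v D))" using v(1) by (intro isset_id) simp
  have "sat E M (fId N f D) v \<longleftrightarrow> (\<forall>z\<in>M. E z (v f) \<longleftrightarrow> (\<exists>x\<in>M. E x (v D) \<and> z = opair x x))"
    using v by (simp add: fId_def sat_fTm)
  also have "\<dots> \<longleftrightarrow> (\<forall>z\<in>M. E z (v f) \<longleftrightarrow> z \<in> (\<lambda>x. opair x x) ` elts E (v D))"
    using mem_M[OF _ asg_M[OF v(1), of D]] by (intro ball_cong refl) auto
  also have "\<dots> \<longleftrightarrow> v f = fn (elts E (v D)) (\<lambda>x. x)"
    unfolding fn_def using elts_iff_M[OF asg_M[OF v(1)] I] by blast
  finally show ?thesis .
qed

lemma cfun_cone: "A \<in> M \<Longrightarrow> cfun (cone A) (\<lambda>x. x) A"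
  unfolding cfun_def using isset_cone[of A] isset_id[of "cone A"] bij_betw_id[of "cone A"] by (simp add: id_def)

lemma minus_of_Q2: "Q2 A B \<Longrightarrow> B \<in> graph E M C2 \<and> minus_of E M C2 B A"
  unfolding Q2_def graph_C2 using minus_of_C2[OF pfm_C(4-6) lang_C(3,4) P_C(2) graph_C2] by blast

lemma con_domain_C2_Q2: "A \<in> con_domain E M C2 \<Longrightarrow> \<exists>B. Q2 A B"
  unfolding Q2_def con_domain_C2[OF pfm_C(4-6) lang_C(3,4) P_C(2) graph_C2] by blast

text \<open>The unstructured point over the transitive closure of \<open>A\<close> carries an expansion of \<open>A\<close>, so
  a uniformisation of \<open>C1\<close> selects such an expansion definably.\<close>

lemma uniformisable_C2:
  assumes "uniformisable E M C1" shows "uniformisable E M C2"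
proof -
  obtain \<psi> where \<psi>: "pfm_over M \<psi>"
    and uni: "\<And>A. A \<in> con_domain E M C1 \<Longrightarrow> \<exists>B\<in>graph E M C1. minus_of E M C1 B A \<and>
      (\<forall>B'\<in>M. holds2 E M \<psi> A B' \<longleftrightarrow> B' = B)"
    using assms unfolding uniformisable_def by blast
  define \<phi> w where "\<phi> = fst \<psi>" and "w = snd \<psi>"
  have w: "asg w" using \<psi> unfolding pfm_over_def asg_def w_def .
  have u: "A \<in> con_domain E M C1 \<Longrightarrow> \<exists>B\<in>graph E M C1. minus_of E M C1 B A \<and>
      (\<forall>B'\<in>M. sat E M \<phi> (w(0 := A, 1 := B')) \<longleftrightarrow> B' = B)" for A
    using uni[of A] unfolding holds2_def \<phi>_def w_def .
  \<comment> \<open>The given formula may use any variables. Its arguments 0 and 1 become 8 and 9;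
    all others move beyond 1000, clear of the variables used in \<open>\<chi>\<close>, and
    \<open>v0\<close> supplies their values there.\<close>
  define r :: "nat \<Rightarrow> nat" where "r i = (if i = 0 then 8 else if i = 1 then 9 else i + 1000)" for i
  have r: "inj r" unfolding r_def inj_def by auto
  define v0 where "v0 i = (if i \<ge> 1000 then w (i - 1000) else par i)" for i
  have v0: "asg v0" using w asg_par unfolding asg_def v0_def by auto
  have v0s: "v0 2 = sE" "v0 3 = sP" unfolding v0_def by simp_all
  \<comment> \<open>Variables 6 to 9 are the closure of argument 0, the identity as its collapse,
    the rigid structure on it, and the expansion selected by \<open>\<phi>\<close>. Argument 1 is
    decoded from the extra point of that expansion.\<close>
  define \<chi> where "\<chi> = fEx 6 (fEx 7 (fEx 8 (fEx 9 (FAnd (fCone 10 6 0) (FAnd (fId 10 7 6)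
     (FAnd (fA1 10 8 6 7) (FAnd (ren r \<phi>) (fB1 10 9 6 7 1))))))))"
  let ?i = "\<lambda>x::'v. x"
  have sat: "sat E M \<chi> (v0(0 := A, 1 := B)) \<longleftrightarrow> sat E M \<phi> (w(0 := A1 (cone A) ?i, 1 := B1 (cone A) ?i B))"
    if A: "A \<in> M" and B: "B \<in> M" for A B
  proof -
    note c = cfun_cone[OF A]
    have S: "isset (cone A)" by (rule isset_cone[OF A])
    have M: "mk (cone A) \<in> M" "fn (cone A) ?i \<in> M" "A1 (cone A) ?i \<in> M" "B1 (cone A) ?i B \<in> M"
      using S cfun_fn[OF c] A1_M[OF c] B1_M[OF c B] by simp_all
    let ?v = "\<lambda>t f a b. v0(0 := A, 1 := B, 6 := t, 7 := f, 8 := a, 9 := b)"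
    have vr: "?v t f a b \<circ> r = w(0 := a, 1 := b)" for t f a b
      unfolding r_def v0_def by (auto simp: fun_eq_iff)
    have v: "asg (?v t f a b)" if "t \<in> M" "f \<in> M" "a \<in> M" "b \<in> M" for t f a b
      using v0 A B that by simp
    have body: "sat E M (FAnd (fCone 10 6 0) (FAnd (fId 10 7 6) (FAnd (fA1 10 8 6 7) (FAnd (ren r \<phi>) (fB1 10 9 6 7 1)))))
        (?v t f a b) \<longleftrightarrow> t = mk (cone A) \<and> f = fn (cone A) ?i \<and> a = A1 (cone A) ?i \<and>
          b = B1 (cone A) ?i B \<and> sat E M \<phi> (w(0 := a, 1 := b))"
      if m: "t \<in> M" "f \<in> M" "a \<in> M" "b \<in> M" for t f a b
    proof -
      have 1: "sat E M (fCone 10 6 0) (?v t f a b) \<longleftrightarrow> t = mk (cone A)"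
        using sat_fCone[OF v[OF m], of 6 10 0] S by simp
      have 2: "sat E M (fId 10 7 6) (?v t f a b) \<longleftrightarrow> f = fn (elts E t) ?i"
        using sat_fId[OF v[OF m], of 7 10 6] by simp
      have 3: "sat E M (fA1 10 8 6 7) (?v t f a b) \<longleftrightarrow> a = A1 (cone A) ?i"
        "sat E M (fB1 10 9 6 7 1) (?v t f a b) \<longleftrightarrow> b = B1 (cone A) ?i B"
        if "t = mk (cone A)" "f = fn (cone A) ?i"
        using sat_fA1[OF v[OF m], of 8 10 6 7 ?i A] sat_fB1[OF v[OF m], of 9 10 6 7 1 ?i A] that S c v0s
        by simp_all
      have 4: "sat E M (ren r \<phi>) (?v t f a b) \<longleftrightarrow> sat E M \<phi> (w(0 := a, 1 := b))"
        unfolding sat_ren[OF r] vr ..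
      show ?thesis unfolding sat.simps 1 2 4 using 3 S by auto
    qed
    have "sat E M \<chi> (v0(0 := A, 1 := B)) \<longleftrightarrow> (\<exists>t\<in>M. \<exists>f\<in>M. \<exists>a\<in>M. \<exists>b\<in>M. t = mk (cone A) \<and> f = fn (cone A) ?i \<and>
        a = A1 (cone A) ?i \<and> b = B1 (cone A) ?i B \<and> sat E M \<phi> (w(0 := a, 1 := b)))"
      unfolding \<chi>_def sat_connectives by (intro bex_cong refl) (rule body)
    then show ?thesis using M by blast
  qed
  show ?thesis
    unfolding uniformisable_def
  proof (intro exI[of _ "(\<chi>, v0)"] conjI ballI)
    show "pfm_over M (\<chi>, v0)" using v0 unfolding pfm_over_def asg_def by simp
    fix A assume "A \<in> con_domain E M C2"
    then obtain B0 where "Q2 A B0" using con_domain_C2_Q2 by blast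
    then have A: "A \<in> M" using Q2_M by blast
    note c = cfun_cone[OF A]
    have "A1 (cone A) ?i \<in> con_domain E M C1" unfolding con_domain_C1 using c \<open>Q2 A B0\<close> by blast
    then obtain B' where B': "B' \<in> graph E M C1" "minus_of E M C1 B' (A1 (cone A) ?i)"
      "\<And>B''. B'' \<in> M \<Longrightarrow> sat E M \<phi> (w(0 := A1 (cone A) ?i, 1 := B'')) \<longleftrightarrow> B'' = B'"
      using u by blast
    \<comment> \<open>The selected expansion is presented by some \<open>h\<close> and
      \<open>A'\<close> of its own. The base is the closure of \<open>A\<close> with true
      membership, so \<open>collapse_unique\<close> will force \<open>h\<close> to be the identity
      there and \<open>A' = A\<close>; thus \<open>B\<close> expands the right set.\<close>
    obtain D h A' B where c': "cfun D h A'" "Q2 A' B" "B' = B1 D h B"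
      using B'(1) unfolding graph_C1 by blast
    have B: "B \<in> M" using Q2_M[OF c'(2)] by blast
    have eq: "A1 (cone A) ?i = A1 D h" using B'(2) minus_of_C1[OF c'(1) B] c'(3) by simp
    have D: "D = cone A" using univ_A1[OF c] univ_A1[OF c'(1)] eq by simp
    have "r1 (cone A) ?i sE = r1 D h sE"
      using struct_inject(2)[OF good_A1[OF c] good_A1[OF c'(1)]] eq unfolding A1_def by simp
    then have "[x, y] \<in> r1 (cone A) ?i sE \<longleftrightarrow> [x, y] \<in> r1 D h sE" for x y by simp
    then have rel: "E x y \<longleftrightarrow> E (h x) (h y)" if "x \<in> cone A" "y \<in> cone A" for x y
      using that unfolding r1_simps D by blast
    have AA: "(\<forall>x\<in>cone A. x = h x) \<and> A = A'"
      using collapse_unique[OF c c'(1)[unfolded D] rel] .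
    have "B1 D h B = B1 (cone A) ?i B"
      unfolding B1_def D
    proof (rule struct_cong[OF refl refl])
      fix s assume "s \<in> {sE, sP}"
      have "h x = x" if "x \<in> cone A" for x using AA that by simp
      then show "r1 (cone A) h s = r1 (cone A) ?i s" unfolding r1_def by (simp cong: conj_cong)
    qed
    then have B1: "B' = B1 (cone A) ?i B" using c'(3) by simp
    have Q: "Q2 A B" using c'(2) AA by simp
    \<comment> \<open>Unique selection of the expansion becomes unique selection of
      \<open>B\<close>, because different sets give different extra points.\<close>
    have "holds2 E M (\<chi>, v0) A X \<longleftrightarrow> X = B" if X: "X \<in> M" for X
      unfolding holds2_def fst_conv snd_conv sat[OF A X] B'(3)[OF B1_M[OF c X]] B1
      by (rule B1_inject[OF c X B])
    then show "\<exists>B\<in>graph E M C2. minus_of E M C2 B A \<and> (\<forall>B'\<in>M. holds2 E M (\<chi>, v0) A B' \<longleftrightarrow> B' = B)"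
      using minus_of_Q2[OF Q] by blast
  qed
qed

lemmas C2_facts = pfm_C(4-6) lang_C(3,4) P_C(2) graph_C2

lemma not_rigid_unif_and_weakly_natural:
  "\<not> ((\<forall>C. is_construction E M C \<and> rigid_based E M C \<longrightarrow> uniformisable E M C) \<and>
      (\<forall>C. is_construction E M C \<and> unitype E M C \<and> uniformisable E M C \<longrightarrow> weakly_natural E M C))"
  using uniformisable_C2 is_construction_C1 rigid_based_C1 is_construction_C2[OF C2_facts]
    unitype_C2[OF C2_facts] not_weakly_natural_C2[OF C2_facts] by blast

lemma not_natural_iff_uniformisable:
  "\<not> (\<forall>C. is_construction E M C \<longrightarrow> (natural E M C \<longleftrightarrow> uniformisable E M C))"
  using uniformisable_C2 is_construction_C1 natural_C1 is_construction_C2[OF C2_facts]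
    not_natural_C2[OF C2_facts] by blast

end

theorem theorem2:
  fixes E :: "'v \<Rightarrow> 'v \<Rightarrow> bool"
  assumes "set_universe E"
  shows "(\<nexists>M. transitive_ZFC_model E M \<and>
            (\<forall>C. is_construction E M C \<and> rigid_based E M C \<longrightarrow> uniformisable E M C) \<and>
            (\<forall>C. is_construction E M C \<and> unitype E M C \<and> uniformisable E M C
               \<longrightarrow> weakly_natural E M C)) \<and>
         (\<nexists>M. transitive_ZFC_model E M \<and>
            (\<forall>C. is_construction E M C \<longrightarrow> (natural E M C \<longleftrightarrow> uniformisable E M C)))"
proof -
  have "zfc_model E M" if "transitive_ZFC_model E M" for M
    using assms that by unfold_locales
  then show ?thesis
    using zfc_model.not_rigid_unif_and_weakly_natural zfc_model.not_natural_iff_uniformisable by blast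
qed

end
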